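(* Let $\mathcal{G}_{\rm LQ}$ be the linear-quadratic game described in the context. For all $i,h,\ell\in I_N$, $\phi\in\pi^{(N)}$, $\phi_h'\in\pi_h$, $\phi_\ell''\in\pi_\ell$ and $(t,x)\in[0,T]\times\mathbb{R}^{n_x}$, $$\frac{\delta V_i^{t,x}}{\delta\phi_h}(\phi;\phi_h')=\frac{\delta\overline{V}_i^\phi}{\delta\phi_h}(t,x;\phi_h'),\qquad\frac{\delta^2V_i^{t,x}}{\delta\phi_h\delta\phi_\ell}(\phi;\phi_h',\phi_\ell'')=\frac{\delta^2\overline{V}_i^\phi}{\delta\phi_h\delta\phi_\ell}(t,x;\phi_h',\phi_\ell''),$$ where the left-hand sides are the probabilistic expressions and the right-hand sides the ODE (PDE) expressions given in the context. That is, for every $(t,x)$, the condition $$\frac{\delta^2V_i^{t,x}}{\delta\phi_i\delta\phi_j}(\phi;\phi_i',\phi_j'')=\frac{\delta^2V_j^{t,x}}{\delta\phi_j\delta\phi_i}(\phi;\phi_j'',\phi_i')\quad\text{for all }\phi\in\pi^{(N)},\ i,j\in I_N,\ \phi_i'\in\pi_i,\ \phi_j''\in\pi_j$$ is equivalent to the condition $$\frac{\delta^2\overline V_i^{\phi}}{\delta\phi_i\delta\phi_j}(t,x;\phi_i',\phi_j'')=\frac{\delta^2\overline V_j^{\phi}}{\delta\phi_j\delta\phi_i}(t,x;\phi_j'',\phi_i')\quad\text{for all }\phi\in\pi^{(N)},\ i,j\in I_N,\ \phi_i'\in\pi_i,\ \phi_j''\in\pi_j.$$ Consequently, if there exists $(t,x)\in[0,T]\times\mathbb{R}^{n_x}$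 such that for all $i,j\in I_N$ with $i\ne j$, $\phi\in\pi^{(N)}$, $\phi_i'\in\pi_i$ and $\phi_j''\in\pi_j$, $$\tfrac12x^\top\Lambda_i^{i,j}(t)x+\lambda_i^{i,j}(t)=\tfrac12x^\top\Lambda_j^{j,i}(t)x+\lambda_j^{j,i}(t),$$ then $\mathcal{G}_{\rm LQ}$ with initial condition $(t,x)$ is a closed-loop potential game. Moreover, $\mathcal{G}_{\rm LQ}$ is a Markov potential game if and only if for all $i,j\in I_N$ with $i\neq j$, $\phi\in\pi^{(N)}$, $\phi_i'\in\pi_i$ and $\phi_j''\in\pi_j$, $$\Lambda_i^{i,j}(t)=\Lambda_j^{j,i}(t)\qquad\forall t\in[0,T].$$ (In $\Lambda_i^{i,j},\lambda_i^{i,j}$ player $i$'s direction is $\phi_i'$ and player $j$'s direction is $\phi_j''$; in $\Lambda_j^{j,i},\lambda_j^{j,i}$ the first direction is $\phi_j''$ and the second is $\phi_i'$.)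
   Context: The game $\mathcal{G}_{\rm LQ}$. $I_N=\{1,\dots,N\}$, $T>0$, $\mathcal{S}=[0,T]\times\mathbb{R}^{n_x}$, $A_i=\mathbb{R}^{k_i}$, $n_a=\sum_ik_i$, $\pi^{(N)}=\prod_i\pi_i$, where $\pi_i=\{\phi:[0,T]\times\mathbb{R}^{n_x}\to\mathbb{R}^{k_i}\mid\phi(t,x)=K_i(t)x,\ K_i\in C([0,T];\mathbb{R}^{k_i\times n_x})\}$; a policy $\phi_i$ is identified with $K_i$ and a profile $\phi$ with $K=(K_i)_{i\in I_N}\in C([0,T];\mathbb{R}^{n_a\times n_x})$. $\mathbb{S}^n$ denotes symmetric $n\times n$ matrices. Coefficients: $A\in C([0,T];\mathbb{R}^{n_x\times n_x})$, $B\in C([0,T];\mathbb{R}^{n_x\times n_a})$, $\sigma\in\mathbb{R}^{n_x\times n_w}$, $Q_i\in C([0,T];\mathbb{S}^{n_x})$, $R_i\in C([0,T];\mathbb{S}^{n_a})$, $G_i\in\mathbb{S}^{n_x}$. $W$ is an $n_w$-dimensional standard Brownian motion. $X^{t,x,\phi}$ solves $\mathrm{d}X_s=(A(s)X_s+B(s)K(s)X_s)\mathrm{d}s+\sigma\,\mathrm{d}W_s$, $s\in[t,T]$, $X_t=x$, and $$V_i^\phi(t,x)=\tfrac12\mathbb{E}\left[\int_t^T\Big((X_s^{t,x,\phi})^\top Q_i(s)X_s^{t,x,\phi}+(K(s)X_s^{t,x,\phi})^\top R_i(s)K(s)X_s^{t,x,\phi}\Big)\mathrm{d}s+(X_T^{t,x,\phi})^\top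 G_iX_T^{t,x,\phi}\right].$$ Block form: $B=(B_1,\dots,B_N)$, $R_i=((R_i)_1,\dots,(R_i)_N)=((R_i)_{h\ell})_{h,\ell\in I_N}$ with $B_\ell(t)\in\mathbb{R}^{n_x\times k_\ell}$, $(R_i)_\ell(t)\in\mathbb{R}^{n_a\times k_\ell}$, $(R_i)_{h\ell}(t)\in\mathbb{R}^{k_h\times k_\ell}$. $E_j\in\mathbb{R}^{n_a\times k_j}$ is the block matrix whose $j$-th block row is the identity and other block rows are zero. The time variable of coefficients is dropped below. Probabilistic expressions. For $\phi=K$, $\phi_h'=K_h'$, $\phi_\ell''=K_\ell''$, $X=X^{t,x,\phi}$, let $Y^h$, $Y^\ell$, $Z$ solve on $[t,T]$: $\mathrm{d}Y^h_s=((A+BK)Y_s^h+B_hK_h'X_s)\mathrm{d}s$, $Y_t^h=0$; $\mathrm{d}Y_s^\ell=((A+BK)Y_s^\ell+B_\ell K_\ell''X_s)\mathrm{d}s$, $Y^\ell_t=0$; $\mathrm{d}Z_s=((A+BK)Z_s+B_\ell K_\ell''Y_s^h+B_hK_h'Y_s^\ell)\mathrm{d}s$, $Z_t=0$. (When $h=\ell$, $Y^h$ refers to direction $K_h'$ and $Y^\ell$ to direction $K_\ell''$.) Then $$\frac{\delta V_i^{t,x}}{\delta\phi_h}(\phi;\phi_h')=\mathbb{E}\left[\int_t^T\Big(X_s^\top Q_iY_s^h+(KX_s)^\top(R_iKY_s^h+(R_i)_hK_h'X_s)\Big)\mathrm{d}s+X_T^\top G_iY_T^h\right],$$ $$\begin{aligned}\frac{\delta^2V_i^{t,x}}{\delta\phi_h\delta\phi_\ell}(\phi;\phi_h',\phi_\ell'')=\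 &\mathbb{E}\left[\int_t^T\Big((Y_s^\ell)^\top Q_iY_s^h+(KY_s^\ell+E_\ell K_\ell''X_s)^\top R_i(KY_s^h+E_hK_h'X_s)\Big)\mathrm{d}s\right]\\&+\mathbb{E}\left[\int_t^T\Big(X_s^\top Q_iZ_s+(KX_s)^\top R_i(KZ_s+E_\ell K_\ell''Y_s^h+E_hK_h'Y_s^\ell)\Big)\mathrm{d}s\right]\\&+\mathbb{E}\left[(Y_T^\ell)^\top G_iY_T^h+X_T^\top G_iZ_T\right].\end{aligned}$$ ODE expressions. $\frac{\delta\overline V_i^\phi}{\delta\phi_h}(t,x;\phi_h')=\frac12x^\top\Theta_i^h(t)x+\theta_i^h(t)$ and $\frac{\delta^2\overline V_i^\phi}{\delta\phi_h\delta\phi_\ell}(t,x;\phi_h',\phi_\ell'')=\frac12x^\top\Lambda_i^{h,\ell}(t)x+\lambda_i^{h,\ell}(t)$, where $\Psi_i,\Theta_i^h,\Lambda_i^{h,\ell}\in C([0,T];\mathbb{S}^{n_x})$ solve on $[0,T]$ $$\dot\Psi_i+(A+BK)^\top\Psi_i+\Psi_i(A+BK)+Q_i+K^\top R_iK=0,\quad\Psi_i(T)=G_i,$$ $$\dot\Theta_i^h+(A+BK)^\top\Theta_i^h+\Theta_i^h(A+BK)+\Psi_iB_hK_h'+(B_hK_h')^\top\Psi_i+K^\top(R_i)_hK_h'+(K_h')^\top((R_i)_h)^\top K=0,\quad\Theta_i^h(T)=0,$$ $$\begin{aligned}&\dot\Lambda_i^{h,\ell}+(A+BK)^\top\Lambda_i^{h,\ell}+\Lambda_i^{h,\ell}(A+BK)+\Theta_i^hB_\ell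 K_\ell''+(B_\ell K_\ell'')^\top\Theta_i^h+\Theta_i^\ell B_hK_h'+(B_hK_h')^\top\Theta_i^\ell\\&+(K_\ell'')^\top(R_i)_{\ell h}K_h'+(K_h')^\top((R_i)_{\ell h})^\top K_\ell''=0,\quad\Lambda_i^{h,\ell}(T)=0,\end{aligned}$$ with $\Theta_i^\ell$ being defined with direction $K_\ell''$, and $\theta_i^h,\lambda_i^{h,\ell}\in C([0,T];\mathbb{R})$ solve $\dot\theta_i^h+\frac12\mathrm{tr}(\sigma\sigma^\top\Theta_i^h)=0$, $\theta_i^h(T)=0$; $\dot\lambda_i^{h,\ell}+\frac12\mathrm{tr}(\sigma\sigma^\top\Lambda_i^{h,\ell})=0$, $\lambda_i^{h,\ell}(T)=0$. The dependence of $\Theta_i^h,\theta_i^h$ on $(K,K_h')$ and of $\Lambda_i^{h,\ell},\lambda_i^{h,\ell}$ on $(K,K_h',K_\ell'')$ is suppressed in the notation. Potential games. The game with initial condition $(t,x)$ is a closed-loop potential game if there is $\Phi^{t,x}:\pi^{(N)}\to\mathbb{R}$ (a potential function) with $\Phi^{t,x}((\phi_i',\phi_{-i}))-\Phi^{t,x}((\phi_i,\phi_{-i}))=V_i^{(\phi_i',\phi_{-i})}(t,x)-V_i^{(\phi_i,\phi_{-i})}(t,x)$ for all $i\in I_N$, $\phi_i,\phi_i'\in\pi_i$, $\phi_{-i}\in\prod_{j\ne i}\pi_j$. It is a Markov potential game if there is $\Phi:\mathcal{S}\times\pi^{(N)}\to\mathbb{R}$ such that for every $(t,x)\in\mathcal{S}$,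 $\Phi(t,x,\cdot)$ is a potential function of the game with initial condition $(t,x)$. *)

theory Defs
  imports "HOL-Probability.Probability"
begin

text \<open>
  Encoding of the dimensions. The state, noise and action-coordinate indices are the finite
  types 'x, 'w and 'a, and the set of players is the finite type 'p. Hence n_x, n_w, n_a and N
  are the cardinalities of 'x, 'w, 'a and 'p.

  Since k_i depends on the player i, R^(k_i) is not a type of its own. The function owner
  assigns each action coordinate to a player, and R^(k_i) is the space of vectors in R^'a that
  are supported on the coordinates owned by i, so that k_i = card {a. owner a = i}. A block with
  k_h rows or k_l columns is accordingly padded with zeros to n_a rows or columns.
\<close>

record ('x, 'a, 'w, 'p, 'o) lq_data =
  horizon :: real
  owner :: "'a \<Rightarrow> 'p"
  cA :: "real \<Rightarrow> real^'x^'x"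
  cB :: "real \<Rightarrow> real^'a^'x"
  sig :: "real^'w^'x"
  cQ :: "'p \<Rightarrow> real \<Rightarrow> real^'x^'x"
  cR :: "'p \<Rightarrow> real \<Rightarrow> real^'a^'a"
  cG :: "'p \<Rightarrow> real^'x^'x"
  Om :: "'o measure"
  BM :: "real \<Rightarrow> 'o \<Rightarrow> real^'w"

definition sym_mat :: "real^'n^'n \<Rightarrow> bool" where
  "sym_mat M \<longleftrightarrow> transpose M = M"

text \<open>
  Standard 'w-dimensional Brownian motion on the time interval [0,T]. Joint independence over
  both the time steps and the coordinates expresses that the vector-valued increments are
  independent and that each of them has independent coordinates.
\<close>

definition std_brownian_motion ::
    "'o measure \<Rightarrow> real \<Rightarrow> (real \<Rightarrow> 'o \<Rightarrow> real^'w) \<Rightarrow> bool" where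
  "std_brownian_motion M T W \<longleftrightarrow>
     prob_space M \<and>
     (\<forall>s\<in>{0..T}. W s \<in> borel_measurable M) \<and>
     (AE \<omega> in M. W 0 \<omega> = 0) \<and>
     (AE \<omega> in M. continuous_on {0..T} (\<lambda>s. W s \<omega>)) \<and>
     (\<forall>s u k. 0 \<le> s \<and> s < u \<and> u \<le> T \<longrightarrow>
        distributed M lborel (\<lambda>\<omega>. (W u \<omega> - W s \<omega>) $ k) (normal_density 0 (sqrt (u - s)))) \<and>
     (\<forall>(n::nat) \<tau>. (\<forall>j\<le>n. \<tau> j \<in> {0..T}) \<and> (\<forall>j<n. \<tau> j < \<tau> (Suc j)) \<longrightarrow>
        prob_space.indep_vars M (\<lambda>_. borel)
          (\<lambda>(j, k) \<omega>. (W (\<tau> (Suc j)) \<omega> - W (\<tau> j) \<omega>) $ k) ({..<n} \<times> (UNIV :: 'w set)))"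

definition lq_game :: "('x::finite, 'a::finite, 'w::finite, 'p::finite, 'o) lq_data \<Rightarrow> bool" where
  "lq_game g \<longleftrightarrow>
     0 < horizon g \<and>
     continuous_on {0..horizon g} (cA g) \<and>
     continuous_on {0..horizon g} (cB g) \<and>
     (\<forall>i. continuous_on {0..horizon g} (cQ g i) \<and> (\<forall>t\<in>{0..horizon g}. sym_mat (cQ g i t))) \<and>
     (\<forall>i. continuous_on {0..horizon g} (cR g i) \<and> (\<forall>t\<in>{0..horizon g}. sym_mat (cR g i t))) \<and>
     (\<forall>i. sym_mat (cG g i)) \<and>
     std_brownian_motion (Om g) (horizon g) (BM g)"


text \<open>
  Policies. An element of the policy space of player i is K_i in C([0,T]; R^(k_i x n_x)), padded
  with zero rows. The value 0 outside [0,T] is a normalisation making the representation of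
  functions on [0,T] by functions on the reals unique.
\<close>

definition policies :: "('x::finite, 'a::finite, 'w::finite, 'p::finite, 'o) lq_data \<Rightarrow>
    'p \<Rightarrow> (real \<Rightarrow> real^'x^'a) set" where
  "policies g i = {K. continuous_on {0..horizon g} K \<and>
     (\<forall>t\<in>{0..horizon g}. \<forall>a. owner g a \<noteq> i \<longrightarrow> K t $ a = 0) \<and>
     (\<forall>t. t \<notin> {0..horizon g} \<longrightarrow> K t = 0)}"

definition profiles :: "('x::finite, 'a::finite, 'w::finite, 'p::finite, 'o) lq_data \<Rightarrow>
    ('p \<Rightarrow> real \<Rightarrow> real^'x^'a) set" where
  "profiles g = {\<phi>. \<forall>i. \<phi> i \<in> policies g i}"

definition stack :: "('x::finite, 'a::finite, 'w::finite, 'p::finite, 'o) lq_data \<Rightarrow>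
    ('p \<Rightarrow> real \<Rightarrow> real^'x^'a) \<Rightarrow> real \<Rightarrow> real^'x^'a" where
  "stack g \<phi> t = (\<chi> a. \<phi> (owner g a) t $ a)"


text \<open>
  Blocks, zero-padded: col_block own l M is M_l (block column l), block own h l M is M_(hl), and
  emb own j is the block embedding E_j.
\<close>

definition col_block :: "('a::finite \<Rightarrow> 'p) \<Rightarrow> 'p \<Rightarrow> real^'a^'m \<Rightarrow> real^'a^'m" where
  "col_block own l M = (\<chi> r c. if own c = l then M $ r $ c else 0)"

definition block :: "('a::finite \<Rightarrow> 'p) \<Rightarrow> 'p \<Rightarrow> 'p \<Rightarrow> real^'a^'a \<Rightarrow> real^'a^'a" where
  "block own h l M = (\<chi> r c. if own r = h \<and> own c = l then M $ r $ c else 0)"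

definition emb :: "('a::finite \<Rightarrow> 'p) \<Rightarrow> 'p \<Rightarrow> real^'a^'a" where
  "emb own j = (\<chi> r c. if r = c \<and> own c = j then 1 else 0)"

abbreviation cBl :: "('x::finite, 'a::finite, 'w::finite, 'p::finite, 'o) lq_data \<Rightarrow>
    'p \<Rightarrow> real \<Rightarrow> real^'a^'x" where
  "cBl g l s \<equiv> col_block (owner g) l (cB g s)"

definition closed_loop :: "('x::finite, 'a::finite, 'w::finite, 'p::finite, 'o) lq_data \<Rightarrow>
    ('p \<Rightarrow> real \<Rightarrow> real^'x^'a) \<Rightarrow> real \<Rightarrow> real^'x^'x" where
  "closed_loop g \<phi> s = cA g s + cB g s ** stack g \<phi> s"


text \<open>
  State and sensitivity processes. Because the noise is additive, the state equation reads, in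
  integrated form, as an equation between paths, and no stochastic integral is needed. Solutions
  are measurable at each time, have continuous paths, and are unique up to indistinguishability
  (hence automatically adapted up to null sets), so the expectations below do not depend on the
  version that SOME selects.
\<close>

definition cont_process :: "'o measure \<Rightarrow> real set \<Rightarrow> (real \<Rightarrow> 'o \<Rightarrow> real^'x) \<Rightarrow> bool" where
  "cont_process M I U \<longleftrightarrow>
     (\<forall>s\<in>I. U s \<in> borel_measurable M) \<and> (\<forall>\<omega>\<in>space M. continuous_on I (\<lambda>s. U s \<omega>))"

definition state :: "('x::finite, 'a::finite, 'w::finite, 'p::finite, 'o) lq_data \<Rightarrow>
    ('p \<Rightarrow> real \<Rightarrow> real^'x^'a) \<Rightarrow> real \<Rightarrow> real^'x \<Rightarrow> real \<Rightarrow> 'o \<Rightarrow> real^'x" where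
  "state g \<phi> t x = (SOME X. cont_process (Om g) {t..horizon g} X \<and>
     (AE \<omega> in Om g. \<forall>s\<in>{t..horizon g}.
        X s \<omega> = x + integral {t..s} (\<lambda>r. cA g r *v X r \<omega> + cB g r *v (stack g \<phi> r *v X r \<omega>))
              + sig g *v (BM g s \<omega> - BM g t \<omega>)))"

definition sens1 :: "('x::finite, 'a::finite, 'w::finite, 'p::finite, 'o) lq_data \<Rightarrow>
    ('p \<Rightarrow> real \<Rightarrow> real^'x^'a) \<Rightarrow> real \<Rightarrow> real^'x \<Rightarrow> 'p \<Rightarrow> (real \<Rightarrow> real^'x^'a) \<Rightarrow>
    real \<Rightarrow> 'o \<Rightarrow> real^'x" where
  "sens1 g \<phi> t x h K' = (SOME Y. cont_process (Om g) {t..horizon g} Y \<and>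
     (AE \<omega> in Om g. \<forall>s\<in>{t..horizon g}.
        Y s \<omega> = integral {t..s} (\<lambda>r. closed_loop g \<phi> r *v Y r \<omega>
                  + cBl g h r *v (K' r *v state g \<phi> t x r \<omega>))))"

definition sens2 :: "('x::finite, 'a::finite, 'w::finite, 'p::finite, 'o) lq_data \<Rightarrow>
    ('p \<Rightarrow> real \<Rightarrow> real^'x^'a) \<Rightarrow> real \<Rightarrow> real^'x \<Rightarrow>
    'p \<Rightarrow> (real \<Rightarrow> real^'x^'a) \<Rightarrow> 'p \<Rightarrow> (real \<Rightarrow> real^'x^'a) \<Rightarrow>
    real \<Rightarrow> 'o \<Rightarrow> real^'x" where
  "sens2 g \<phi> t x h K' l K'' = (SOME Z. cont_process (Om g) {t..horizon g} Z \<and>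
     (AE \<omega> in Om g. \<forall>s\<in>{t..horizon g}.
        Z s \<omega> = integral {t..s} (\<lambda>r. closed_loop g \<phi> r *v Z r \<omega>
                  + cBl g l r *v (K'' r *v sens1 g \<phi> t x h K' r \<omega>)
                  + cBl g h r *v (K' r *v sens1 g \<phi> t x l K'' r \<omega>))))"

definition value_fn :: "('x::finite, 'a::finite, 'w::finite, 'p::finite, 'o) lq_data \<Rightarrow>
    'p \<Rightarrow> ('p \<Rightarrow> real \<Rightarrow> real^'x^'a) \<Rightarrow> real \<Rightarrow> real^'x \<Rightarrow> real" where
  "value_fn g i \<phi> t x = (let T = horizon g; X = state g \<phi> t x; K = stack g \<phi> in
     1/2 * prob_space.expectation (Om g) (\<lambda>\<omega>.
       integral {t..T} (\<lambda>s. X s \<omega> \<bullet> (cQ g i s *v X s \<omega>)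
                          + (K s *v X s \<omega>) \<bullet> (cR g i s *v (K s *v X s \<omega>)))
       + X T \<omega> \<bullet> (cG g i *v X T \<omega>)))"


definition prob_deriv1 :: "('x::finite, 'a::finite, 'w::finite, 'p::finite, 'o) lq_data \<Rightarrow>
    'p \<Rightarrow> ('p \<Rightarrow> real \<Rightarrow> real^'x^'a) \<Rightarrow> real \<Rightarrow> real^'x \<Rightarrow>
    'p \<Rightarrow> (real \<Rightarrow> real^'x^'a) \<Rightarrow> real" where
  "prob_deriv1 g i \<phi> t x h K' =
     (let T = horizon g; X = state g \<phi> t x; Y = sens1 g \<phi> t x h K'; K = stack g \<phi> in
      prob_space.expectation (Om g) (\<lambda>\<omega>.
        integral {t..T} (\<lambda>s. X s \<omega> \<bullet> (cQ g i s *v Y s \<omega>)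
          + (K s *v X s \<omega>) \<bullet> (cR g i s *v (K s *v Y s \<omega>)
                              + col_block (owner g) h (cR g i s) *v (K' s *v X s \<omega>)))
        + X T \<omega> \<bullet> (cG g i *v Y T \<omega>)))"

definition prob_deriv2 :: "('x::finite, 'a::finite, 'w::finite, 'p::finite, 'o) lq_data \<Rightarrow>
    'p \<Rightarrow> ('p \<Rightarrow> real \<Rightarrow> real^'x^'a) \<Rightarrow> real \<Rightarrow> real^'x \<Rightarrow>
    'p \<Rightarrow> (real \<Rightarrow> real^'x^'a) \<Rightarrow> 'p \<Rightarrow> (real \<Rightarrow> real^'x^'a) \<Rightarrow> real" where
  "prob_deriv2 g i \<phi> t x h K' l K'' =
     (let T = horizon g; X = state g \<phi> t x; K = stack g \<phi>;
          Yh = sens1 g \<phi> t x h K'; Yl = sens1 g \<phi> t x l K''; Z = sens2 g \<phi> t x h K' l K'';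
          Eh = emb (owner g) h; El = emb (owner g) l in
      prob_space.expectation (Om g) (\<lambda>\<omega>.
        integral {t..T} (\<lambda>s. Yl s \<omega> \<bullet> (cQ g i s *v Yh s \<omega>)
          + (K s *v Yl s \<omega> + El *v (K'' s *v X s \<omega>)) \<bullet>
            (cR g i s *v (K s *v Yh s \<omega> + Eh *v (K' s *v X s \<omega>)))))
      + prob_space.expectation (Om g) (\<lambda>\<omega>.
        integral {t..T} (\<lambda>s. X s \<omega> \<bullet> (cQ g i s *v Z s \<omega>)
          + (K s *v X s \<omega>) \<bullet>
            (cR g i s *v (K s *v Z s \<omega> + El *v (K'' s *v Yh s \<omega>) + Eh *v (K' s *v Yl s \<omega>)))))
      + prob_space.expectation (Om g) (\<lambda>\<omega>.
        Yl T \<omega> \<bullet> (cG g i *v Yh T \<omega>) + X T \<omega> \<bullet> (cG g i *v Z T \<omega>)))"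


text \<open>
  ODE expressions. The linear terminal value problems have exactly one solution on [0,T]; the
  values of the selected solution outside [0,T] are irrelevant.
\<close>

definition ode_Psi :: "('x::finite, 'a::finite, 'w::finite, 'p::finite, 'o) lq_data \<Rightarrow>
    'p \<Rightarrow> ('p \<Rightarrow> real \<Rightarrow> real^'x^'a) \<Rightarrow> real \<Rightarrow> real^'x^'x" where
  "ode_Psi g i \<phi> = (SOME P. continuous_on {0..horizon g} P \<and>
     (\<forall>t\<in>{0..horizon g}. sym_mat (P t)) \<and>
     (\<forall>t\<in>{0..horizon g}. \<exists>P'. (P has_vector_derivative P') (at t within {0..horizon g}) \<and>
        P' + transpose (closed_loop g \<phi> t) ** P t + P t ** closed_loop g \<phi> t
           + cQ g i t + transpose (stack g \<phi> t) ** cR g i t ** stack g \<phi> t = 0) \<and>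
     P (horizon g) = cG g i)"

definition ode_Theta :: "('x::finite, 'a::finite, 'w::finite, 'p::finite, 'o) lq_data \<Rightarrow>
    'p \<Rightarrow> ('p \<Rightarrow> real \<Rightarrow> real^'x^'a) \<Rightarrow> 'p \<Rightarrow> (real \<Rightarrow> real^'x^'a) \<Rightarrow>
    real \<Rightarrow> real^'x^'x" where
  "ode_Theta g i \<phi> h K' = (SOME P. continuous_on {0..horizon g} P \<and>
     (\<forall>t\<in>{0..horizon g}. sym_mat (P t)) \<and>
     (\<forall>t\<in>{0..horizon g}. \<exists>P'. (P has_vector_derivative P') (at t within {0..horizon g}) \<and>
        P' + transpose (closed_loop g \<phi> t) ** P t + P t ** closed_loop g \<phi> t
           + ode_Psi g i \<phi> t ** (cBl g h t ** K' t)
           + transpose (cBl g h t ** K' t) ** ode_Psi g i \<phi> t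
           + transpose (stack g \<phi> t) ** col_block (owner g) h (cR g i t) ** K' t
           + transpose (K' t) ** transpose (col_block (owner g) h (cR g i t)) ** stack g \<phi> t
           = 0) \<and>
     P (horizon g) = 0)"

definition ode_Lambda :: "('x::finite, 'a::finite, 'w::finite, 'p::finite, 'o) lq_data \<Rightarrow>
    'p \<Rightarrow> ('p \<Rightarrow> real \<Rightarrow> real^'x^'a) \<Rightarrow>
    'p \<Rightarrow> (real \<Rightarrow> real^'x^'a) \<Rightarrow> 'p \<Rightarrow> (real \<Rightarrow> real^'x^'a) \<Rightarrow>
    real \<Rightarrow> real^'x^'x" where
  "ode_Lambda g i \<phi> h K' l K'' = (SOME P. continuous_on {0..horizon g} P \<and>
     (\<forall>t\<in>{0..horizon g}. sym_mat (P t)) \<and>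
     (\<forall>t\<in>{0..horizon g}. \<exists>P'. (P has_vector_derivative P') (at t within {0..horizon g}) \<and>
        P' + transpose (closed_loop g \<phi> t) ** P t + P t ** closed_loop g \<phi> t
           + ode_Theta g i \<phi> h K' t ** (cBl g l t ** K'' t)
           + transpose (cBl g l t ** K'' t) ** ode_Theta g i \<phi> h K' t
           + ode_Theta g i \<phi> l K'' t ** (cBl g h t ** K' t)
           + transpose (cBl g h t ** K' t) ** ode_Theta g i \<phi> l K'' t
           + transpose (K'' t) ** block (owner g) l h (cR g i t) ** K' t
           + transpose (K' t) ** transpose (block (owner g) l h (cR g i t)) ** K'' t
           = 0) \<and>
     P (horizon g) = 0)"

definition ode_theta :: "('x::finite, 'a::finite, 'w::finite, 'p::finite, 'o) lq_data \<Rightarrow>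
    'p \<Rightarrow> ('p \<Rightarrow> real \<Rightarrow> real^'x^'a) \<Rightarrow> 'p \<Rightarrow> (real \<Rightarrow> real^'x^'a) \<Rightarrow>
    real \<Rightarrow> real" where
  "ode_theta g i \<phi> h K' = (SOME p. continuous_on {0..horizon g} p \<and>
     (\<forall>t\<in>{0..horizon g}. \<exists>p'. (p has_real_derivative p') (at t within {0..horizon g}) \<and>
        p' + 1/2 * trace (sig g ** transpose (sig g) ** ode_Theta g i \<phi> h K' t) = 0) \<and>
     p (horizon g) = 0)"

definition ode_lambda :: "('x::finite, 'a::finite, 'w::finite, 'p::finite, 'o) lq_data \<Rightarrow>
    'p \<Rightarrow> ('p \<Rightarrow> real \<Rightarrow> real^'x^'a) \<Rightarrow>
    'p \<Rightarrow> (real \<Rightarrow> real^'x^'a) \<Rightarrow> 'p \<Rightarrow> (real \<Rightarrow> real^'x^'a) \<Rightarrow>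
    real \<Rightarrow> real" where
  "ode_lambda g i \<phi> h K' l K'' = (SOME p. continuous_on {0..horizon g} p \<and>
     (\<forall>t\<in>{0..horizon g}. \<exists>p'. (p has_real_derivative p') (at t within {0..horizon g}) \<and>
        p' + 1/2 * trace (sig g ** transpose (sig g) ** ode_Lambda g i \<phi> h K' l K'' t) = 0) \<and>
     p (horizon g) = 0)"

definition pde_deriv1 :: "('x::finite, 'a::finite, 'w::finite, 'p::finite, 'o) lq_data \<Rightarrow>
    'p \<Rightarrow> ('p \<Rightarrow> real \<Rightarrow> real^'x^'a) \<Rightarrow> real \<Rightarrow> real^'x \<Rightarrow>
    'p \<Rightarrow> (real \<Rightarrow> real^'x^'a) \<Rightarrow> real" where
  "pde_deriv1 g i \<phi> t x h K' =
     1/2 * (x \<bullet> (ode_Theta g i \<phi> h K' t *v x)) + ode_theta g i \<phi> h K' t"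

definition pde_deriv2 :: "('x::finite, 'a::finite, 'w::finite, 'p::finite, 'o) lq_data \<Rightarrow>
    'p \<Rightarrow> ('p \<Rightarrow> real \<Rightarrow> real^'x^'a) \<Rightarrow> real \<Rightarrow> real^'x \<Rightarrow>
    'p \<Rightarrow> (real \<Rightarrow> real^'x^'a) \<Rightarrow> 'p \<Rightarrow> (real \<Rightarrow> real^'x^'a) \<Rightarrow> real" where
  "pde_deriv2 g i \<phi> t x h K' l K'' =
     1/2 * (x \<bullet> (ode_Lambda g i \<phi> h K' l K'' t *v x)) + ode_lambda g i \<phi> h K' l K'' t"


definition is_potential :: "('x::finite, 'a::finite, 'w::finite, 'p::finite, 'o) lq_data \<Rightarrow>
    real \<Rightarrow> real^'x \<Rightarrow> (('p \<Rightarrow> real \<Rightarrow> real^'x^'a) \<Rightarrow> real) \<Rightarrow> bool" where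
  "is_potential g t x \<Phi> \<longleftrightarrow>
     (\<forall>i. \<forall>\<phi>\<in>profiles g. \<forall>K'\<in>policies g i.
        \<Phi> (\<phi>(i := K')) - \<Phi> \<phi> = value_fn g i (\<phi>(i := K')) t x - value_fn g i \<phi> t x)"

definition closed_loop_potential_game ::
    "('x::finite, 'a::finite, 'w::finite, 'p::finite, 'o) lq_data \<Rightarrow>
     real \<Rightarrow> real^'x \<Rightarrow> bool" where
  "closed_loop_potential_game g t x \<longleftrightarrow> (\<exists>\<Phi>. is_potential g t x \<Phi>)"

definition markov_potential_game ::
    "('x::finite, 'a::finite, 'w::finite, 'p::finite, 'o) lq_data \<Rightarrow> bool" where
  "markov_potential_game g \<longleftrightarrow>
     (\<exists>\<Phi>. \<forall>t\<in>{0..horizon g}. \<forall>x. is_potential g t x (\<Phi> t x))"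

end

theory Submission
  imports Defs
begin

text \<open>
  Every process of the game is affine in the noise and every cost is quadratic, so only first and
  second moments of the Brownian motion matter and no stochastic integral is needed. Over a fixed
  time interval the noise enters through three facts: the increments \<open>N s\<close> from the
  initial time are centred, their covariance is the identity times the elapsed time, and a later
  increment is orthogonal to the state and its sensitivities at any earlier time (locale
  \<open>standard_noise\<close>, predicate \<open>nonanticipating\<close>). They give an Ito formula under
  the expectation for \<open>U \<bullet> P V\<close> with deterministic \<open>P\<close>
  (\<open>expected_product_rule\<close>).

  If \<open>P\<close> solves a Lyapunov equation along the closed loop, the two drift terms cancel
  against the linear part of the equation for \<open>P\<close>, and only the inhomogeneities are left
  (\<open>lyapunov_product_rule\<close>). The probabilistic derivatives are then evaluated by pairing
  the sensitivity processes with the right matrices: \<open>\<Psi>\<close> with \<open>(X, Y)\<close> and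
  \<open>\<Theta>\<close> with \<open>(X, X)\<close> for the first derivative; \<open>\<Psi>\<close> with the two
  first sensitivities and with \<open>(X, Z)\<close>, each \<open>\<Theta>\<close> with \<open>X\<close> and the
  first sensitivity of the other direction, and \<open>\<Lambda>\<close> with \<open>(X, X)\<close> for the
  second. Adding these identities removes all sensitivity processes (\<open>first_sensitivity\<close>,
  \<open>second_sensitivity\<close>). Values and derivatives alike become one linear functional
  \<open>quad_functional\<close>, applied to \<open>\<Psi>\<close>, \<open>\<Theta>\<close> and \<open>\<Lambda>\<close>.

  Along a line in policy space, \<open>\<Theta>\<close> is the derivative of \<open>\<Psi>\<close> and
  \<open>\<Lambda>\<close> that of \<open>\<Theta>\<close>, uniformly in time
  (\<open>lyapunov_difference_quotient\<close>); hence the formal derivatives of the value are its true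
  directional derivatives. The equation for \<open>\<Lambda>\<close> is symmetric in its two directions.
  So the symmetry of the second derivatives across two players says exactly that the mixed second
  difference of the value over any rectangle of policies is the same for both players, and this is
  what the existence of a potential requires: a potential transfers its own mixed differences to
  all players, and conversely one is assembled player by player (\<open>potential_exists\<close>). For
  Markov games the identity holds at every state; evaluating at state 0 separates \<open>\<lambda>\<close>
  from the quadratic part, and polarisation recovers the matrix \<open>\<Lambda>\<close>.
\<close>

section \<open>Integral equations with Lipschitz right-hand side\<close>

lemma gronwall:
  fixes u :: "real \<Rightarrow> real"
  assumes u: "continuous_on {a..b} u" and L: "0 \<le> L"
    and le: "\<And>s. s \<in> {a..b} \<Longrightarrow> u s \<le> C + L * integral {a..s} u"
    and s: "s \<in> {a..b}"
  shows "u s \<le> C * exp (L * (s - a))"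
proof -
  define v where "v = (\<lambda>s. C + L * integral {a..s} u)"
  define w where "w = (\<lambda>s. v s * exp (- (L * (s - a))))"
  have dI: "((\<lambda>s. integral {a..s} u) has_real_derivative u x) (at x within {a..b})"
    if "x \<in> {a..b}" for x
    using integral_has_vector_derivative[OF u that]
    by (simp add: has_real_derivative_iff_has_vector_derivative)
  have dw: "(w has_real_derivative L * (u x - v x) * exp (- (L * (x - a)))) (at x within {a..b})"
    if "x \<in> {a..b}" for x
    unfolding w_def v_def using that
    by (auto intro!: derivative_eq_intros dI simp: algebra_simps)
  have "w s \<le> w a"
  proof (rule DERIV_nonpos_imp_decreasing_open[of a s w])
    show "a \<le> s" using s by simp
    show "\<exists>y. (w has_real_derivative y) (at x) \<and> y \<le> 0" if "a < x" "x < s" for x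
    proof (intro exI conjI)
      have x: "x \<in> {a..b}" "x \<in> interior {a..b}" using that s by auto
      show "(w has_real_derivative L * (u x - v x) * exp (- (L * (x - a)))) (at x)"
        using dw[OF x(1)] at_within_interior[OF x(2)] by simp
      have "u x \<le> v x" using le[OF x(1)] by (simp add: v_def)
      then show "L * (u x - v x) * exp (- (L * (x - a))) \<le> 0"
        using L by (simp add: mult_nonneg_nonpos mult_nonpos_nonneg)
    qed
    have "continuous_on {a..b} w"
      using dw by (meson DERIV_continuous continuous_on_eq_continuous_within)
    then show "continuous_on {a..s} w" using s by (auto intro: continuous_on_subset)
  qed
  moreover have "w a = C" by (simp add: w_def v_def)
  ultimately have "v s \<le> C * exp (L * (s - a))"
    unfolding w_def by (simp only: exp_minus) (simp add: field_simps)
  then show ?thesis using le[OF s] by (simp add: v_def)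
qed

lemma has_vector_derivative_of_integral_equation:
  fixes f :: "real \<Rightarrow> 'b::banach"
  assumes f: "continuous_on {a..b} f"
    and x: "\<And>s. s \<in> {a..b} \<Longrightarrow> x s = x0 + integral {a..s} f" and s: "s \<in> {a..b}"
  shows "(x has_vector_derivative f s) (at s within {a..b})"
proof -
  have "((\<lambda>s. x0 + integral {a..s} f) has_vector_derivative f s) (at s within {a..b})"
    using integral_has_vector_derivative[OF f s] by (auto intro!: derivative_eq_intros)
  then show ?thesis by (rule has_vector_derivative_transform[OF s, rotated]) (rule x)
qed

text \<open>
  The iterates are named because measurability of a solution in a random parameter is inherited
  from them: each iterate is measurable, and the solution is their pointwise limit.
\<close>

primrec picard_iterate ::
    "(real \<Rightarrow> 'e \<Rightarrow> 'e) \<Rightarrow> 'e::banach \<Rightarrow> real \<Rightarrow> nat \<Rightarrow> real \<Rightarrow> 'e" where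
  "picard_iterate f y0 a 0 = (\<lambda>s. y0)"
| "picard_iterate f y0 a (Suc n) =
     (\<lambda>s. y0 + integral {a..s} (\<lambda>r. f r (picard_iterate f y0 a n r)))"

theorem picard_lindelof:
  fixes f :: "real \<Rightarrow> 'e::banach \<Rightarrow> 'e"
  assumes cont: "\<And>y. continuous_on {a..b} y \<Longrightarrow> continuous_on {a..b} (\<lambda>s. f s (y s))"
    and lip: "\<And>s y z. s \<in> {a..b} \<Longrightarrow> norm (f s y - f s z) \<le> L * norm (y - z)"
  shows "\<exists>y. continuous_on {a..b} y \<and>
    (\<forall>s\<in>{a..b}. y s = y0 + integral {a..s} (\<lambda>r. f r (y r))) \<and>
    (\<forall>s\<in>{a..b}. (\<lambda>n. picard_iterate f y0 a n s) \<longlonglongrightarrow> y s)"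
proof -
  define p where "p = picard_iterate f y0 a"
  have p0: "p 0 = (\<lambda>s. y0)" and pS: "p (Suc n) s = y0 + integral {a..s} (\<lambda>r. f r (p n r))"
    for n s by (simp_all add: p_def)
  have indef: "continuous_on {a..b} (\<lambda>s. integral {a..s} g)" if "continuous_on {a..b} g" for g :: "real \<Rightarrow> 'e"
    using integral_has_vector_derivative[OF that]
    by (meson continuous_on_eq_continuous_within has_vector_derivative_continuous)
  have pc: "continuous_on {a..b} (p n)" for n
  proof (induction n)
    case (Suc n)
    have "continuous_on {a..b} (\<lambda>s. y0 + integral {a..s} (\<lambda>r. f r (p n r)))"
      by (intro continuous_intros indef cont Suc)
    then show ?case by (simp add: pS[abs_def])
  qed (simp add: p0)
  \<comment> \<open>The weight below needs a positive Lipschitz constant.\<close>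
  define C where "C = max L 1"
  have C: "0 < C" and lipC: "s \<in> {a..b} \<Longrightarrow> norm (f s y - f s z) \<le> C * norm (y - z)" for s y z
    using lip[of s y z] mult_right_mono[of L C "norm (y - z)"] by (auto simp: C_def)
  have fint: "(\<lambda>r. f r (p n r)) integrable_on {a..s}" if "s \<in> {a..b}" for n s
    using that by (intro integrable_continuous_real continuous_on_subset[OF cont[OF pc]]) auto
  obtain K where K: "\<And>s. s \<in> {a..b} \<Longrightarrow> norm (p 1 s - p 0 s) \<le> K"
  proof -
    have "compact ((\<lambda>s. p 1 s - p 0 s) ` {a..b})"
      by (intro compact_continuous_image continuous_intros pc) auto
    then have "bounded ((\<lambda>s. p 1 s - p 0 s) ` {a..b})" by (rule compact_imp_bounded)
    then show ?thesis using that unfolding bounded_iff by (metis imageI)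
  qed
  define K' where "K' = max K 0"
  have K': "0 \<le> K'" "\<And>s. s \<in> {a..b} \<Longrightarrow> norm (p 1 s - p 0 s) \<le> K'"
    using K unfolding K'_def by (auto simp: le_max_iff_disj)
  \<comment> \<open>The Picard map is a contraction with factor 1/2 for the norm weighted by exp (-2 C s).\<close>
  have step: "norm (p (Suc n) s - p n s) \<le> K' * (1/2)^n * exp (2 * C * (s - a))"
    if "s \<in> {a..b}" for n s
    using that
  proof (induction n arbitrary: s)
    case 0
    have "1 \<le> exp (2 * C * (s - a))" using 0 C by auto
    then have "K' * 1 \<le> K' * exp (2 * C * (s - a))" using K'(1) by (rule mult_left_mono)
    then show ?case using K'(2)[OF 0] by simp
  next
    case (Suc n)
    let ?g = "\<lambda>r. C * (K' * (1/2)^n * exp (2 * C * (r - a)))"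
    let ?G = "\<lambda>r. K' * (1/2)^(Suc n) * exp (2 * C * (r - a))"
    have "(?g has_integral ?G s - ?G a) {a..s}"
      using Suc.prems by (intro fundamental_theorem_of_calculus)
        (auto intro!: derivative_eq_intros simp flip: has_real_derivative_iff_has_vector_derivative)
    then have gi: "?g integrable_on {a..s}" and gv: "integral {a..s} ?g = ?G s - ?G a"
      by (auto simp: has_integral_iff)
    have "p (Suc (Suc n)) s - p (Suc n) s
        = integral {a..s} (\<lambda>r. f r (p (Suc n) r) - f r (p n r))"
      unfolding pS[of "Suc n"] pS[of n s]
      by (simp add: integral_diff[OF fint[OF Suc.prems, of "Suc n"] fint[OF Suc.prems, of n]])
    also have "norm \<dots> \<le> integral {a..s} ?g"
    proof (rule integral_norm_bound_integral)
      fix r assume "r \<in> {a..s}"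
      then have r: "r \<in> {a..b}" using Suc.prems by auto
      show "norm (f r (p (Suc n) r) - f r (p n r)) \<le> ?g r"
        by (rule order_trans[OF lipC[OF r]]) (intro mult_left_mono Suc.IH r less_imp_le[OF C])
    qed (intro integrable_diff fint Suc.prems gi)+
    also have "\<dots> \<le> ?G s" unfolding gv using K'(1) by simp
    finally show ?case .
  qed
  define d where "d = (\<lambda>n s. p (Suc n) s - p n s)"
  define y where "y = (\<lambda>s. y0 + suminf (\<lambda>n. d n s))"
  have "uniform_limit {a..b} (\<lambda>n s. \<Sum>i<n. d i s) (\<lambda>s. suminf (\<lambda>i. d i s)) sequentially"
  proof (rule Weierstrass_m_test)
    show "norm (d n s) \<le> K' * exp (2 * C * (b - a)) * (1/2)^n" if "s \<in> {a..b}" for n s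
    proof -
      have "norm (d n s) \<le> K' * (1/2)^n * exp (2 * C * (s - a))" using step[OF that] by (simp add: d_def)
      also have "\<dots> \<le> K' * (1/2)^n * exp (2 * C * (b - a))"
        using that C K' by (intro mult_left_mono) auto
      finally show ?thesis by (simp add: mult_ac)
    qed
  qed (intro summable_mult summable_geometric, simp)
  then have ul: "uniform_limit {a..b} p y sequentially"
  proof -
    assume "uniform_limit {a..b} (\<lambda>n s. \<Sum>i<n. d i s) (\<lambda>s. suminf (\<lambda>i. d i s)) sequentially"
    from uniform_limit_add[OF uniform_limit_const[of "\<lambda>_. y0"] this]
    have "uniform_limit {a..b} (\<lambda>n s. y0 + (\<Sum>i<n. d i s)) y sequentially"
      by (simp add: y_def)
    moreover have "y0 + (\<Sum>i<n. d i s) = p n s" for n s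
      by (induction n) (simp_all add: d_def p0 add.assoc[symmetric])
    ultimately show ?thesis by simp
  qed
  have yc: "continuous_on {a..b} y"
    by (rule uniform_limit_theorem[OF _ ul]) (auto simp: pc)
  have lim: "(\<lambda>n. p n s) \<longlonglongrightarrow> y s" if "s \<in> {a..b}" for s
    using tendsto_uniform_limitI[OF ul that] .
  have ulf: "uniform_limit {a..b} (\<lambda>n r. f r (p n r)) (\<lambda>r. f r (y r)) sequentially"
  proof (rule uniform_limitI)
    fix e :: real assume "0 < e"
    then have "0 < e / C" using C by simp
    from uniform_limitD[OF ul this]
    show "\<forall>\<^sub>F n in sequentially. \<forall>x\<in>{a..b}. dist (f x (p n x)) (f x (y x)) < e"
    proof (eventually_elim, intro ballI)
      fix n x assume *: "\<forall>x\<in>{a..b}. dist (p n x) (y x) < e / C" and x: "x \<in> {a..b}"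
      have "dist (f x (p n x)) (f x (y x)) \<le> C * dist (p n x) (y x)"
        using lipC[OF x] by (simp add: dist_norm)
      also have "\<dots> < e" using * x C by (auto simp: field_simps)
      finally show "dist (f x (p n x)) (f x (y x)) < e" .
    qed
  qed
  have eq: "y s = y0 + integral {a..s} (\<lambda>r. f r (y r))" if s: "s \<in> {a..b}" for s
  proof -
    have "{a..s} \<subseteq> {a..b}" using s by auto
    then obtain I J where I: "\<And>n. ((\<lambda>r. f r (p n r)) has_integral I n) {a..s}"
        and J: "((\<lambda>r. f r (y r)) has_integral J) {a..s}" "I \<longlonglongrightarrow> J"
      using uniform_limit_integral[OF uniform_limit_on_subset[OF ulf], of a s]
        continuous_on_subset[OF cont[OF pc]] by (metis sequentially_bot)
    have "p (Suc n) s = y0 + I n" for n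
      by (simp add: pS integral_unique[OF I])
    then have "(\<lambda>n. p (Suc n) s) \<longlonglongrightarrow> y0 + J"
      using J(2) by (simp add: tendsto_intros)
    then show ?thesis
      using LIMSEQ_unique[OF LIMSEQ_Suc[OF lim[OF s]]] J(1) by (simp add: integral_unique)
  qed
  show ?thesis
    by (intro exI[of _ y] conjI ballI yc eq lim[unfolded p_def])
qed

section \<open>Lyapunov equations\<close>

lemma matrix_mult_add_rdistrib:
  "(A + B) ** C = A ** C + B ** (C :: 'a::semiring_1^'p^'n)"
  by (vector matrix_matrix_mult_def sum.distrib[symmetric] field_simps)

lemma bounded_bilinear_matrix_mult:
  "bounded_bilinear ((**) :: real^'n^'m \<Rightarrow> real^'p^'n \<Rightarrow> real^'p^'m)"
  by (simp add: bilinear_conv_bounded_bilinear[symmetric] bilinear_def linear_iff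
      matrix_add_ldistrib matrix_mult_add_rdistrib scalar_matrix_assoc matrix_scalar_ac)

lemma bounded_bilinear_matrix_vector_mult:
  "bounded_bilinear ((*v) :: real^'n^'m \<Rightarrow> real^'n \<Rightarrow> real^'m)"
  by (simp add: bilinear_conv_bounded_bilinear[symmetric] bilinear_def linear_iff
      matrix_vector_right_distrib matrix_vector_mult_add_rdistrib scaleR_matrix_vector_assoc
      matrix_vector_mult_scaleR)

lemma linear_transpose: "linear (transpose :: real^'n^'m \<Rightarrow> real^'m^'n)"
  by (simp add: linear_iff transpose_def vec_eq_iff)

lemma bounded_linear_transpose: "bounded_linear (transpose :: real^'n^'m \<Rightarrow> real^'m^'n)"
  by (simp add: linear_transpose linear_conv_bounded_linear[symmetric])

lemma bounded_linear_trace: "bounded_linear (trace :: real^'n^'n \<Rightarrow> real)"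
  by (simp add: linear_conv_bounded_linear[symmetric] linear_iff trace_def sum.distrib
      sum_distrib_left)

lemmas continuous_on_matrix_intros [continuous_intros] =
  bounded_bilinear.continuous_on[OF bounded_bilinear_matrix_mult]
  bounded_bilinear.continuous_on[OF bounded_bilinear_matrix_vector_mult]
  bounded_linear.continuous_on[OF bounded_linear_transpose]
  bounded_linear.continuous_on[OF bounded_linear_trace]

lemmas transpose_simps =
  linear_add[OF linear_transpose] linear_diff[OF linear_transpose]
  linear_neg[OF linear_transpose] linear_cmul[OF linear_transpose] matrix_transpose_mul

definition lyap_op :: "real^'n^'n \<Rightarrow> real^'n^'n \<Rightarrow> real^'n^'n" where
  "lyap_op M P = transpose M ** P + P ** M"

lemma bounded_bilinear_lyap_op: "bounded_bilinear (lyap_op :: real^'n^'n \<Rightarrow> _)"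
  unfolding lyap_op_def
  by (simp add: bilinear_conv_bounded_bilinear[symmetric] bilinear_def linear_iff transpose_simps
      matrix_add_ldistrib matrix_mult_add_rdistrib scalar_matrix_assoc[symmetric] matrix_scalar_ac
      scaleR_add_right algebra_simps)

lemmas continuous_on_lyap_op [continuous_intros] =
  bounded_bilinear.continuous_on[OF bounded_bilinear_lyap_op]

text \<open>
  The terminal value is not part of the predicate: the same equation is used with terminal cost,
  with terminal value 0, and for differences of solutions.
\<close>

definition lyapunov ::
    "real \<Rightarrow> (real \<Rightarrow> real^'n^'n) \<Rightarrow> (real \<Rightarrow> real^'n^'n) \<Rightarrow> (real \<Rightarrow> real^'n^'n) \<Rightarrow> bool" where
  "lyapunov T M F P \<longleftrightarrow>
     (\<forall>t\<in>{0..T}. (P has_vector_derivative - (lyap_op (M t) (P t) + F t)) (at t within {0..T}))"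

lemma lyapunov_continuous: "lyapunov T M F P \<Longrightarrow> continuous_on {0..T} P"
  unfolding lyapunov_def
  by (meson continuous_on_eq_continuous_within has_vector_derivative_continuous)

lemma has_vector_derivative_reflect:
  assumes "(f has_vector_derivative f') (at (T - t) within {0..T})"
  shows "((\<lambda>s. f (T - s)) has_vector_derivative - f') (at t within {0..T::real})"
proof -
  have "(f \<circ> (\<lambda>s. T - s) has_vector_derivative (- 1) *\<^sub>R f') (at t within {0..T})"
  proof (rule vector_diff_chain_within)
    show "((\<lambda>s. T - s) has_vector_derivative - 1) (at t within {0..T})"
      by (auto intro!: derivative_eq_intros)
    have "(\<lambda>s. T - s) ` {0..T} \<subseteq> {0..T}" by auto
    then show "(f has_vector_derivative f') (at (T - t) within (\<lambda>s. T - s) ` {0..T})"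
      using assms by (rule has_vector_derivative_within_subset[rotated])
  qed
  then show ?thesis by (simp add: o_def)
qed

lemma continuous_on_reflect:
  "continuous_on {0..T::real} f \<Longrightarrow> continuous_on {0..T} (\<lambda>s. f (T - s))"
  by (rule continuous_on_compose2[of "{0..T}" f]) (auto intro!: continuous_intros)

lemma continuous_on_norm_bound:
  fixes f :: "real \<Rightarrow> 'b::real_normed_vector"
  assumes "continuous_on {a..b} f"
  obtains C where "0 \<le> C" "\<And>s. s \<in> {a..b} \<Longrightarrow> norm (f s) \<le> C"
proof -
  have "bounded (f ` {a..b})"
    by (intro compact_imp_bounded compact_continuous_image assms) auto
  then obtain C where "\<And>s. s \<in> {a..b} \<Longrightarrow> norm (f s) \<le> C"
    unfolding bounded_iff by (metis imageI)
  then show thesis using that[of "max C 0"] by (auto simp: le_max_iff_disj)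
qed

lemma transpose_lyap_op: "transpose (lyap_op M P) = lyap_op M (transpose P)"
  by (simp add: lyap_op_def transpose_simps add.commute)

text \<open>
  Time reversal turns the terminal value problem into an initial value problem with globally
  Lipschitz right-hand side.
\<close>

theorem lyapunov_exists:
  fixes M F :: "real \<Rightarrow> real^'n^'n"
  assumes M: "continuous_on {0..T} M" and F: "continuous_on {0..T} F"
    and sF: "\<And>t. t \<in> {0..T} \<Longrightarrow> sym_mat (F t)" and sG: "sym_mat G"
  shows "\<exists>P. lyapunov T M F P \<and> (\<forall>t\<in>{0..T}. sym_mat (P t)) \<and> P T = G"
proof -
  obtain K where K: "0 < K" "\<And>A B :: real^'n^'n. norm (lyap_op A B) \<le> norm A * norm B * K"
    using bounded_bilinear.pos_bounded[OF bounded_bilinear_lyap_op] by blast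
  obtain C where C: "0 \<le> C" "\<And>s. s \<in> {0..T} \<Longrightarrow> norm (M s) \<le> C"
    using continuous_on_norm_bound[OF M] by blast
  define f where "f = (\<lambda>s P. lyap_op (M (T - s)) P + F (T - s))"
  have fc: "continuous_on {0..T} (\<lambda>s. f s (y s))" if "continuous_on {0..T} y" for y
    unfolding f_def by (intro continuous_intros continuous_on_reflect[OF M]
        continuous_on_reflect[OF F] that)
  have lip: "norm (f s y - f s z) \<le> (C * K) * norm (y - z)" if "s \<in> {0..T}" for s y z
  proof -
    have "f s y - f s z = lyap_op (M (T - s)) (y - z)"
      by (simp add: f_def bounded_bilinear.diff_right[OF bounded_bilinear_lyap_op])
    also have "norm \<dots> \<le> norm (M (T - s)) * norm (y - z) * K" by (rule K)
    also have "\<dots> \<le> C * norm (y - z) * K"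
      using C(2)[of "T - s"] that K(1) by (intro mult_right_mono) auto
    finally show ?thesis by (simp add: mult_ac)
  qed
  have "\<exists>y. continuous_on {0..T} y \<and>
      (\<forall>s\<in>{0..T}. y s = G + integral {0..s} (\<lambda>r. f r (y r))) \<and>
      (\<forall>s\<in>{0..T}. (\<lambda>n. picard_iterate f G 0 n s) \<longlonglongrightarrow> y s)"
    by (rule picard_lindelof[OF fc lip])
  then obtain y where y: "continuous_on {0..T} y"
      "\<And>s. s \<in> {0..T} \<Longrightarrow> y s = G + integral {0..s} (\<lambda>r. f r (y r))"
    by blast
  have y0: "y 0 = G" if "0 \<le> T" using y(2)[of 0] that by simp
  have dy: "(y has_vector_derivative f s (y s)) (at s within {0..T})" if "s \<in> {0..T}" for s
    by (rule has_vector_derivative_of_integral_equation[OF fc[OF y(1)] y(2) that])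
  define Q where "Q = (\<lambda>t. y (T - t))"
  have dQ: "(Q has_vector_derivative - (lyap_op (M t) (Q t) + F t)) (at t within {0..T})"
    if "t \<in> {0..T}" for t
    using has_vector_derivative_reflect[OF dy[of "T - t"]] that by (simp add: Q_def f_def)
  \<comment> \<open>The transpose of a solution is a solution, so averaging the two gives a symmetric one.\<close>
  \<comment> \<open>If \<open>T < 0\<close> the interval is empty and only the terminal value is constrained.\<close>
  define P where "P = (\<lambda>t. if 0 \<le> T then (1/2) *\<^sub>R (Q t + transpose (Q t)) else G)"
  have "(P has_vector_derivative - (lyap_op (M t) (P t) + F t)) (at t within {0..T})"
    if t: "t \<in> {0..T}" for t
  proof -
    have "((\<lambda>t. (1/2) *\<^sub>R (Q t + transpose (Q t))) has_vector_derivative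
        (1/2) *\<^sub>R (- (lyap_op (M t) (Q t) + F t) + transpose (- (lyap_op (M t) (Q t) + F t))))
        (at t within {0..T})"
      by (intro bounded_linear.has_vector_derivative[OF bounded_linear_scaleR_right]
          has_vector_derivative_add dQ t
          bounded_linear.has_vector_derivative[OF bounded_linear_transpose])
    moreover have "(1/2) *\<^sub>R (- (lyap_op (M t) (Q t) + F t) + transpose (- (lyap_op (M t) (Q t) + F t)))
        = - (lyap_op (M t) (P t) + F t)"
      using sF[OF t] t
      by (simp add: P_def transpose_simps transpose_lyap_op sym_mat_def
          bounded_bilinear.add_right[OF bounded_bilinear_lyap_op]
          bounded_bilinear.scaleR_right[OF bounded_bilinear_lyap_op] scaleR_add_right scaleR_diff_right
          flip: scaleR_add_left)
    ultimately show ?thesis using t by (simp add: P_def)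
  qed
  moreover have "sym_mat (P t)" for t
    using sG by (simp add: P_def sym_mat_def transpose_simps add.commute)
  moreover have "P T = G"
    using y0 sG by (simp add: P_def Q_def sym_mat_def flip: scaleR_2)
  ultimately show ?thesis unfolding lyapunov_def by blast
qed

text \<open>
  The constant depends only on the horizon and on a bound for the coefficient, so one constant
  serves a whole family of perturbed equations.
\<close>

lemma lyapunov_bound:
  fixes T C :: real
  assumes C: "0 \<le> C"
  shows "\<exists>c\<ge>0. \<forall>(M :: real \<Rightarrow> real^'n^'n) F P \<eta>.
    (\<forall>t\<in>{0..T}. norm (M t) \<le> C) \<longrightarrow> (\<forall>t\<in>{0..T}. norm (F t) \<le> \<eta>) \<longrightarrow>
    lyapunov T M F P \<longrightarrow> P T = 0 \<longrightarrow> (\<forall>t\<in>{0..T}. norm (P t) \<le> c * \<eta>)"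
proof -
  obtain K where K: "0 < K" "\<And>A B :: real^'n^'n. norm (lyap_op A B) \<le> norm A * norm B * K"
    using bounded_bilinear.pos_bounded[OF bounded_bilinear_lyap_op] by blast
  let ?c = "\<bar>T\<bar> * exp (C * K * \<bar>T\<bar>)"
  have *: "norm (P t) \<le> ?c * \<eta>"
    if M: "\<And>t. t \<in> {0..T} \<Longrightarrow> norm (M t) \<le> C" and F: "\<And>t. t \<in> {0..T} \<Longrightarrow> norm (F t) \<le> \<eta>"
      and lyap: "lyapunov T M F P" and PT: "P T = 0" and t: "t \<in> {0..T}"
    for M F :: "real \<Rightarrow> real^'n^'n" and P \<eta> t
  proof -
    define e where "e = (\<lambda>s. P (T - s))"
    have ec: "continuous_on {0..T} e"
      unfolding e_def by (intro continuous_on_reflect lyapunov_continuous[OF lyap])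
    have nec: "continuous_on {0..T} (\<lambda>s. norm (e s))" by (intro continuous_intros ec)
    have de: "(e has_vector_derivative lyap_op (M (T - s)) (e s) + F (T - s)) (at s within {0..T})"
      if "s \<in> {0..T}" for s
    proof -
      have "(P has_vector_derivative - (lyap_op (M (T - s)) (P (T - s)) + F (T - s)))
          (at (T - s) within {0..T})"
        using lyap that unfolding lyapunov_def by auto
      from has_vector_derivative_reflect[OF this] show ?thesis by (simp add: e_def add.commute)
    qed
    have \<eta>: "0 \<le> \<eta>" using F[OF t] norm_ge_zero order_trans by blast
    have bound: "norm (e s) \<le> T * \<eta> + (C * K) * integral {0..s} (\<lambda>r. norm (e r))"
      if s: "s \<in> {0..T}" for s
    proof -
      have "((\<lambda>r. lyap_op (M (T - r)) (e r) + F (T - r)) has_integral e s - e 0) {0..s}"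
        using s by (intro fundamental_theorem_of_calculus)
          (auto intro: has_vector_derivative_within_subset[OF de])
      then have i: "(\<lambda>r. lyap_op (M (T - r)) (e r) + F (T - r)) integrable_on {0..s}"
          "e s = integral {0..s} (\<lambda>r. lyap_op (M (T - r)) (e r) + F (T - r))"
        using PT by (auto simp: has_integral_iff e_def)
      have ni: "(\<lambda>r. norm (e r)) integrable_on {0..s}"
        using s by (intro integrable_continuous_real continuous_on_subset[OF nec]) auto
      have "norm (e s) \<le> integral {0..s} (\<lambda>r. (C * K) * norm (e r) + \<eta>)"
        unfolding i(2)
      proof (rule integral_norm_bound_integral[OF i(1)])
        show "(\<lambda>r. C * K * norm (e r) + \<eta>) integrable_on {0..s}"
          by (intro integrable_add integrable_on_mult_right ni) auto
        fix r assume "r \<in> {0..s}"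
        then have r: "T - r \<in> {0..T}" using s by auto
        have "norm (lyap_op (M (T - r)) (e r)) \<le> norm (M (T - r)) * norm (e r) * K" by (rule K)
        also have "\<dots> \<le> C * norm (e r) * K"
          using M[OF r] K(1) by (intro mult_right_mono) auto
        finally show "norm (lyap_op (M (T - r)) (e r) + F (T - r)) \<le> C * K * norm (e r) + \<eta>"
          using F[OF r] norm_triangle_ineq[of "lyap_op (M (T - r)) (e r)" "F (T - r)"]
          by (simp add: mult_ac)
      qed
      also have "\<dots> = (C * K) * integral {0..s} (\<lambda>r. norm (e r)) + s * \<eta>"
        using s by (simp add: integral_add[OF integrable_on_mult_right[OF ni] integrable_const_ivl])
      also have "\<dots> \<le> (C * K) * integral {0..s} (\<lambda>r. norm (e r)) + T * \<eta>"
        using s \<eta> by (simp add: mult_right_mono)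
      finally show ?thesis by simp
    qed
    have Tt: "T - t \<in> {0..T}" using t by auto
    have "norm (P t) = norm (e (T - t))" by (simp add: e_def)
    also have "\<dots> \<le> T * \<eta> * exp (C * K * (T - t - 0))"
      by (rule gronwall[OF nec _ bound Tt]) (use C K in auto)
    also have "\<dots> \<le> T * \<eta> * exp (C * K * T)"
      using t \<eta> C K by (intro mult_left_mono) (auto intro!: mult_left_mono)
    finally show ?thesis using t by (simp add: mult_ac)
  qed
  show ?thesis
  proof (intro exI[of _ ?c] conjI allI impI ballI)
    show "0 \<le> ?c" by simp
    fix M F P :: "real \<Rightarrow> real^'n^'n" and \<eta> t
    assume "\<forall>t\<in>{0..T}. norm (M t) \<le> C" "\<forall>t\<in>{0..T}. norm (F t) \<le> \<eta>"
      "lyapunov T M F P" "P T = 0" "t \<in> {0..T}"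
    then show "norm (P t) \<le> ?c * \<eta>" by (intro *[of M F \<eta> P t]) auto
  qed
qed

text \<open>
  Differentiation of a solution with respect to a parameter that enters the coefficient affinely.
  Subtracting the equations shows that the difference quotient itself solves a Lyapunov equation
  with the perturbed coefficient and an inhomogeneity that converges uniformly; the a-priori bound
  transfers the convergence to the solution.
\<close>

theorem lyapunov_difference_quotient:
  fixes M S F1 D :: "real \<Rightarrow> real^'n^'n" and F P :: "real \<Rightarrow> real \<Rightarrow> real^'n^'n"
  assumes M: "continuous_on {0..T} M" and S: "continuous_on {0..T} S"
    and P: "\<And>r. lyapunov T (\<lambda>s. M s + r *\<^sub>R S s) (F r) (P r)" and PT: "\<And>r. P r T = G"
    and F: "uniform_limit {0..T} (\<lambda>r s. (F r s - F 0 s) /\<^sub>R r) F1 (at 0)"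
    and D: "lyapunov T M (\<lambda>s. lyap_op (S s) (P 0 s) + F1 s) D" and DT: "D T = 0"
  shows "uniform_limit {0..T} (\<lambda>r s. (P r s - P 0 s) /\<^sub>R r) D (at 0)"
proof -
  interpret L: bounded_bilinear "lyap_op :: real^'n^'n \<Rightarrow> _" by (rule bounded_bilinear_lyap_op)
  obtain CM where CM: "0 \<le> CM" "\<And>s. s \<in> {0..T} \<Longrightarrow> norm (M s) \<le> CM"
    using continuous_on_norm_bound[OF M] by blast
  obtain CS where CS: "0 \<le> CS" "\<And>s. s \<in> {0..T} \<Longrightarrow> norm (S s) \<le> CS"
    using continuous_on_norm_bound[OF S] by blast
  have "continuous_on {0..T} (\<lambda>s. lyap_op (S s) (D s))"
    by (intro continuous_intros S lyapunov_continuous[OF D])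
  then obtain CD where CD: "0 \<le> CD" "\<And>s. s \<in> {0..T} \<Longrightarrow> norm (lyap_op (S s) (D s)) \<le> CD"
    using continuous_on_norm_bound by blast
  obtain c where c: "0 \<le> c"
    "\<forall>(M :: real \<Rightarrow> real^'n^'n) F P \<eta>.
    (\<forall>t\<in>{0..T}. norm (M t) \<le> CM + CS) \<longrightarrow> (\<forall>t\<in>{0..T}. norm (F t) \<le> \<eta>) \<longrightarrow>
    lyapunov T M F P \<longrightarrow> P T = 0 \<longrightarrow> (\<forall>t\<in>{0..T}. norm (P t) \<le> c * \<eta>)"
    using lyapunov_bound[OF add_nonneg_nonneg[OF CM(1) CS(1)], of T] by blast
  define q where "q = (\<lambda>r s. (F r s - F 0 s) /\<^sub>R r)"
  \<comment> \<open>The error of the difference quotient solves a Lyapunov equation with small inhomogeneity.\<close>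
  have E: "lyapunov T (\<lambda>s. M s + r *\<^sub>R S s) (\<lambda>s. r *\<^sub>R lyap_op (S s) (D s) + (q r s - F1 s))
      (\<lambda>s. (P r s - P 0 s) /\<^sub>R r - D s)" if "r \<noteq> 0" for r
    unfolding lyapunov_def
  proof
    fix s assume s: "s \<in> {0..T}"
    have dP: "(P r has_vector_derivative - (lyap_op (M s + r *\<^sub>R S s) (P r s) + F r s))
        (at s within {0..T})" for r
      using P[of r] s by (simp add: lyapunov_def)
    have dP0: "(P 0 has_vector_derivative - (lyap_op (M s) (P 0 s) + F 0 s)) (at s within {0..T})"
      using dP[of 0] by simp
    have dD: "(D has_vector_derivative - (lyap_op (M s) (D s) + (lyap_op (S s) (P 0 s) + F1 s)))
        (at s within {0..T})"
      using D s by (simp add: lyapunov_def)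
    have "((\<lambda>s. (P r s - P 0 s) /\<^sub>R r - D s) has_vector_derivative
       (- (lyap_op (M s + r *\<^sub>R S s) (P r s) + F r s) - - (lyap_op (M s) (P 0 s) + F 0 s)) /\<^sub>R r
         - - (lyap_op (M s) (D s) + (lyap_op (S s) (P 0 s) + F1 s))) (at s within {0..T})"
      by (intro has_vector_derivative_diff dD dP dP0
          bounded_linear.has_vector_derivative[OF bounded_linear_scaleR_right])
    moreover have "(- (lyap_op (M s + r *\<^sub>R S s) (P r s) + F r s) - - (lyap_op (M s) (P 0 s) + F 0 s)) /\<^sub>R r
         - - (lyap_op (M s) (D s) + (lyap_op (S s) (P 0 s) + F1 s))
       = - (lyap_op (M s + r *\<^sub>R S s) ((P r s - P 0 s) /\<^sub>R r - D s)
            + (r *\<^sub>R lyap_op (S s) (D s) + (q r s - F1 s)))"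
      using that by (simp add: q_def L.add_left L.add_right L.diff_right L.scaleR_left L.scaleR_right
          scaleR_add_right scaleR_diff_right algebra_simps)
    ultimately show "((\<lambda>s. (P r s - P 0 s) /\<^sub>R r - D s) has_vector_derivative
       - (lyap_op (M s + r *\<^sub>R S s) ((P r s - P 0 s) /\<^sub>R r - D s)
            + (r *\<^sub>R lyap_op (S s) (D s) + (q r s - F1 s)))) (at s within {0..T})" by (simp only:)
  qed
  show ?thesis
  proof (rule uniform_limitI)
    fix e :: real assume e: "0 < e"
    define \<epsilon> where "\<epsilon> = e / (2 * (c + 1))"
    have \<epsilon>: "0 < \<epsilon>" "c * (2 * \<epsilon>) < e" using e c(1) by (auto simp: \<epsilon>_def field_simps)
    have "\<forall>\<^sub>F r in at 0. \<forall>s\<in>{0..T}. dist (q r s) (F1 s) < \<epsilon>"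
      using uniform_limitD[OF F \<epsilon>(1)] by (simp add: q_def)
    moreover have "\<forall>\<^sub>F r in at (0::real). \<bar>r\<bar> < min 1 (\<epsilon> / (CD + 1))"
      using eventually_at_ball[of "min 1 (\<epsilon> / (CD + 1))" "0::real" UNIV] \<epsilon> CD(1)
      by (auto elim!: eventually_mono simp: dist_norm)
    moreover have "\<forall>\<^sub>F r in at (0::real). r \<noteq> 0"
      by (simp add: eventually_at_filter)
    ultimately show "\<forall>\<^sub>F r in at 0. \<forall>s\<in>{0..T}. dist ((P r s - P 0 s) /\<^sub>R r) (D s) < e"
    proof (eventually_elim, intro ballI)
      fix r t
      assume q: "\<forall>s\<in>{0..T}. dist (q r s) (F1 s) < \<epsilon>" and r: "\<bar>r\<bar> < min 1 (\<epsilon> / (CD + 1))" "r \<noteq> 0"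
        and t: "t \<in> {0..T}"
      have "norm ((P r t - P 0 t) /\<^sub>R r - D t) \<le> c * (2 * \<epsilon>)"
      proof (rule c(2)[rule_format, OF _ _ E[OF r(2)] _ t])
        fix s assume s: "s \<in> {0..T}"
        have "norm (M s + r *\<^sub>R S s) \<le> norm (M s) + \<bar>r\<bar> * norm (S s)"
          using norm_triangle_ineq[of "M s" "r *\<^sub>R S s"] by simp
        also have "\<dots> \<le> CM + 1 * CS"
          using CM(2)[OF s] CS(2)[OF s] r by (intro add_mono mult_mono) auto
        finally show "norm (M s + r *\<^sub>R S s) \<le> CM + CS" by simp
        have "norm (r *\<^sub>R lyap_op (S s) (D s)) \<le> \<bar>r\<bar> * CD"
          using CD(2)[OF s] by (simp add: mult_left_mono)
        also have "\<dots> \<le> \<bar>r\<bar> * (CD + 1)" by (simp add: mult_left_mono)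
        also have "\<dots> \<le> \<epsilon>" using r CD(1) by (simp add: field_simps)
        finally show "norm (r *\<^sub>R lyap_op (S s) (D s) + (q r s - F1 s)) \<le> 2 * \<epsilon>"
          using q s norm_triangle_ineq[of "r *\<^sub>R lyap_op (S s) (D s)" "q r s - F1 s"]
          by (force simp: dist_norm)
      qed (simp add: PT DT)
      then show "dist ((P r t - P 0 t) /\<^sub>R r) (D t) < e" using \<epsilon>(2) by (simp add: dist_norm)
    qed
  qed
qed

section \<open>Processes with continuous paths and bounded moments\<close>

lemma matrix_vector_path_bound:
  fixes A :: "real \<Rightarrow> real^'n^'m"
  assumes "continuous_on {a..b} A"
  obtains L where "0 \<le> L" "\<And>s v. s \<in> {a..b} \<Longrightarrow> norm (A s *v v) \<le> L * norm v"
proof -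
  obtain K where K: "0 < K" "\<And>(A :: real^'n^'m) v. norm (A *v v) \<le> norm A * norm v * K"
    using bounded_bilinear.pos_bounded[OF bounded_bilinear_matrix_vector_mult] by blast
  obtain C where C: "0 \<le> C" "\<And>s. s \<in> {a..b} \<Longrightarrow> norm (A s) \<le> C"
    using continuous_on_norm_bound[OF assms] by blast
  have "norm (A s *v v) \<le> C * K * norm v" if "s \<in> {a..b}" for s v
  proof -
    have "norm (A s *v v) \<le> norm (A s) * norm v * K" by (rule K)
    also have "\<dots> \<le> C * norm v * K" using C(2)[OF that] K(1) by (intro mult_right_mono) auto
    finally show ?thesis by (simp add: mult_ac)
  qed
  then show thesis using that[of "C * K"] C K by simp
qed

definition path_process :: "'o measure \<Rightarrow> real \<Rightarrow> real \<Rightarrow> (real \<Rightarrow> 'o \<Rightarrow> 'b::euclidean_space) \<Rightarrow> bool" where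
  "path_process M a b U \<longleftrightarrow>
     (\<forall>s\<in>{a..b}. U s \<in> borel_measurable M) \<and> (\<forall>w\<in>space M. continuous_on {a..b} (\<lambda>s. U s w))"

lemma path_process_subinterval:
  "path_process M a b U \<Longrightarrow> {c..d} \<subseteq> {a..b} \<Longrightarrow> path_process M c d U"
  unfolding path_process_def by (blast intro: continuous_on_subset)

text \<open>
  Continuity of the paths upgrades measurability at each time to joint measurability, because the
  process is the limit of its values at the grid points below the current time. The indicator
  makes the statement independent of the behaviour outside the interval.
\<close>

lemma path_process_measurable_pair:
  assumes U: "path_process M a b U" and ab: "a \<le> b"
  shows "(\<lambda>(s, w). indicat_real {a..b} s *\<^sub>R U s w) \<in> borel_measurable (lborel \<Otimes>\<^sub>M M)"
proof -
  define c where "c = (\<lambda>s. max a (min s b))"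
  have c: "c s \<in> {a..b}" for s using ab by (auto simp: c_def)
  define V where "V = (\<lambda>n s w. U (c (real_of_int \<lfloor>real (Suc n) * s\<rfloor> / real (Suc n))) w)"
  have meas: "(\<lambda>(s, w). V n s w) \<in> borel_measurable (lborel \<Otimes>\<^sub>M M)" for n
  proof -
    have "(\<lambda>x. U (c (real_of_int \<lfloor>real (Suc n) * fst x\<rfloor> / real (Suc n))) (snd x))
        \<in> borel_measurable (lborel \<Otimes>\<^sub>M M)"
    proof (rule measurable_compose_countable[where f = "\<lambda>k x. U (c (real_of_int k / real (Suc n))) (snd x)"
            and g = "\<lambda>x. \<lfloor>real (Suc n) * fst x\<rfloor>"])
      show "(\<lambda>x. \<lfloor>real (Suc n) * fst x\<rfloor>) \<in> measurable (lborel \<Otimes>\<^sub>M M) (count_space UNIV)"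
        by measurable
      show "(\<lambda>x. U (c (real_of_int k / real (Suc n))) (snd x)) \<in> borel_measurable (lborel \<Otimes>\<^sub>M M)" for k
        using U c by (intro measurable_compose[OF measurable_snd]) (auto simp: path_process_def)
    qed
    then show ?thesis by (simp add: V_def case_prod_beta)
  qed
  have lim: "(\<lambda>n. V n s w) \<longlonglongrightarrow> U (c s) w" if "w \<in> space M" for s w
  proof -
    have "continuous_on UNIV (\<lambda>s. U (c s) w)"
      by (rule continuous_on_compose2[of "{a..b}" "\<lambda>s. U s w"])
        (use U that c in \<open>auto simp: path_process_def c_def intro!: continuous_intros\<close>)
    then have "isCont (\<lambda>s. U (c s) w) s" by (simp add: continuous_on_eq_continuous_at)
    moreover have "(\<lambda>n. real_of_int \<lfloor>real (Suc n) * s\<rfloor> / real (Suc n)) \<longlonglongrightarrow> s"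
    proof (rule tendsto_sandwich)
      have fl: "s - 1 / real (Suc n) \<le> real_of_int \<lfloor>real (Suc n) * s\<rfloor> / real (Suc n)"
          "real_of_int \<lfloor>real (Suc n) * s\<rfloor> / real (Suc n) \<le> s" for n
      proof -
        define N where "N = real (Suc n)"
        have N: "0 < N" by (simp add: N_def)
        then have e: "s - 1 / N = (N * s - 1) / N" by (simp add: field_simps)
        have "(N * s - 1) / N \<le> \<lfloor>N * s\<rfloor> / N"
          using N by (intro divide_right_mono) linarith+
        then show "s - 1 / real (Suc n) \<le> real_of_int \<lfloor>real (Suc n) * s\<rfloor> / real (Suc n)"
          unfolding N_def[symmetric] e .
        have "\<lfloor>N * s\<rfloor> / N \<le> (N * s) / N"
          using N by (intro divide_right_mono) linarith+
        then show "real_of_int \<lfloor>real (Suc n) * s\<rfloor> / real (Suc n) \<le> s"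
          unfolding N_def[symmetric] using N by simp
      qed
      show "\<forall>\<^sub>F n in sequentially. s - 1 / real (Suc n) \<le> real_of_int \<lfloor>real (Suc n) * s\<rfloor> / real (Suc n)"
        using fl by simp
      show "\<forall>\<^sub>F n in sequentially. real_of_int \<lfloor>real (Suc n) * s\<rfloor> / real (Suc n) \<le> s"
        using fl by simp
      show "(\<lambda>n. s - 1 / real (Suc n)) \<longlonglongrightarrow> s"
        using LIMSEQ_inverse_real_of_nat_add_minus[of s] by (simp add: inverse_eq_divide)
    qed simp
    ultimately show ?thesis unfolding V_def by (rule isCont_tendsto_compose)
  qed
  have "(\<lambda>x. U (c (fst x)) (snd x)) \<in> borel_measurable (lborel \<Otimes>\<^sub>M M)"
  proof (rule borel_measurable_LIMSEQ_metric)
    show "(\<lambda>x. V n (fst x) (snd x)) \<in> borel_measurable (lborel \<Otimes>\<^sub>M M)" for n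
      using meas[of n] by (simp add: case_prod_beta)
    show "(\<lambda>n. V n (fst x) (snd x)) \<longlonglongrightarrow> U (c (fst x)) (snd x)"
      if "x \<in> space (lborel \<Otimes>\<^sub>M M)" for x
      using that by (intro lim) (auto simp: space_pair_measure)
  qed
  moreover have "(\<lambda>x. indicat_real {a..b} (fst x)) \<in> borel_measurable (lborel \<Otimes>\<^sub>M M)"
    by (intro measurable_compose[OF measurable_fst] borel_measurable_indicator) simp
  ultimately have "(\<lambda>x. indicat_real {a..b} (fst x) *\<^sub>R U (c (fst x)) (snd x)) \<in> borel_measurable (lborel \<Otimes>\<^sub>M M)"
    by (intro borel_measurable_scaleR)
  moreover have "indicat_real {a..b} s *\<^sub>R U (c s) w = indicat_real {a..b} s *\<^sub>R U s w" for s w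
    by (auto simp: c_def indicator_def)
  ultimately show ?thesis by (simp add: case_prod_beta)
qed

lemma path_integral_eq_lebesgue:
  fixes f :: "real \<Rightarrow> 'b::euclidean_space"
  assumes "continuous_on {a..b} f"
  shows "integrable lborel (\<lambda>s. indicat_real {a..b} s *\<^sub>R f s)"
    and "(\<integral>s. indicat_real {a..b} s *\<^sub>R f s \<partial>lborel) = integral {a..b} f"
  using borel_integrable_atLeastAtMost'[OF assms]
    set_borel_integral_eq_integral(2)[of "{a..b}" f]
  by (auto simp: set_integrable_def set_lebesgue_integral_def)

lemma path_process_integral:
  assumes U: "path_process M a b U" and s: "s \<in> {a..b}"
    and M: "sigma_finite_measure M"
  shows "(\<lambda>w. integral {a..s} (\<lambda>r. U r w)) \<in> borel_measurable M"
proof -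
  interpret M: sigma_finite_measure M by fact
  have U': "path_process M a s U" using path_process_subinterval[OF U] s by auto
  have "(\<lambda>(w, r). indicat_real {a..s} r *\<^sub>R U r w) \<in> borel_measurable (M \<Otimes>\<^sub>M lborel)"
    using path_process_measurable_pair[OF U'] s
    by (subst measurable_pair_swap_iff) (simp add: case_prod_beta)
  then have "(\<lambda>w. \<integral>r. indicat_real {a..s} r *\<^sub>R U r w \<partial>lborel) \<in> borel_measurable M"
    by (rule lborel.borel_measurable_lebesgue_integral)
  also have "?this \<longleftrightarrow> ?thesis"
    using U' by (intro measurable_cong path_integral_eq_lebesgue(2)) (auto simp: path_process_def)
  finally show ?thesis .
qed

lemma path_process_indefinite_integral:
  assumes U: "path_process M a b U" and M: "sigma_finite_measure M"
  shows "path_process M a b (\<lambda>s w. integral {a..s} (\<lambda>r. U r w))"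
proof -
  have "continuous_on {a..b} (\<lambda>s. integral {a..s} (\<lambda>r. U r w))" if "w \<in> space M" for w
    using U that indefinite_integral_continuous_1[OF integrable_continuous_real, of a b "\<lambda>r. U r w"]
    by (auto simp: path_process_def)
  then show ?thesis
    using path_process_integral[OF U _ M] by (auto simp: path_process_def)
qed

lemma path_process_const: "f \<in> borel_measurable M \<Longrightarrow> path_process M a b (\<lambda>s. f)"
  by (simp add: path_process_def)

lemma path_process_add:
  "path_process M a b U \<Longrightarrow> path_process M a b V \<Longrightarrow> path_process M a b (\<lambda>s w. U s w + V s w)"
  unfolding path_process_def
  by (auto intro!: continuous_intros borel_measurable_add borel_measurable_diff
      borel_measurable_inner borel_measurable_scaleR)

lemma path_process_inner:
  "path_process M a b U \<Longrightarrow> path_process M a b V \<Longrightarrow> path_process M a b (\<lambda>s w. U s w \<bullet> V s w)"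
  unfolding path_process_def
  by (auto intro!: continuous_intros borel_measurable_add borel_measurable_diff
      borel_measurable_inner borel_measurable_scaleR)

lemma path_process_scaleR:
  "path_process M a b U \<Longrightarrow> path_process M a b V \<Longrightarrow> path_process M a b (\<lambda>s w. U s w *\<^sub>R V s w)"
  unfolding path_process_def
  by (auto intro!: continuous_intros borel_measurable_add borel_measurable_diff
      borel_measurable_inner borel_measurable_scaleR)

lemma path_process_norm_power:
  "path_process M a b U \<Longrightarrow> path_process M a b (\<lambda>s w. norm (U s w) ^ 2)"
  unfolding path_process_def
  by (auto intro!: continuous_intros borel_measurable_add borel_measurable_diff
      borel_measurable_inner borel_measurable_scaleR)

lemma path_process_matrix_vector:
  assumes "continuous_on {a..b} R" and "path_process M a b U"
  shows "path_process M a b (\<lambda>s w. (R s :: real^'n^'m) *v U s w)"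
  using assms unfolding path_process_def
  by (auto intro!: continuous_intros borel_measurable_continuous_onI
      measurable_compose[of _ _ borel "\<lambda>v. R _ *v v"])

text \<open>
  The uniform bound on the moments is all that Fubini needs; in particular the supremum of a path
  need not be integrable, which avoids maximal inequalities.
\<close>

definition L1_process :: "'o measure \<Rightarrow> real \<Rightarrow> real \<Rightarrow> (real \<Rightarrow> 'o \<Rightarrow> 'b::euclidean_space) \<Rightarrow> bool" where
  "L1_process M a b H \<longleftrightarrow> path_process M a b H \<and>
     (\<exists>C. \<forall>s\<in>{a..b}. integrable M (H s) \<and> (\<integral>w. norm (H s w) \<partial>M) \<le> C)"

lemma L1_process_integrable: "L1_process M a b H \<Longrightarrow> s \<in> {a..b} \<Longrightarrow> integrable M (H s)"
  by (auto simp: L1_process_def)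

lemma L1_process_subinterval:
  assumes "L1_process M a b H" "{c..d} \<subseteq> {a..b}" shows "L1_process M c d H"
proof -
  obtain C where "\<And>s. s \<in> {a..b} \<Longrightarrow> integrable M (H s) \<and> (\<integral>w. norm (H s w) \<partial>M) \<le> C"
    using assms(1) unfolding L1_process_def by blast
  then have "\<forall>s\<in>{c..d}. integrable M (H s) \<and> (\<integral>w. norm (H s w) \<partial>M) \<le> C"
    using assms(2) by blast
  then show ?thesis
    using assms path_process_subinterval[of M a b H c d] unfolding L1_process_def by blast
qed

lemma L1_process_fubini:
  assumes H: "L1_process M a b H" and ab: "a \<le> b" and M: "sigma_finite_measure M"
  shows "integrable M (\<lambda>w. integral {a..b} (\<lambda>s. H s w))"
    and "(\<lambda>s. \<integral>w. H s w \<partial>M) integrable_on {a..b}"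
    and "(\<integral>w. integral {a..b} (\<lambda>s. H s w) \<partial>M) = integral {a..b} (\<lambda>s. \<integral>w. H s w \<partial>M)"
proof -
  interpret M: sigma_finite_measure M by fact
  interpret P: pair_sigma_finite lborel M ..
  let ?h = "\<lambda>s w. indicat_real {a..b} s *\<^sub>R H s w"
  have H': "path_process M a b H" using H by (simp add: L1_process_def)
  obtain C where C: "\<And>s. s \<in> {a..b} \<Longrightarrow> integrable M (H s)"
      "\<And>s. s \<in> {a..b} \<Longrightarrow> (\<integral>w. norm (H s w) \<partial>M) \<le> C"
    using H unfolding L1_process_def by blast
  have meas: "(\<lambda>(s, w). ?h s w) \<in> borel_measurable (lborel \<Otimes>\<^sub>M M)"
    by (rule path_process_measurable_pair[OF H' ab])
  have int_s: "integrable M (?h s)" for s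
    using C(1)[of s] by (cases "s \<in> {a..b}") auto
  have "integrable lborel (\<lambda>s. \<integral>w. norm (?h s w) \<partial>M)"
  proof (rule Bochner_Integration.integrable_bound)
    show "integrable lborel (\<lambda>s. indicat_real {a..b} s *\<^sub>R C)"
      by (intro path_integral_eq_lebesgue continuous_intros)
    show "(\<lambda>s. \<integral>w. norm (?h s w) \<partial>M) \<in> borel_measurable lborel"
      using measurable_compose[OF meas borel_measurable_norm]
      by (intro M.borel_measurable_lebesgue_integral) (simp add: case_prod_beta)
    show "AE s in lborel. norm (\<integral>w. norm (?h s w) \<partial>M) \<le> norm (indicat_real {a..b} s *\<^sub>R C)"
    proof (intro always_eventually allI)
      fix s show "norm (\<integral>w. norm (?h s w) \<partial>M) \<le> norm (indicat_real {a..b} s *\<^sub>R C)"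
      proof (cases "s \<in> {a..b}")
        case True
        have "0 \<le> (\<integral>w. norm (H s w) \<partial>M)" by (rule Bochner_Integration.integral_nonneg) simp
        then show ?thesis using C(2)[OF True] True by simp
      qed simp
    qed
  qed
  then have int: "integrable (lborel \<Otimes>\<^sub>M M) (\<lambda>(s, w). ?h s w)"
    using int_s by (intro P.Fubini_integrable meas) auto
  have eq: "(\<integral>s. ?h s w \<partial>lborel) = integral {a..b} (\<lambda>s. H s w)" if "w \<in> space M" for w
    using H' that by (intro path_integral_eq_lebesgue) (auto simp: path_process_def)
  have "integrable M (\<lambda>w. \<integral>s. ?h s w \<partial>lborel)"
    by (rule P.integrable_snd[OF int])
  also have "?this \<longleftrightarrow> integrable M (\<lambda>w. integral {a..b} (\<lambda>s. H s w))"
    by (intro Bochner_Integration.integrable_cong eq) auto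
  finally show "integrable M (\<lambda>w. integral {a..b} (\<lambda>s. H s w))" .
  have E: "(\<integral>w. ?h s w \<partial>M) = indicat_real {a..b} s *\<^sub>R (\<integral>w. H s w \<partial>M)" for s by simp
  have "set_integrable lborel {a..b} (\<lambda>s. \<integral>w. H s w \<partial>M)"
    using P.integrable_fst[OF int] unfolding E set_integrable_def .
  note set_borel_integral_eq_integral[OF this]
  then show "(\<lambda>s. \<integral>w. H s w \<partial>M) integrable_on {a..b}"
    and "(\<integral>w. integral {a..b} (\<lambda>s. H s w) \<partial>M) = integral {a..b} (\<lambda>s. \<integral>w. H s w \<partial>M)"
    using P.Fubini_integral[OF int] eq
    by (simp_all add: E set_lebesgue_integral_def cong: Bochner_Integration.integral_cong)
qed

lemma L1_process_bound:
  assumes U: "path_process M a b U" and V: "L1_process M a b V"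
    and le: "\<And>s. s \<in> {a..b} \<Longrightarrow> AE w in M. norm (U s w) \<le> norm (V s w)"
  shows "L1_process M a b U"
proof -
  obtain C where C: "\<And>s. s \<in> {a..b} \<Longrightarrow> integrable M (V s)"
      "\<And>s. s \<in> {a..b} \<Longrightarrow> (\<integral>w. norm (V s w) \<partial>M) \<le> C"
    using V unfolding L1_process_def by blast
  have "integrable M (U s) \<and> (\<integral>w. norm (U s w) \<partial>M) \<le> C" if s: "s \<in> {a..b}" for s
  proof
    show i: "integrable M (U s)"
      by (rule Bochner_Integration.integrable_bound[OF C(1)[OF s] _ le[OF s]])
        (use U s in \<open>simp add: path_process_def\<close>)
    have "(\<integral>w. norm (U s w) \<partial>M) \<le> (\<integral>w. norm (V s w) \<partial>M)"
      by (intro integral_mono_AE le s integrable_norm C i)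
    then show "(\<integral>w. norm (U s w) \<partial>M) \<le> C" using C(2)[OF s] by simp
  qed
  then show ?thesis using U unfolding L1_process_def by blast
qed

lemma L1_process_add:
  assumes U: "L1_process M a b U" and V: "L1_process M a b V"
  shows "L1_process M a b (\<lambda>s w. U s w + V s w)"
proof -
  obtain C where C: "\<And>s. s \<in> {a..b} \<Longrightarrow> integrable M (U s) \<and> (\<integral>w. norm (U s w) \<partial>M) \<le> C"
    using U unfolding L1_process_def by blast
  obtain D where D: "\<And>s. s \<in> {a..b} \<Longrightarrow> integrable M (V s) \<and> (\<integral>w. norm (V s w) \<partial>M) \<le> D"
    using V unfolding L1_process_def by blast
  have "integrable M (\<lambda>w. U s w + V s w) \<and> (\<integral>w. norm (U s w + V s w) \<partial>M) \<le> C + D"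
    if s: "s \<in> {a..b}" for s
  proof
    show i: "integrable M (\<lambda>w. U s w + V s w)" using C[OF s] D[OF s] by simp
    have "(\<integral>w. norm (U s w + V s w) \<partial>M) \<le> (\<integral>w. norm (U s w) + norm (V s w) \<partial>M)"
      using C[OF s] D[OF s] i by (intro integral_mono) (auto simp: norm_triangle_ineq)
    also have "\<dots> \<le> C + D" using C[OF s] D[OF s] by simp
    finally show "(\<integral>w. norm (U s w + V s w) \<partial>M) \<le> C + D" .
  qed
  then show ?thesis using U V path_process_add[of M a b U V] unfolding L1_process_def by blast
qed

lemma L1_process_const:
  assumes "integrable M f" shows "L1_process M a b (\<lambda>s. f)"
  using assms unfolding L1_process_def by (auto intro: path_process_const)

lemma L1_process_scaleR:
  assumes U: "L1_process M a b U" shows "L1_process M a b (\<lambda>s w. c *\<^sub>R U s w)"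
proof -
  obtain C where C: "\<And>s. s \<in> {a..b} \<Longrightarrow> integrable M (U s) \<and> (\<integral>w. norm (U s w) \<partial>M) \<le> C"
    using U unfolding L1_process_def by blast
  have "path_process M a b (\<lambda>s w. c *\<^sub>R U s w)"
    using U unfolding L1_process_def path_process_def by (auto intro!: continuous_intros)
  moreover have "\<forall>s\<in>{a..b}. integrable M (\<lambda>w. c *\<^sub>R U s w) \<and> (\<integral>w. norm (c *\<^sub>R U s w) \<partial>M) \<le> \<bar>c\<bar> * C"
    using C by (auto intro!: mult_left_mono)
  ultimately show ?thesis unfolding L1_process_def by blast
qed

definition L2_process :: "'o measure \<Rightarrow> real \<Rightarrow> real \<Rightarrow> (real \<Rightarrow> 'o \<Rightarrow> 'b::euclidean_space) \<Rightarrow> bool" where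
  "L2_process M a b U \<longleftrightarrow> path_process M a b U \<and> L1_process M a b (\<lambda>s w. norm (U s w) ^ 2)"

lemma sum_power2_bound: "(x + y)^2 \<le> 2 * x^2 + 2 * (y::real)^2"
  using sum_squares_bound[of x y] by (simp add: power2_sum)

lemma L2_process_bound:
  assumes U: "path_process M a b U" and V: "L1_process M a b V"
    and le: "\<And>s. s \<in> {a..b} \<Longrightarrow> AE w in M. norm (U s w) ^ 2 \<le> norm (V s w)"
  shows "L2_process M a b U"
  unfolding L2_process_def
  using assms by (auto intro!: L1_process_bound[OF path_process_norm_power[OF U] V])

lemma L2_process_add:
  assumes U: "L2_process M a b U" and V: "L2_process M a b V"
  shows "L2_process M a b (\<lambda>s w. U s w + V s w)"
proof (rule L2_process_bound)
  show "path_process M a b (\<lambda>s w. U s w + V s w)"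
    using U V by (auto simp: L2_process_def intro: path_process_add)
  show "L1_process M a b (\<lambda>s w. 2 *\<^sub>R norm (U s w)^2 + 2 *\<^sub>R norm (V s w)^2)"
    using U V by (intro L1_process_add L1_process_scaleR) (auto simp: L2_process_def)
  have "norm (U s w + V s w) ^ 2 \<le> 2 * norm (U s w)^2 + 2 * norm (V s w)^2" for s w
    using norm_triangle_ineq[of "U s w" "V s w"] sum_power2_bound[of "norm (U s w)" "norm (V s w)"]
    by (meson norm_ge_zero order_trans power_mono)
  then show "AE w in M. norm (U s w + V s w) ^ 2 \<le> norm (2 *\<^sub>R norm (U s w)^2 + 2 *\<^sub>R norm (V s w)^2)" for s
    by simp
qed

lemma L2_process_matrix_vector:
  fixes R :: "real \<Rightarrow> real^'n^'m"
  assumes R: "continuous_on {a..b} R" and U: "L2_process M a b U"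
  shows "L2_process M a b (\<lambda>s w. R s *v U s w)"
proof -
  obtain L where L: "0 \<le> L" "\<And>s v. s \<in> {a..b} \<Longrightarrow> norm (R s *v v) \<le> L * norm v"
    using matrix_vector_path_bound[OF R] by blast
  show ?thesis
  proof (rule L2_process_bound)
    show "path_process M a b (\<lambda>s w. R s *v U s w)"
      using R U by (auto simp: L2_process_def intro: path_process_matrix_vector)
    show "L1_process M a b (\<lambda>s w. L^2 *\<^sub>R norm (U s w)^2)"
      using U by (intro L1_process_scaleR) (auto simp: L2_process_def)
    have "norm (R s *v U s w) ^ 2 \<le> L^2 * norm (U s w)^2" if "s \<in> {a..b}" for s w
      using power_mono[OF L(2)[OF that, of "U s w"] norm_ge_zero, of 2] by (simp add: power_mult_distrib)
    then show "AE w in M. norm (R s *v U s w) ^ 2 \<le> norm (L^2 *\<^sub>R norm (U s w)^2)"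
      if "s \<in> {a..b}" for s using that by simp
  qed
qed

lemma mult_le_sum_squares: "0 \<le> x \<Longrightarrow> 0 \<le> y \<Longrightarrow> x * y \<le> x^2 + (y::real)^2"
  using sum_squares_bound[of x y] mult_nonneg_nonneg[of x y] by linarith

lemma L1_process_inner:
  assumes U: "L2_process M a b U" and V: "L2_process M a b V"
  shows "L1_process M a b (\<lambda>s w. U s w \<bullet> V s w)"
proof (rule L1_process_bound)
  show "path_process M a b (\<lambda>s w. U s w \<bullet> V s w)"
    using U V by (auto simp: L2_process_def intro: path_process_inner)
  show "L1_process M a b (\<lambda>s w. norm (U s w)^2 + norm (V s w)^2)"
    using U V by (intro L1_process_add) (auto simp: L2_process_def)
  have "\<bar>U s w \<bullet> V s w\<bar> \<le> norm (U s w)^2 + norm (V s w)^2" for s w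
    using Cauchy_Schwarz_ineq2[of "U s w" "V s w"] mult_le_sum_squares[of "norm (U s w)" "norm (V s w)"]
    by simp
  then show "AE w in M. norm (U s w \<bullet> V s w) \<le> norm (norm (U s w)^2 + norm (V s w)^2)" for s
    by simp
qed

lemma L1_process_product:
  fixes f :: "'o \<Rightarrow> real"
  assumes f: "f \<in> borel_measurable M" "integrable M (\<lambda>w. f w ^ 2)" and U: "L2_process M a b U"
  shows "L1_process M a b (\<lambda>s w. f w *\<^sub>R U s w)"
proof (rule L1_process_bound)
  show "path_process M a b (\<lambda>s w. f w *\<^sub>R U s w)"
    using U f(1) by (auto simp: L2_process_def intro!: path_process_scaleR path_process_const)
  show "L1_process M a b (\<lambda>s w. f w ^2 + norm (U s w)^2)"
    using U f by (intro L1_process_add L1_process_const) (auto simp: L2_process_def)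
  have "\<bar>f w\<bar> * norm (U s w) \<le> f w ^2 + norm (U s w)^2" for s w
    using mult_le_sum_squares[of "\<bar>f w\<bar>" "norm (U s w)"] by simp
  then show "AE w in M. norm (f w *\<^sub>R U s w) \<le> norm (f w ^2 + norm (U s w)^2)" for s
    by simp
qed

section \<open>Noise with orthogonal increments\<close>

text \<open>
  The Cauchy-Schwarz inequality against the constant 1, read off from the nonnegative integral of
  \<open>((b - a) * f - integral f)^2\<close>.
\<close>

lemma integral_square_le:
  fixes f :: "real \<Rightarrow> real"
  assumes f: "continuous_on {a..b} f" and ab: "a \<le> b"
  shows "(integral {a..b} f)^2 \<le> (b - a) * integral {a..b} (\<lambda>s. f s ^ 2)"
proof (cases "a = b")
  case False
  define m where "m = integral {a..b} f"
  define q where "q = integral {a..b} (\<lambda>s. f s ^ 2)"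
  have fi: "f integrable_on {a..b}" "(\<lambda>s. f s ^ 2) integrable_on {a..b}"
    by (auto intro!: integrable_continuous_real continuous_intros f)
  have "((\<lambda>s. (b - a)^2 * f s ^ 2 - 2 * (b - a) * m * f s + m^2) has_integral
      (b - a)^2 * q - 2 * (b - a) * m * m + (b - a) * m^2) {a..b}"
    using ab by (intro has_integral_add has_integral_diff has_integral_mult_right
        integrable_integral[OF fi(1), folded m_def] integrable_integral[OF fi(2), folded q_def])
      (use has_integral_const_real[of "m^2" a b] ab in \<open>simp add: mult.commute\<close>)
  moreover have "(b - a)^2 * f s ^ 2 - 2 * (b - a) * m * f s + m^2 = ((b - a) * f s - m)^2" for s
    by (simp add: power2_eq_square algebra_simps)
  ultimately have "0 \<le> (b - a)^2 * q - 2 * (b - a) * m * m + (b - a) * m^2"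
    using has_integral_nonneg by (metis (no_types, lifting) zero_le_power2)
  also have "\<dots> = (b - a) * ((b - a) * q - m^2)"
    by (simp add: power2_eq_square algebra_simps)
  finally have "0 \<le> (b - a) * q - m^2"
    using False ab by (simp add: zero_le_mult_iff)
  then show ?thesis by (simp add: m_def q_def)
qed simp

lemma integral_vec_nth:
  fixes f :: "'o \<Rightarrow> real^'n"
  assumes "integrable M f"
  shows "integrable M (\<lambda>w. f w $ k)" "(\<integral>w. f w \<partial>M) $ k = (\<integral>w. f w $ k \<partial>M)"
  using integrable_bounded_linear[OF bounded_linear_vec_nth assms]
    integral_bounded_linear[OF bounded_linear_vec_nth assms] by auto

lemma L2_process_const:
  assumes "f \<in> borel_measurable M" "integrable M (\<lambda>w. norm (f w) ^ 2)"
  shows "L2_process M a b (\<lambda>s. f)"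
  using assms by (simp add: L2_process_def path_process_const L1_process_const)

lemma product_path:
  fixes R :: "real \<Rightarrow> real^'n^'m"
  assumes ab: "a \<le> b" and f: "continuous_on {a..b} f"
    and x: "\<And>s. s \<in> {a..b} \<Longrightarrow> x s = x0 + integral {a..s} f"
    and R: "\<And>s. s \<in> {a..b} \<Longrightarrow> (R has_vector_derivative R' s) (at s within {a..b})"
  shows "R b *v x b = R a *v x0 + integral {a..b} (\<lambda>s. R s *v f s + R' s *v x s)"
proof -
  note dx = has_vector_derivative_of_integral_equation[OF f x]
  have "((\<lambda>s. R s *v f s + R' s *v x s) has_integral R b *v x b - R a *v x a) {a..b}"
    by (intro fundamental_theorem_of_calculus ab
        bounded_bilinear.has_vector_derivative[OF bounded_bilinear_matrix_vector_mult] dx R)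
  then show ?thesis using x[of a] ab by (simp add: has_integral_iff)
qed

lemma inner_product_path:
  fixes P :: "real \<Rightarrow> real^'n^'m"
  assumes ab: "a \<le> b" and f: "continuous_on {a..b} f" and h: "continuous_on {a..b} h"
    and x: "\<And>s. s \<in> {a..b} \<Longrightarrow> x s = x0 + integral {a..s} f"
    and y: "\<And>s. s \<in> {a..b} \<Longrightarrow> y s = y0 + integral {a..s} h"
    and P: "\<And>s. s \<in> {a..b} \<Longrightarrow> (P has_vector_derivative P' s) (at s within {a..b})"
  shows "x b \<bullet> (P b *v y b) = x0 \<bullet> (P a *v y0) +
    integral {a..b} (\<lambda>s. f s \<bullet> (P s *v y s) + x s \<bullet> (P' s *v y s) + x s \<bullet> (P s *v h s))"
proof -
  note d = has_vector_derivative_of_integral_equation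
  have "((\<lambda>s. x s \<bullet> (P s *v h s + P' s *v y s) + f s \<bullet> (P s *v y s)) has_integral
      x b \<bullet> (P b *v y b) - x a \<bullet> (P a *v y a)) {a..b}"
    by (intro fundamental_theorem_of_calculus ab P d[OF f x] d[OF h y]
        bounded_bilinear.has_vector_derivative[OF bounded_bilinear_inner]
        bounded_bilinear.has_vector_derivative[OF bounded_bilinear_matrix_vector_mult])
  then have "x b \<bullet> (P b *v y b) = x a \<bullet> (P a *v y a) +
    integral {a..b} (\<lambda>s. x s \<bullet> (P s *v h s + P' s *v y s) + f s \<bullet> (P s *v y s))"
    by (simp add: has_integral_iff)
  moreover have "x a = x0" "y a = y0" using x[of a] y[of a] ab by simp_all
  ultimately show ?thesis by (simp add: inner_add_right algebra_simps)
qed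

text \<open>
  The second-order content of a Brownian motion restarted at time \<open>a\<close>. Gaussianity and
  independence are forgotten, because expectations of quadratic expressions see only these
  moments.
\<close>

locale standard_noise = prob_space M for M :: "'o measure" +
  fixes a b :: real and N :: "real \<Rightarrow> 'o \<Rightarrow> real^'w"
  assumes ab: "a \<le> b"
    and N_path: "path_process M a b N"
    and N_square: "\<And>s k. s \<in> {a..b} \<Longrightarrow> integrable M (\<lambda>w. (N s w $ k)^2)"
    and N_mean: "\<And>s k. s \<in> {a..b} \<Longrightarrow> (\<integral>w. N s w $ k \<partial>M) = 0"
    and N_cov: "\<And>s u k l. \<lbrakk>a \<le> s; s \<le> u; u \<le> b\<rbrakk> \<Longrightarrow>
       (\<integral>w. N s w $ k * N u w $ l \<partial>M) = (if k = l then s - a else 0)"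
begin

lemma N_meas [measurable]: "s \<in> {a..b} \<Longrightarrow> N s \<in> borel_measurable M"
  using N_path by (simp add: path_process_def)

lemma N_nth_meas: "s \<in> {a..b} \<Longrightarrow> (\<lambda>w. N s w $ k) \<in> borel_measurable M"
  by (rule measurable_compose[OF N_meas]) auto

lemma N_mult_integrable:
  assumes "s \<in> {a..b}" "u \<in> {a..b}"
  shows "integrable M (\<lambda>w. N s w $ k * N u w $ l)"
proof (rule Bochner_Integration.integrable_bound)
  show "integrable M (\<lambda>w. (N s w $ k)^2 + (N u w $ l)^2)"
    using assms by (intro Bochner_Integration.integrable_add N_square)
  show "(\<lambda>w. N s w $ k * N u w $ l) \<in> borel_measurable M"
    using assms by (intro borel_measurable_times N_nth_meas)
  have "\<bar>N s w $ k * N u w $ l\<bar> \<le> (N s w $ k)^2 + (N u w $ l)^2" for w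
    using mult_le_sum_squares[of "\<bar>N s w $ k\<bar>" "\<bar>N u w $ l\<bar>"] by (simp add: abs_mult)
  then show "AE w in M. norm (N s w $ k * N u w $ l) \<le> norm ((N s w $ k)^2 + (N u w $ l)^2)"
    by simp
qed

lemma N_nth_integrable: "s \<in> {a..b} \<Longrightarrow> integrable M (\<lambda>w. N s w $ k)"
  by (rule square_integrable_imp_integrable[OF N_nth_meas N_square])

lemma norm2_N: "norm (N s w)^2 = (\<Sum>k\<in>UNIV. (N s w $ k)^2)"
  by (simp only: power2_norm_eq_inner inner_vec_def) (simp add: power2_eq_square)

lemma N_L2: "L2_process M a b N"
  unfolding L2_process_def L1_process_def
proof (intro conjI N_path path_process_norm_power exI[of _ "real CARD('w) * (b - a)"] ballI)
  fix s assume s: "s \<in> {a..b}"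
  show "integrable M (\<lambda>w. norm (N s w)^2)"
    unfolding norm2_N by (intro Bochner_Integration.integrable_sum N_square s)
  have "(\<integral>w. norm (norm (N s w)^2) \<partial>M) = (\<Sum>k\<in>UNIV. \<integral>w. (N s w $ k)^2 \<partial>M)"
    unfolding norm2_N using N_square[OF s] by (simp add: sum_nonneg)
  also have "\<dots> = real CARD('w) * (s - a)"
    using N_cov[of s s] s by (simp add: power2_eq_square)
  also have "\<dots> \<le> real CARD('w) * (b - a)" using s by (intro mult_left_mono) auto
  finally show "(\<integral>w. norm (norm (N s w)^2) \<partial>M) \<le> real CARD('w) * (b - a)" .
qed

lemma increment:
  assumes "s \<in> {a..b}" "u \<in> {a..b}"
  shows "(\<lambda>w. N u w $ k - N s w $ k) \<in> borel_measurable M"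
    and "integrable M (\<lambda>w. (N u w $ k - N s w $ k)^2)"
proof -
  show "(\<lambda>w. N u w $ k - N s w $ k) \<in> borel_measurable M"
    using assms by (intro borel_measurable_diff N_nth_meas)
  have "integrable M (\<lambda>w. (N u w $ k)^2 + (N s w $ k)^2 - 2 * (N u w $ k * N s w $ k))"
    using assms by (intro Bochner_Integration.integrable_add Bochner_Integration.integrable_diff
        N_square integrable_mult_right N_mult_integrable)
  then show "integrable M (\<lambda>w. (N u w $ k - N s w $ k)^2)"
    by (simp add: power2_diff algebra_simps)
qed

text \<open>
  A second-order substitute for adaptedness: the process at an earlier time is orthogonal to later
  increments of the noise. It needs no filtration, and it is inherited by solutions of linear
  equations through uniqueness rather than through measurability.
\<close>

definition nonanticipating :: "(real \<Rightarrow> 'o \<Rightarrow> real^'n) \<Rightarrow> bool" where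
  "nonanticipating U \<longleftrightarrow> L2_process M a b U \<and>
     (\<forall>r s u k. a \<le> r \<longrightarrow> r \<le> s \<longrightarrow> s \<le> u \<longrightarrow> u \<le> b \<longrightarrow>
        (\<integral>w. (N u w $ k - N s w $ k) *\<^sub>R U r w \<partial>M) = 0)"

lemma nonanticipating_L2: "nonanticipating U \<Longrightarrow> L2_process M a b U"
  by (simp add: nonanticipating_def)

lemma increment_product_integrable:
  assumes "L2_process M a b U" "r \<in> {a..b}" "s \<in> {a..b}" "u \<in> {a..b}"
  shows "integrable M (\<lambda>w. (N u w $ k - N s w $ k) *\<^sub>R U r w)"
  using assms by (intro L1_process_integrable[OF L1_process_product[OF increment]])

lemma nonanticipating_noise: "nonanticipating N"
  unfolding nonanticipating_def
proof (intro conjI N_L2 allI impI)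
  fix r s u k assume *: "a \<le> r" "r \<le> s" "s \<le> u" "u \<le> b"
  then have mem: "r \<in> {a..b}" "s \<in> {a..b}" "u \<in> {a..b}" by auto
  show "(\<integral>w. (N u w $ k - N s w $ k) *\<^sub>R N r w \<partial>M) = 0"
  proof (subst vec_eq_iff, intro allI)
    fix l
    have "(\<integral>w. (N u w $ k - N s w $ k) *\<^sub>R N r w \<partial>M) $ l
        = (\<integral>w. N r w $ l * N u w $ k - N r w $ l * N s w $ k \<partial>M)"
      using integral_vec_nth[OF increment_product_integrable[OF N_L2 mem]]
      by (simp add: algebra_simps)
    also have "\<dots> = 0"
      using * mem by (subst Bochner_Integration.integral_diff)
        (auto intro!: N_mult_integrable simp: N_cov)
    finally show "(\<integral>w. (N u w $ k - N s w $ k) *\<^sub>R N r w \<partial>M) $ l = 0 $ l" by simp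
  qed
qed

lemma nonanticipating_add:
  assumes U: "nonanticipating U" and V: "nonanticipating V"
  shows "nonanticipating (\<lambda>s w. U s w + V s w)"
  unfolding nonanticipating_def
proof (intro conjI allI impI)
  show "L2_process M a b (\<lambda>s w. U s w + V s w)"
    using U V by (intro L2_process_add nonanticipating_L2)
  fix r s u k assume *: "a \<le> r" "r \<le> s" "s \<le> u" "u \<le> b"
  then have mem: "r \<in> {a..b}" "s \<in> {a..b}" "u \<in> {a..b}" by auto
  show "(\<integral>w. (N u w $ k - N s w $ k) *\<^sub>R (U r w + V r w) \<partial>M) = 0"
    unfolding scaleR_add_right
    using U V * increment_product_integrable[OF nonanticipating_L2 mem]
    by (subst Bochner_Integration.integral_add) (auto simp: nonanticipating_def)
qed

lemma nonanticipating_matrix_vector: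
  fixes R :: "real \<Rightarrow> real^'n^'m"
  assumes R: "continuous_on {a..b} R" and U: "nonanticipating U"
  shows "nonanticipating (\<lambda>s w. R s *v U s w)"
  unfolding nonanticipating_def
proof (intro conjI allI impI)
  show "L2_process M a b (\<lambda>s w. R s *v U s w)"
    by (intro L2_process_matrix_vector R nonanticipating_L2 U)
  fix r s u k assume *: "a \<le> r" "r \<le> s" "s \<le> u" "u \<le> b"
  then have mem: "r \<in> {a..b}" "s \<in> {a..b}" "u \<in> {a..b}" by auto
  show "(\<integral>w. (N u w $ k - N s w $ k) *\<^sub>R (R r *v U r w) \<partial>M) = 0"
    using integral_bounded_linear[OF matrix_vector_mul_bounded_linear[of "R r"]
        increment_product_integrable[OF nonanticipating_L2[OF U] mem]] U *
    by (simp add: matrix_vector_mult_scaleR nonanticipating_def)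
qed

text \<open>
  Gronwall along each path bounds the solution by the integral of the forcing over the whole
  interval, whose square is integrable by the Cauchy-Schwarz inequality and Fubini.
\<close>

lemma linear_ode_L2:
  fixes A :: "real \<Rightarrow> real^'n^'n"
  assumes A: "continuous_on {a..b} A" and f: "L2_process M a b f" and Y: "path_process M a b Y"
    and eq: "AE w in M. \<forall>s\<in>{a..b}. Y s w = y0 + integral {a..s} (\<lambda>r. A r *v Y r w + f r w)"
  shows "L2_process M a b Y"
proof -
  obtain L where L: "0 \<le> L" "\<And>s v. s \<in> {a..b} \<Longrightarrow> norm (A s *v v) \<le> L * norm v"
    using matrix_vector_path_bound[OF A] by blast
  define e where "e = exp (L * (b - a))"
  have fpath: "path_process M a b f" using f by (simp add: L2_process_def)
  define V where "V = (\<lambda>w. e^2 * (2 * norm y0 ^ 2 + 2 * ((b - a) * integral {a..b} (\<lambda>s. norm (f s w)^2))))"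
  have Vint: "integrable M V"
    unfolding V_def using f L1_process_fubini(1)[OF _ ab sigma_finite_measure_axioms]
    by (intro integrable_mult_right Bochner_Integration.integrable_add) (auto simp: L2_process_def)
  show ?thesis
  proof (rule L2_process_bound[OF Y L1_process_const[OF Vint]])
    fix s assume s: "s \<in> {a..b}"
    show "AE w in M. norm (Y s w)^2 \<le> norm (V w)"
      using eq AE_space
    proof eventually_elim
      case (elim w)
      have Yc: "continuous_on {a..b} (\<lambda>s. Y s w)" and fc: "continuous_on {a..b} (\<lambda>s. f s w)"
        using Y fpath elim(2) by (auto simp: path_process_def)
      define m where "m = integral {a..b} (\<lambda>s. norm (f s w))"
      have nfi: "(\<lambda>s. norm (f s w)) integrable_on {a..q}" if "q \<in> {a..b}" for q
        using that by (intro integrable_continuous_real continuous_intros continuous_on_subset[OF fc]) auto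
      have nYi: "(\<lambda>s. norm (Y s w)) integrable_on {a..q}" if "q \<in> {a..b}" for q
        using that by (intro integrable_continuous_real continuous_intros continuous_on_subset[OF Yc]) auto
      have "norm (Y s w) \<le> (norm y0 + m) * exp (L * (s - a))"
      proof (rule gronwall[OF _ _ _ s])
        show "continuous_on {a..b} (\<lambda>s. norm (Y s w))" by (intro continuous_intros Yc)
        show "0 \<le> L" by (rule L)
        fix q assume q: "q \<in> {a..b}"
        have sub: "{a..q} \<subseteq> {a..b}" using q by auto
        have "norm (Y q w) \<le> norm y0 + norm (integral {a..q} (\<lambda>r. A r *v Y r w + f r w))"
          unfolding bspec[OF elim(1) q] by (rule norm_triangle_ineq)
        also have "norm (integral {a..q} (\<lambda>r. A r *v Y r w + f r w))
            \<le> integral {a..q} (\<lambda>r. L * norm (Y r w) + norm (f r w))"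
        proof (rule integral_norm_bound_integral)
          show "(\<lambda>r. A r *v Y r w + f r w) integrable_on {a..q}"
            by (intro integrable_continuous_real continuous_intros continuous_on_subset[OF _ sub] A Yc fc)
          show "(\<lambda>r. L * norm (Y r w) + norm (f r w)) integrable_on {a..q}"
            by (intro integrable_add integrable_on_mult_right nYi nfi q)
          fix r assume "r \<in> {a..q}"
          then have r: "r \<in> {a..b}" using sub by auto
          show "norm (A r *v Y r w + f r w) \<le> L * norm (Y r w) + norm (f r w)"
            using L(2)[OF r, of "Y r w"] norm_triangle_ineq[of "A r *v Y r w" "f r w"] by simp
        qed
        also have "\<dots> = L * integral {a..q} (\<lambda>r. norm (Y r w)) + integral {a..q} (\<lambda>r. norm (f r w))"
          by (simp add: integral_add[OF integrable_on_mult_right[OF nYi[OF q]] nfi[OF q]])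
        also have "integral {a..q} (\<lambda>r. norm (f r w)) \<le> m"
          unfolding m_def using sub ab by (intro integral_subset_le nfi q) auto
        finally show "norm (Y q w) \<le> norm y0 + m + L * integral {a..q} (\<lambda>r. norm (Y r w))"
          by simp
      qed
      also have "\<dots> \<le> (norm y0 + m) * e"
      proof (rule mult_left_mono)
        show "exp (L * (s - a)) \<le> e"
          unfolding e_def using s L(1) by (auto intro!: mult_left_mono)
        show "0 \<le> norm y0 + m"
          unfolding m_def using nfi[of b] ab by (auto intro!: add_nonneg_nonneg integral_nonneg)
      qed
      finally have "norm (Y s w)^2 \<le> ((norm y0 + m) * e)^2" by (rule power_mono) simp
      also have "\<dots> = e^2 * (norm y0 + m)^2" by (simp add: power_mult_distrib)
      also have "\<dots> \<le> e^2 * (2 * norm y0 ^ 2 + 2 * m^2)"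
        by (intro mult_left_mono sum_power2_bound) simp
      also have "m^2 \<le> (b - a) * integral {a..b} (\<lambda>s. norm (f s w)^2)"
        unfolding m_def by (intro integral_square_le ab continuous_intros fc)
      finally have "norm (Y s w)^2 \<le> V w" by (simp add: V_def mult_left_mono)
      then show ?case by simp
    qed
  qed
qed

text \<open>
  For a fixed later increment \<open>\<nu>\<close>, the moment \<open>c q = E[\<nu> Y q]\<close> solves the
  homogeneous linear equation with initial value 0, since \<open>\<nu>\<close> is orthogonal to the
  forcing and centred. Hence \<open>c\<close> vanishes.
\<close>

lemma nonanticipating_linear_ode:
  fixes A :: "real \<Rightarrow> real^'n^'n"
  assumes A: "continuous_on {a..b} A" and f: "nonanticipating f" and Y: "path_process M a b Y"
    and eq: "AE w in M. \<forall>s\<in>{a..b}. Y s w = y0 + integral {a..s} (\<lambda>r. A r *v Y r w + f r w)"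
  shows "nonanticipating Y"
proof -
  have YL2: "L2_process M a b Y" by (rule linear_ode_L2[OF A nonanticipating_L2[OF f] Y eq])
  have rhsL2: "L2_process M a b (\<lambda>r w. A r *v Y r w + f r w)"
    by (intro L2_process_add L2_process_matrix_vector A YL2 nonanticipating_L2 f)
  obtain L where L: "0 \<le> L" "\<And>s v. s \<in> {a..b} \<Longrightarrow> norm (A s *v v) \<le> L * norm v"
    using matrix_vector_path_bound[OF A] by blast
  show ?thesis
    unfolding nonanticipating_def
  proof (intro conjI YL2 allI impI)
    fix r s u k assume *: "a \<le> r" "r \<le> s" "s \<le> u" "u \<le> b"
    then have mem: "s \<in> {a..b}" "u \<in> {a..b}" by auto
    define \<nu> where "\<nu> = (\<lambda>w. N u w $ k - N s w $ k)"
    have \<nu>int: "integrable M \<nu>" "(\<integral>w. \<nu> w \<partial>M) = 0"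
      unfolding \<nu>_def using mem N_mean by (auto intro!: N_nth_integrable simp: N_nth_integrable)
    have L1: "L1_process M a b (\<lambda>r w. \<nu> w *\<^sub>R U r w)" if "L2_process M a b U" for U :: "real \<Rightarrow> 'o \<Rightarrow> real^'n"
      unfolding \<nu>_def by (rule L1_process_product[OF increment[OF mem] that])
    define c where "c = (\<lambda>q. \<integral>w. \<nu> w *\<^sub>R Y q w \<partial>M)"
    have drift: "(\<integral>w. \<nu> w *\<^sub>R (A p *v Y p w + f p w) \<partial>M) = A p *v c p" if p: "p \<in> {a..s}" for p
    proof -
      have pb: "p \<in> {a..b}" using p mem by auto
      have i: "integrable M (\<lambda>w. \<nu> w *\<^sub>R Y p w)" "integrable M (\<lambda>w. \<nu> w *\<^sub>R f p w)"
        by (intro L1_process_integrable[OF L1 pb] YL2 nonanticipating_L2 f)+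
      have "integrable M (\<lambda>w. A p *v (\<nu> w *\<^sub>R Y p w))"
        by (rule integrable_bounded_linear[OF matrix_vector_mul_bounded_linear i(1)])
      moreover have "(\<integral>w. A p *v (\<nu> w *\<^sub>R Y p w) \<partial>M) = A p *v c p"
        unfolding c_def by (rule integral_bounded_linear[OF matrix_vector_mul_bounded_linear i(1)])
      moreover have "(\<integral>w. \<nu> w *\<^sub>R f p w \<partial>M) = 0"
        using f p * by (auto simp: nonanticipating_def \<nu>_def)
      ultimately show ?thesis
        using i by (simp add: scaleR_add_right matrix_vector_mult_scaleR)
    qed
    have ceq: "c q = integral {a..q} (\<lambda>p. A p *v c p)" and hint: "(\<lambda>p. A p *v c p) integrable_on {a..q}"
      if q: "q \<in> {a..s}" for q
    proof -
      have qb: "q \<in> {a..b}" and aq: "a \<le> q" using q mem by auto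
      have L1q: "L1_process M a q (\<lambda>p w. \<nu> w *\<^sub>R (A p *v Y p w + f p w))"
        using qb by (intro L1_process_subinterval[OF L1[OF rhsL2]]) auto
      note fub = L1_process_fubini[OF L1q aq sigma_finite_measure_axioms]
      have E: "integral {a..q} (\<lambda>p. \<integral>w. \<nu> w *\<^sub>R (A p *v Y p w + f p w) \<partial>M)
          = integral {a..q} (\<lambda>p. A p *v c p)"
        using q by (intro Henstock_Kurzweil_Integration.integral_cong drift) auto
      show "(\<lambda>p. A p *v c p) integrable_on {a..q}"
        using q by (intro Henstock_Kurzweil_Integration.integrable_eq[OF fub(2)] drift) auto
      have "c q = (\<integral>w. \<nu> w *\<^sub>R y0 + integral {a..q} (\<lambda>p. \<nu> w *\<^sub>R (A p *v Y p w + f p w)) \<partial>M)"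
        unfolding c_def
      proof (rule integral_cong_AE)
        show "(\<lambda>w. \<nu> w *\<^sub>R Y q w) \<in> borel_measurable M"
          using L1_process_integrable[OF L1[OF YL2] qb] by auto
        show "(\<lambda>w. \<nu> w *\<^sub>R y0 + integral {a..q} (\<lambda>p. \<nu> w *\<^sub>R (A p *v Y p w + f p w))) \<in> borel_measurable M"
          using fub(1) \<nu>int(1) by (intro borel_measurable_add) auto
        show "AE w in M. \<nu> w *\<^sub>R Y q w
            = \<nu> w *\<^sub>R y0 + integral {a..q} (\<lambda>p. \<nu> w *\<^sub>R (A p *v Y p w + f p w))"
          using eq
        proof eventually_elim
          case (elim w)
          show ?case
            unfolding bspec[OF elim qb] scaleR_add_right[of _ y0]
            by (simp only: integral_cmul)
        qed
      qed
      also have "\<dots> = integral {a..q} (\<lambda>p. A p *v c p)"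
        using fub(1,3) \<nu>int E by (subst Bochner_Integration.integral_add) auto
      finally show "c q = integral {a..q} (\<lambda>p. A p *v c p)" .
    qed
    have s_mem: "s \<in> {a..s}" using mem by auto
    have "continuous_on {a..s} (\<lambda>q. integral {a..q} (\<lambda>p. A p *v c p))"
      by (rule indefinite_integral_continuous_1[OF hint[OF s_mem]])
    then have cc: "continuous_on {a..s} c" by (rule continuous_on_eq) (rule ceq[symmetric])
    have "norm (c r) \<le> 0 * exp (L * (r - a))"
    proof (rule gronwall)
      show "continuous_on {a..s} (\<lambda>q. norm (c q))" by (intro continuous_intros cc)
      show "0 \<le> L" by (rule L)
      show "r \<in> {a..s}" using * by simp
      fix q assume q: "q \<in> {a..s}"
      have ni: "(\<lambda>r. norm (c r)) integrable_on {a..q}"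
        using q by (intro integrable_continuous_real continuous_intros continuous_on_subset[OF cc]) auto
      have "norm (c q) \<le> integral {a..q} (\<lambda>p. L * norm (c p))"
        unfolding ceq[OF q]
      proof (rule integral_norm_bound_integral[OF hint[OF q] integrable_on_mult_right[OF ni]])
        fix p assume "p \<in> {a..q}"
        then have p: "p \<in> {a..b}" using q mem by auto
        show "norm (A p *v c p) \<le> L * norm (c p)" by (rule L(2)[OF p])
      qed
      then show "norm (c q) \<le> 0 + L * integral {a..q} (\<lambda>r. norm (c r))" by simp
    qed
    then show "(\<integral>w. (N u w $ k - N s w $ k) *\<^sub>R Y r w \<partial>M) = 0"
      by (simp add: c_def \<nu>_def)
  qed
qed

end

section \<open>The product rule under the expectation\<close>

lemma path_mean_add:
  fixes F G :: "real \<Rightarrow> 'o \<Rightarrow> real"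
  assumes F: "L1_process M a b F" and G: "L1_process M a b G"
    and ab: "a \<le> b" and M: "sigma_finite_measure M"
  shows "(\<integral>w. integral {a..b} (\<lambda>s. F s w + G s w) \<partial>M) =
    (\<integral>w. integral {a..b} (\<lambda>s. F s w) \<partial>M) + (\<integral>w. integral {a..b} (\<lambda>s. G s w) \<partial>M)"
proof -
  have i: "(\<lambda>s. H s w) integrable_on {a..b}" if "L1_process M a b H" "w \<in> space M"
    for H :: "real \<Rightarrow> 'o \<Rightarrow> real" and w
    using that by (intro integrable_continuous_real) (auto simp: L1_process_def path_process_def)
  have "(\<integral>w. integral {a..b} (\<lambda>s. F s w + G s w) \<partial>M) =
      (\<integral>w. integral {a..b} (\<lambda>s. F s w) + integral {a..b} (\<lambda>s. G s w) \<partial>M)"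
    by (intro Bochner_Integration.integral_cong refl
        Henstock_Kurzweil_Integration.integral_add i[OF F] i[OF G])
  also have "\<dots> = (\<integral>w. integral {a..b} (\<lambda>s. F s w) \<partial>M) + (\<integral>w. integral {a..b} (\<lambda>s. G s w) \<partial>M)"
    by (intro Bochner_Integration.integral_add L1_process_fubini(1) F G ab M)
  finally show ?thesis .
qed

lemma inner_eq_sum_nth: "(x :: real^'n) \<bullet> y = (\<Sum>k\<in>UNIV. x $ k * y $ k)"
  by (simp add: inner_vec_def)

context standard_noise
begin

lemma N_fixed_time_L2: "s \<in> {a..b} \<Longrightarrow> L2_process M a b (\<lambda>_. N s)"
  using N_L2 by (intro L2_process_const N_meas) (auto simp: L2_process_def L1_process_def)

text \<open>
  Inside the time integral, the terminal noise \<open>N b\<close> may be replaced by the current noise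
  \<open>N s\<close>, because the increment in between is orthogonal to the drift at time
  \<open>s\<close>.
\<close>

lemma noise_times_drift:
  fixes \<rho> :: "real \<Rightarrow> 'o \<Rightarrow> real^'w"
  assumes \<rho>: "nonanticipating \<rho>" and q: "AE w in M. q w = q0 + integral {a..b} (\<lambda>s. \<rho> s w)"
    and q_meas: "q \<in> borel_measurable M"
  shows "(\<integral>w. N b w \<bullet> q w \<partial>M) = (\<integral>w. integral {a..b} (\<lambda>s. N s w \<bullet> \<rho> s w) \<partial>M)"
proof -
  have b: "b \<in> {a..b}" using ab by simp
  have \<rho>L2: "L2_process M a b \<rho>" by (rule nonanticipating_L2[OF \<rho>])
  have L1: "L1_process M a b (\<lambda>s w. N b w \<bullet> \<rho> s w)"
    by (rule L1_process_inner[OF N_fixed_time_L2[OF b] \<rho>L2])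
  have L1': "L1_process M a b (\<lambda>s w. N s w \<bullet> \<rho> s w)" by (rule L1_process_inner[OF N_L2 \<rho>L2])
  note fub = L1_process_fubini[OF L1 ab sigma_finite_measure_axioms]
  note fub' = L1_process_fubini[OF L1' ab sigma_finite_measure_axioms]
  have N0: "integrable M (\<lambda>w. N b w \<bullet> q0)" "(\<integral>w. N b w \<bullet> q0 \<partial>M) = 0"
    unfolding inner_eq_sum_nth using N_mean[OF b] N_nth_integrable[OF b]
    by (auto intro!: Bochner_Integration.integrable_sum)
  have same: "(\<integral>w. N b w \<bullet> \<rho> s w \<partial>M) = (\<integral>w. N s w \<bullet> \<rho> s w \<partial>M)" if s: "s \<in> {a..b}" for s
  proof -
    have i: "integrable M (\<lambda>w. (N b w $ k - N s w $ k) *\<^sub>R \<rho> s w)" for k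
      by (rule increment_product_integrable[OF \<rho>L2 s s b])
    have z: "(\<integral>w. (N b w $ k - N s w $ k) * \<rho> s w $ k \<partial>M) = 0" for k
    proof -
      have "(\<integral>w. (N b w $ k - N s w $ k) *\<^sub>R \<rho> s w \<partial>M) = 0"
        using \<rho> s by (auto simp: nonanticipating_def)
      then show ?thesis using integral_vec_nth(2)[OF i[of k], of k] by simp
    qed
    have "(\<integral>w. N b w \<bullet> \<rho> s w \<partial>M) - (\<integral>w. N s w \<bullet> \<rho> s w \<partial>M)
        = (\<integral>w. (N b w \<bullet> \<rho> s w) - (N s w \<bullet> \<rho> s w) \<partial>M)"
      by (rule Bochner_Integration.integral_diff[symmetric])
        (use L1 L1' s in \<open>auto intro: L1_process_integrable\<close>)
    also have "\<dots> = (\<integral>w. (\<Sum>k\<in>UNIV. (N b w $ k - N s w $ k) * \<rho> s w $ k) \<partial>M)"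
      by (simp add: inner_eq_sum_nth left_diff_distrib sum_subtractf)
    also have "\<dots> = (\<Sum>k\<in>UNIV. \<integral>w. (N b w $ k - N s w $ k) * \<rho> s w $ k \<partial>M)"
      using integral_vec_nth(1)[OF i] by (intro Bochner_Integration.integral_sum) simp
    also have "\<dots> = 0" by (simp add: z)
    finally show ?thesis by simp
  qed
  have "(\<integral>w. N b w \<bullet> q w \<partial>M) = (\<integral>w. N b w \<bullet> q0 + integral {a..b} (\<lambda>s. N b w \<bullet> \<rho> s w) \<partial>M)"
  proof (rule integral_cong_AE)
    show "(\<lambda>w. N b w \<bullet> q w) \<in> borel_measurable M"
      by (intro borel_measurable_inner N_meas b q_meas)
    show "(\<lambda>w. N b w \<bullet> q0 + integral {a..b} (\<lambda>s. N b w \<bullet> \<rho> s w)) \<in> borel_measurable M"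
      using fub(1) N0(1) by (intro borel_measurable_add) auto
    show "AE w in M. N b w \<bullet> q w = N b w \<bullet> q0 + integral {a..b} (\<lambda>s. N b w \<bullet> \<rho> s w)"
      using q AE_space
    proof eventually_elim
      case (elim w)
      have "(\<lambda>s. \<rho> s w) integrable_on {a..b}"
        using \<rho>L2 elim(2) by (intro integrable_continuous_real) (auto simp: L2_process_def path_process_def)
      from integral_linear[OF this bounded_linear_inner_right[of "N b w"]]
      show ?case by (simp add: elim(1) inner_add_right o_def)
    qed
  qed
  also have "\<dots> = integral {a..b} (\<lambda>s. \<integral>w. N b w \<bullet> \<rho> s w \<partial>M)"
    using fub(1,3) N0 by (subst Bochner_Integration.integral_add) auto
  also have "\<dots> = integral {a..b} (\<lambda>s. \<integral>w. N s w \<bullet> \<rho> s w \<partial>M)"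
    by (rule Henstock_Kurzweil_Integration.integral_cong[OF same])
  finally show ?thesis unfolding fub'(3) .
qed

lemma noise_times_matrix_drift:
  fixes R :: "real \<Rightarrow> real^'n^'w"
  assumes f: "nonanticipating f" and D: "nonanticipating D"
    and Deq: "AE w in M. \<forall>s\<in>{a..b}. D s w = u + integral {a..s} (\<lambda>r. f r w)"
    and R: "\<And>s. s \<in> {a..b} \<Longrightarrow> (R has_vector_derivative R' s) (at s within {a..b})"
    and R': "continuous_on {a..b} R'"
  shows "(\<integral>w. N b w \<bullet> (R b *v D b w) \<partial>M)
    = (\<integral>w. integral {a..b} (\<lambda>s. N s w \<bullet> (R s *v f s w + R' s *v D s w)) \<partial>M)"
proof (rule noise_times_drift)
  have Rc: "continuous_on {a..b} R"
    using R by (meson continuous_on_eq_continuous_within has_vector_derivative_continuous)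
  show "nonanticipating (\<lambda>s w. R s *v f s w + R' s *v D s w)"
    by (intro nonanticipating_add nonanticipating_matrix_vector f D Rc R')
  show "(\<lambda>w. R b *v D b w) \<in> borel_measurable M"
    using L2_process_matrix_vector[OF Rc nonanticipating_L2[OF D]] ab
    by (simp add: L2_process_def path_process_def)
  show "AE w in M. R b *v D b w = R a *v u + integral {a..b} (\<lambda>s. R s *v f s w + R' s *v D s w)"
    using Deq AE_space
  proof eventually_elim
    case (elim w)
    have "continuous_on {a..b} (\<lambda>s. f s w)"
      using f elim(2) by (simp add: nonanticipating_def L2_process_def path_process_def)
    then show ?case by (rule product_path[OF ab _ bspec[OF elim(1)] R])
  qed
qed

lemma noise_quadratic:
  assumes s: "s \<in> {a..b}"
  shows "(\<integral>w. N s w \<bullet> (R *v N s w) \<partial>M) = (s - a) * trace R"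
proof -
  have cov: "(\<integral>w. N s w $ k * N s w $ l \<partial>M) = (if k = l then s - a else 0)" for k l
    using N_cov[of s s k l] s by simp
  have "(\<integral>w. N s w \<bullet> (R *v N s w) \<partial>M)
      = (\<integral>w. (\<Sum>k\<in>UNIV. \<Sum>l\<in>UNIV. R $ k $ l * (N s w $ k * N s w $ l)) \<partial>M)"
    by (simp add: inner_eq_sum_nth matrix_vector_mult_def sum_distrib_left mult_ac)
  also have "\<dots> = (\<Sum>k\<in>UNIV. \<Sum>l\<in>UNIV. R $ k $ l * (\<integral>w. N s w $ k * N s w $ l \<partial>M))"
    using N_mult_integrable[OF s s] by simp
  also have "\<dots> = (\<Sum>k\<in>UNIV. R $ k $ k * (s - a))"
    unfolding cov by (simp add: if_distrib cong: if_cong)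
  finally show ?thesis by (simp add: trace_def sum_distrib_left mult.commute)
qed

text \<open>
  A path driven by a drift and by the noise with a constant coefficient; sensitivities have
  coefficient 0.
\<close>

definition noisy_path ::
    "real^'w^'n \<Rightarrow> real^'n \<Rightarrow> (real \<Rightarrow> 'o \<Rightarrow> real^'n) \<Rightarrow> (real \<Rightarrow> 'o \<Rightarrow> real^'n) \<Rightarrow> bool" where
  "noisy_path \<alpha> u f U \<longleftrightarrow> nonanticipating f \<and> nonanticipating U \<and>
     (AE w in M. \<forall>s\<in>{a..b}. U s w = u + integral {a..s} (\<lambda>r. f r w) + \<alpha> *v N s w)"

text \<open>
  Ito's formula for a bilinear expression with a deterministic matrix, under the expectation. Both
  paths are split into an absolutely continuous part and a multiple of the noise. The four products
  are treated separately: the first by the classical product rule, the two mixed ones by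
  \<open>noise_times_drift\<close>, and the last by the explicit covariance of the noise, which
  contributes the trace.
\<close>

theorem expected_product_rule:
  fixes P P' :: "real \<Rightarrow> real^'n^'m"
  assumes U: "noisy_path \<alpha> u f U" and V: "noisy_path \<beta> v h V"
    and P: "\<And>s. s \<in> {a..b} \<Longrightarrow> (P has_vector_derivative P' s) (at s within {a..b})"
    and P': "continuous_on {a..b} P'"
  shows "(\<integral>w. U b w \<bullet> (P b *v V b w) \<partial>M) = u \<bullet> (P a *v v) +
    (\<integral>w. integral {a..b} (\<lambda>s. f s w \<bullet> (P s *v V s w) + U s w \<bullet> (P' s *v V s w)
        + U s w \<bullet> (P s *v h s w)) \<partial>M)
    + integral {a..b} (\<lambda>s. trace (transpose \<alpha> ** P s ** \<beta>))"
proof -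
  have b: "b \<in> {a..b}" using ab by simp
  have Pc: "continuous_on {a..b} P"
    using P by (meson continuous_on_eq_continuous_within has_vector_derivative_continuous)
  note c_intros = continuous_intros Pc P'
  define D where "D = (\<lambda>s w. U s w + (- \<alpha>) *v N s w)"
  define E where "E = (\<lambda>s w. V s w + (- \<beta>) *v N s w)"
  have nonant: "nonanticipating f" "nonanticipating h" "nonanticipating U" "nonanticipating V"
    using U V by (auto simp: noisy_path_def)
  have nonant': "nonanticipating D" "nonanticipating E"
    unfolding D_def E_def
    by (intro nonanticipating_add nonanticipating_matrix_vector nonant nonanticipating_noise
        continuous_intros)+
  have UD: "U s w = D s w + \<alpha> *v N s w" and VE: "V s w = E s w + \<beta> *v N s w" for s w
    by (simp_all add: D_def E_def bounded_bilinear.minus_left[OF bounded_bilinear_matrix_vector_mult])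
  have Deq: "AE w in M. \<forall>s\<in>{a..b}. D s w = u + integral {a..s} (\<lambda>r. f r w)"
    using U unfolding noisy_path_def UD by (auto elim!: eventually_mono)
  have Eeq: "AE w in M. \<forall>s\<in>{a..b}. E s w = v + integral {a..s} (\<lambda>r. h r w)"
    using V unfolding noisy_path_def VE by (auto elim!: eventually_mono)
  have path: "continuous_on {a..b} (\<lambda>s. Y s w)" if "nonanticipating Y" "w \<in> space M"
    for Y :: "real \<Rightarrow> 'o \<Rightarrow> real^'k" and w
    using that by (auto simp: nonanticipating_def L2_process_def path_process_def)
  have L2N: "L2_process M a b (\<lambda>s w. R s *v N s w)" if "continuous_on {a..b} R" for R :: "real \<Rightarrow> real^'w^'k"
    by (intro L2_process_matrix_vector that N_L2)
  have L1: "L1_process M a b (\<lambda>s w. Y s w \<bullet> (R s *v Z s w))"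
    if "L2_process M a b Y" "L2_process M a b Z" "continuous_on {a..b} R"
    for Y :: "real \<Rightarrow> 'o \<Rightarrow> real^'k" and R :: "real \<Rightarrow> real^'l^'k" and Z
    by (intro L1_process_inner L2_process_matrix_vector that)
  note L2 = nonant[THEN nonanticipating_L2] nonant'[THEN nonanticipating_L2]
    L2N[OF continuous_on_const]
  let ?J = "\<lambda>F. \<integral>w. integral {a..b} (\<lambda>s. F s w) \<partial>M"
  define F1 where "F1 = (\<lambda>s w. f s w \<bullet> (P s *v E s w) + D s w \<bullet> (P' s *v E s w) + D s w \<bullet> (P s *v h s w))"
  define F2 where "F2 = (\<lambda>s w. f s w \<bullet> (P s *v (\<beta> *v N s w)) + D s w \<bullet> (P' s *v (\<beta> *v N s w)))"
  define F3 where "F3 = (\<lambda>s w. (\<alpha> *v N s w) \<bullet> (P s *v h s w) + (\<alpha> *v N s w) \<bullet> (P' s *v E s w))"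
  define F4 where "F4 = (\<lambda>s w. (\<alpha> *v N s w) \<bullet> (P' s *v (\<beta> *v N s w)))"
  have L1F: "L1_process M a b F1" "L1_process M a b F2" "L1_process M a b F3" "L1_process M a b F4"
    unfolding F1_def F2_def F3_def F4_def by (intro L1_process_add L1 L2 Pc P')+
  have E1: "(\<integral>w. D b w \<bullet> (P b *v E b w) \<partial>M) = u \<bullet> (P a *v v) + ?J F1"
  proof -
    have "(\<integral>w. D b w \<bullet> (P b *v E b w) \<partial>M) = (\<integral>w. u \<bullet> (P a *v v) + integral {a..b} (\<lambda>s. F1 s w) \<partial>M)"
    proof (rule integral_cong_AE)
      show "(\<lambda>w. D b w \<bullet> (P b *v E b w)) \<in> borel_measurable M"
        using L1_process_integrable[OF L1[OF L2(5) L2(6) Pc] b] by auto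
      show "(\<lambda>w. u \<bullet> (P a *v v) + integral {a..b} (\<lambda>s. F1 s w)) \<in> borel_measurable M"
        using L1_process_fubini(1)[OF L1F(1) ab sigma_finite_measure_axioms]
        by (intro borel_measurable_add) auto
      show "AE w in M. D b w \<bullet> (P b *v E b w) = u \<bullet> (P a *v v) + integral {a..b} (\<lambda>s. F1 s w)"
        using Deq Eeq AE_space
      proof eventually_elim
        case (elim w)
        show ?case unfolding F1_def
          by (rule inner_product_path[OF ab path[OF nonant(1) elim(3)] path[OF nonant(2) elim(3)]
                bspec[OF elim(1)] bspec[OF elim(2)] P])
      qed
    qed
    also have "\<dots> = u \<bullet> (P a *v v) + ?J F1"
      using L1_process_fubini(1)[OF L1F(1) ab sigma_finite_measure_axioms]
      by (subst Bochner_Integration.integral_add) (auto simp: prob_space)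
    finally show ?thesis .
  qed
  have E2: "(\<integral>w. D b w \<bullet> (P b *v (\<beta> *v N b w)) \<partial>M) = ?J F2"
  proof -
    let ?R = "\<lambda>s. transpose \<beta> ** transpose (P s)" and ?R' = "\<lambda>s. transpose \<beta> ** transpose (P' s)"
    have dR: "(?R has_vector_derivative ?R' s) (at s within {a..b})" if "s \<in> {a..b}" for s
      by (intro bounded_linear.has_vector_derivative[OF
            bounded_bilinear.bounded_linear_right[OF bounded_bilinear_matrix_mult]]
          bounded_linear.has_vector_derivative[OF bounded_linear_transpose] P that)
    have "continuous_on {a..b} ?R'" by (intro c_intros)
    note noise_times_matrix_drift[OF nonant(1) nonant'(1) Deq dR this]
    then show ?thesis
      by (simp add: F2_def inner_add_right inner_commute[of "N _ _"] dot_lmul_matrix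
          matrix_vector_mul_assoc[symmetric])
  qed
  have E3: "(\<integral>w. (\<alpha> *v N b w) \<bullet> (P b *v E b w) \<partial>M) = ?J F3"
  proof -
    let ?R = "\<lambda>s. transpose \<alpha> ** P s" and ?R' = "\<lambda>s. transpose \<alpha> ** P' s"
    have dR: "(?R has_vector_derivative ?R' s) (at s within {a..b})" if "s \<in> {a..b}" for s
      by (intro bounded_linear.has_vector_derivative[OF
            bounded_bilinear.bounded_linear_right[OF bounded_bilinear_matrix_mult]] P that)
    have "continuous_on {a..b} ?R'" by (intro c_intros)
    note noise_times_matrix_drift[OF nonant(2) nonant'(2) Eeq dR this]
    then show ?thesis
      by (simp add: F3_def inner_add_right inner_commute[of "N _ _"] dot_lmul_matrix
          matrix_vector_mul_assoc[symmetric] inner_commute[of _ "_ *v N _ _"])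
  qed
  have quad: "(\<alpha> *v n) \<bullet> (R *v (\<beta> *v n)) = n \<bullet> ((transpose \<alpha> ** R ** \<beta>) *v n)" for n R
    by (simp add: matrix_vector_mul_assoc[symmetric] inner_commute[of n] dot_lmul_matrix inner_commute[of _ "\<alpha> *v n"])
  let ?\<tau> = "\<lambda>R. trace (transpose \<alpha> ** R ** \<beta>)"
  have E4: "(\<integral>w. (\<alpha> *v N b w) \<bullet> (P b *v (\<beta> *v N b w)) \<partial>M)
      = ?J F4 + integral {a..b} (\<lambda>s. ?\<tau> (P s))"
  proof -
    have d\<tau>: "((\<lambda>s. ?\<tau> (P s)) has_vector_derivative ?\<tau> (P' s)) (at s within {a..b})" if "s \<in> {a..b}" for s
      by (intro bounded_linear.has_vector_derivative[OF bounded_linear_trace]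
          bounded_linear.has_vector_derivative[OF
            bounded_bilinear.bounded_linear_left[OF bounded_bilinear_matrix_mult]]
          bounded_linear.has_vector_derivative[OF
            bounded_bilinear.bounded_linear_right[OF bounded_bilinear_matrix_mult]] P that)
    have "((\<lambda>s. (s - a) * ?\<tau> (P' s) + ?\<tau> (P s)) has_integral
        (b - a) * ?\<tau> (P b) - (a - a) * ?\<tau> (P a)) {a..b}"
    proof (intro fundamental_theorem_of_calculus ab)
      fix s assume s: "s \<in> {a..b}"
      have "((\<lambda>s. (s - a) * ?\<tau> (P s)) has_real_derivative (s - a) * ?\<tau> (P' s) + ?\<tau> (P s)) (at s within {a..b})"
        using d\<tau>[OF s] by (auto intro!: derivative_eq_intros simp: has_real_derivative_iff_has_vector_derivative[symmetric])
      then show "((\<lambda>s. (s - a) * ?\<tau> (P s)) has_vector_derivative (s - a) * ?\<tau> (P' s) + ?\<tau> (P s)) (at s within {a..b})"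
        by (simp add: has_real_derivative_iff_has_vector_derivative)
    qed
    moreover have "?J F4 = integral {a..b} (\<lambda>s. (s - a) * ?\<tau> (P' s))"
      unfolding L1_process_fubini(3)[OF L1F(4) ab sigma_finite_measure_axioms]
      by (intro Henstock_Kurzweil_Integration.integral_cong) (simp add: F4_def quad noise_quadratic)
    moreover have "integral {a..b} (\<lambda>s. (s - a) * ?\<tau> (P' s) + ?\<tau> (P s))
        = integral {a..b} (\<lambda>s. (s - a) * ?\<tau> (P' s)) + integral {a..b} (\<lambda>s. ?\<tau> (P s))"
      by (intro Henstock_Kurzweil_Integration.integral_add integrable_continuous_real c_intros)
    ultimately show ?thesis
      by (simp add: quad noise_quadratic[OF b] has_integral_iff)
  qed
  have "(\<integral>w. U b w \<bullet> (P b *v V b w) \<partial>M)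
      = (\<integral>w. D b w \<bullet> (P b *v E b w) + D b w \<bullet> (P b *v (\<beta> *v N b w))
          + (\<alpha> *v N b w) \<bullet> (P b *v E b w) + (\<alpha> *v N b w) \<bullet> (P b *v (\<beta> *v N b w)) \<partial>M)"
    by (simp add: UD VE inner_add_left inner_add_right matrix_vector_right_distrib algebra_simps)
  also have "\<dots> = u \<bullet> (P a *v v) + (?J F1 + ?J F2 + ?J F3 + ?J F4) + integral {a..b} (\<lambda>s. ?\<tau> (P s))"
  proof -
    have "integrable M (\<lambda>w. D b w \<bullet> (P b *v E b w))"
      "integrable M (\<lambda>w. D b w \<bullet> (P b *v (\<beta> *v N b w)))"
      "integrable M (\<lambda>w. (\<alpha> *v N b w) \<bullet> (P b *v E b w))"
      "integrable M (\<lambda>w. (\<alpha> *v N b w) \<bullet> (P b *v (\<beta> *v N b w)))"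
      by (rule L1_process_integrable[OF L1[OF _ _ Pc] b]; rule L2)+
    then show ?thesis by (simp add: E1 E2 E3 E4)
  qed
  also have "?J F1 + ?J F2 + ?J F3 + ?J F4 = ?J (\<lambda>s w. F1 s w + F2 s w + F3 s w + F4 s w)"
    by (simp add: path_mean_add L1F L1_process_add ab sigma_finite_measure_axioms)
  also have "(\<lambda>s w. F1 s w + F2 s w + F3 s w + F4 s w) = (\<lambda>s w. f s w \<bullet> (P s *v V s w)
      + U s w \<bullet> (P' s *v V s w) + U s w \<bullet> (P s *v h s w))"
    by (simp add: fun_eq_iff F1_def F2_def F3_def F4_def UD VE inner_add_left inner_add_right
        matrix_vector_right_distrib algebra_simps)
  finally show ?thesis by simp
qed

end

section \<open>Brownian motion and random linear equations\<close>

lemma (in prob_space) indep_vars_expectation_mult: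
  fixes X :: "'i \<Rightarrow> 'a \<Rightarrow> real"
  assumes ind: "indep_vars (\<lambda>_. borel) X I" and pq: "p \<in> I" "q \<in> I" "p \<noteq> q"
    and int: "integrable M (X p)" "integrable M (X q)"
  shows "integrable M (\<lambda>w. X p w * X q w)"
    and "(\<integral>w. X p w * X q w \<partial>M) = (\<integral>w. X p w \<partial>M) * (\<integral>w. X q w \<partial>M)"
proof -
  have ind': "indep_vars (\<lambda>_. borel) X {p, q}"
    using indep_vars_subset[OF ind, of "{p, q}"] pq by simp
  have i: "integrable M (X r)" if "r \<in> {p, q}" for r using that int by auto
  show "integrable M (\<lambda>w. X p w * X q w)"
    using indep_vars_integrable[OF _ ind' i] pq(3) by simp
  show "(\<integral>w. X p w * X q w \<partial>M) = (\<integral>w. X p w \<partial>M) * (\<integral>w. X q w \<partial>M)"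
    using indep_vars_lebesgue_integral[OF _ ind' i] pq(3) by simp
qed

text \<open>
  The increments from time \<open>t\<close> form a standard noise. For \<open>s \<le> u\<close> the covariance
  follows by writing the increment up to \<open>u\<close> as the one up to \<open>s\<close> plus an
  independent one.
\<close>

theorem brownian_standard_noise:
  fixes W :: "real \<Rightarrow> 'o \<Rightarrow> real^'w"
  assumes W: "std_brownian_motion M T W" and t: "0 \<le> t" "t \<le> T"
  shows "\<exists>N. standard_noise M t T N \<and> (AE w in M. \<forall>s\<in>{t..T}. N s w = W s w - W t w)"
proof -
  interpret prob_space M using W by (simp add: std_brownian_motion_def)
  have Wm: "W s \<in> borel_measurable M" if "s \<in> {t..T}" for s
    using W t that by (auto simp: std_brownian_motion_def)
  have dist: "distributed M lborel (\<lambda>w. (W u w - W s w) $ k) (normal_density 0 (sqrt (u - s)))"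
    if "t \<le> s" "s < u" "u \<le> T" for s u k
    using W t that by (auto simp: std_brownian_motion_def)
  have ind: "indep_vars (\<lambda>_. borel) (\<lambda>(j, k) w. (W (\<tau> (Suc j)) w - W (\<tau> j) w) $ k) ({..<n} \<times> UNIV)"
    if "\<And>j. j \<le> n \<Longrightarrow> \<tau> j \<in> {0..T}" "\<And>j. j < n \<Longrightarrow> \<tau> j < \<tau> (Suc j)" for n \<tau>
    using W that by (auto simp: std_brownian_motion_def)
  define \<Delta> where "\<Delta> = (\<lambda>s u k w. (W u w - W s w) $ k)"
  have sq: "integrable M (\<lambda>w. (\<Delta> s u k w)^2)" "(\<integral>w. (\<Delta> s u k w)^2 \<partial>M) = u - s"
      "(\<integral>w. \<Delta> s u k w \<partial>M) = 0"
    if su: "t \<le> s" "s \<le> u" "u \<le> T" for s u k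
  proof -
    have "integrable M (\<lambda>w. (\<Delta> s u k w)^2) \<and> (\<integral>w. (\<Delta> s u k w)^2 \<partial>M) = u - s \<and> (\<integral>w. \<Delta> s u k w \<partial>M) = 0"
    proof (cases "s = u")
      case False
      then have pos: "0 < sqrt (u - s)" and su': "s < u" using su by auto
      note d = dist[OF su(1) su' su(3), of k]
      have e: "(\<integral>w. \<Delta> s u k w \<partial>M) = 0"
        using normal_distributed_expectation[OF pos d] by (simp add: \<Delta>_def)
      have "(\<integral>w. (\<Delta> s u k w)^2 \<partial>M) = (sqrt (u - s))^2"
        using normal_distributed_variance[OF pos d] e by (simp add: \<Delta>_def)
      moreover have "integrable M (\<lambda>w. (\<Delta> s u k w)^2)"
        unfolding \<Delta>_def
      proof (rule iffD1[OF distributed_integrable[OF d]])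
        show "integrable lborel (\<lambda>x. normal_density 0 (sqrt (u - s)) x * x^2)"
          using integrable_normal_moment[OF pos, of 0 2] by (simp only: diff_0_right)
      qed auto
      ultimately show ?thesis using e su' by simp
    qed (simp add: \<Delta>_def)
    then show "integrable M (\<lambda>w. (\<Delta> s u k w)^2)" "(\<integral>w. (\<Delta> s u k w)^2 \<partial>M) = u - s"
      "(\<integral>w. \<Delta> s u k w \<partial>M) = 0" by auto
  qed
  have \<Delta>m: "\<Delta> s u k \<in> borel_measurable M" if "s \<in> {t..T}" "u \<in> {t..T}" for s u k
    unfolding \<Delta>_def using Wm that
    by (intro measurable_compose[OF borel_measurable_diff, of "W u" M "W s" "\<lambda>v. v $ k"]) auto
  have \<Delta>int: "integrable M (\<Delta> s u k)" if "t \<le> s" "s \<le> u" "u \<le> T" for s u k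
    using that by (intro square_integrable_imp_integrable[OF \<Delta>m sq(1)]) auto
  \<comment> \<open>Distinct coordinates of one increment, and successive increments, are uncorrelated.\<close>
  have coord: "(\<integral>w. \<Delta> t s k w * \<Delta> t s l w \<partial>M) = (if k = l then s - t else 0)"
      "integrable M (\<lambda>w. \<Delta> t s k w * \<Delta> t s l w)"
    if s: "t \<le> s" "s \<le> T" for s k l
  proof -
    have "integrable M (\<lambda>w. \<Delta> t s k w * \<Delta> t s l w) \<and>
        (\<integral>w. \<Delta> t s k w * \<Delta> t s l w \<partial>M) = (if k = l then s - t else 0)"
    proof (cases "k = l \<or> s = t")
      case True
      then show ?thesis
        using sq(1,2)[of t s k] s t by (auto simp: \<Delta>_def power2_eq_square)
    next
      case False
      \<comment> \<open>A single step from \<open>t\<close> to \<open>s\<close>; independence is across the coordinates.\<close>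
      let ?\<tau> = "\<lambda>j::nat. if j = 0 then t else s"
      have i: "indep_vars (\<lambda>_. borel) (\<lambda>(j, k). \<Delta> (?\<tau> j) (?\<tau> (Suc j)) k) ({..<1} \<times> UNIV)"
        unfolding \<Delta>_def by (rule ind) (use s t False in auto)
      show ?thesis
        using indep_vars_expectation_mult[OF i, of "(0, k)" "(0, l)"] False s t
          \<Delta>int[of t s k] \<Delta>int[of t s l] sq(3)[of t s k] by simp
    qed
    then show "(\<integral>w. \<Delta> t s k w * \<Delta> t s l w \<partial>M) = (if k = l then s - t else 0)"
      "integrable M (\<lambda>w. \<Delta> t s k w * \<Delta> t s l w)" by auto
  qed
  have later: "(\<integral>w. \<Delta> t s k w * \<Delta> s u l w \<partial>M) = 0" "integrable M (\<lambda>w. \<Delta> t s k w * \<Delta> s u l w)"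
    if s: "t \<le> s" "s \<le> u" "u \<le> T" for s u k l
  proof -
    have "integrable M (\<lambda>w. \<Delta> t s k w * \<Delta> s u l w) \<and> (\<integral>w. \<Delta> t s k w * \<Delta> s u l w \<partial>M) = 0"
    proof (cases "t = s \<or> s = u")
      case False
      let ?\<tau> = "\<lambda>j::nat. if j = 0 then t else if j = 1 then s else u"
      have i: "indep_vars (\<lambda>_. borel) (\<lambda>(j, k). \<Delta> (?\<tau> j) (?\<tau> (Suc j)) k) ({..<2} \<times> UNIV)"
        unfolding \<Delta>_def by (rule ind) (use s t False in auto)
      show ?thesis
        using indep_vars_expectation_mult[OF i, of "(0, k)" "(1, l)"] False s t
          \<Delta>int[of t s k] \<Delta>int[of s u l] sq(3)[of t s k] by simp
    qed (auto simp: \<Delta>_def)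
    then show "(\<integral>w. \<Delta> t s k w * \<Delta> s u l w \<partial>M) = 0" "integrable M (\<lambda>w. \<Delta> t s k w * \<Delta> s u l w)"
      by auto
  qed
  have cov: "(\<integral>w. \<Delta> t s k w * \<Delta> t u l w \<partial>M) = (if k = l then s - t else 0)"
    if s: "t \<le> s" "s \<le> u" "u \<le> T" for s u k l
  proof -
    have "\<Delta> t s k w * \<Delta> t u l w = \<Delta> t s k w * \<Delta> t s l w + \<Delta> t s k w * \<Delta> s u l w" for w
      by (simp add: \<Delta>_def algebra_simps)
    then show ?thesis using coord[of s k l] later[of s u k l] s by simp
  qed
  have "AE w in M. continuous_on {0..T} (\<lambda>s. W s w)"
    using W by (simp add: std_brownian_motion_def)
  then obtain Z where Z: "{w\<in>space M. \<not> continuous_on {0..T} (\<lambda>s. W s w)} \<subseteq> Z"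
      "emeasure M Z = 0" "Z \<in> sets M" by (rule AE_E)
  have AEZ: "AE w in M. w \<in> space M - Z"
    using AE_not_in[of Z M] Z(2,3) AE_space[of M] by (auto simp: null_sets_def elim!: eventually_elim2)
  \<comment> \<open>Resetting the paths to 0 on the null set of discontinuity makes every path continuous.\<close>
  define N where "N = (\<lambda>s w. indicat_real (space M - Z) w *\<^sub>R (W s w - W t w))"
  have N\<Delta>: "AE w in M. \<forall>s. N s w = W s w - W t w"
    using AEZ by eventually_elim (simp add: N_def)
  have Nm: "N s \<in> borel_measurable M" if "s \<in> {t..T}" for s
    unfolding N_def using that t Z(3) by (intro borel_measurable_scaleR borel_measurable_diff Wm) auto
  have Nkm: "(\<lambda>w. N s w $ k) \<in> borel_measurable M" if "s \<in> {t..T}" for s k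
    by (rule measurable_compose[OF Nm[OF that]]) auto
  have "standard_noise M t T N"
  proof
    show "t \<le> T" by fact
    have "continuous_on {t..T} (\<lambda>s. N s w)" if "w \<in> space M" for w
    proof (cases "w \<in> Z")
      case False
      then have "continuous_on {0..T} (\<lambda>s. W s w)" using Z(1) that by auto
      then have "continuous_on {t..T} (\<lambda>s. W s w)" by (rule continuous_on_subset) (use t in auto)
      then show ?thesis using False that by (auto simp: N_def intro!: continuous_intros)
    qed (simp add: N_def)
    then show "path_process M t T N" using Nm by (simp add: path_process_def)
    fix s k assume s: "s \<in> {t..T}"
    have st: "t \<le> t" "t \<le> s" "s \<le> T" using s by auto
    have "integrable M (\<lambda>w. (N s w $ k)^2) \<longleftrightarrow> integrable M (\<lambda>w. (\<Delta> t s k w)^2)"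
      using N\<Delta> s t by (intro integrable_cong_AE borel_measurable_power Nkm \<Delta>m)
        (auto elim!: eventually_mono simp: \<Delta>_def)
    then show "integrable M (\<lambda>w. (N s w $ k)^2)" using sq(1)[OF st] by simp
    have "(\<integral>w. N s w $ k \<partial>M) = (\<integral>w. \<Delta> t s k w \<partial>M)"
      using N\<Delta> s t by (intro integral_cong_AE Nkm \<Delta>m) (auto elim!: eventually_mono simp: \<Delta>_def)
    then show "(\<integral>w. N s w $ k \<partial>M) = 0" using sq(3)[OF st] by simp
  next
    fix s u k l assume su: "t \<le> s" "s \<le> u" "u \<le> T"
    have "(\<integral>w. N s w $ k * N u w $ l \<partial>M) = (\<integral>w. \<Delta> t s k w * \<Delta> t u l w \<partial>M)"
      using N\<Delta> su by (intro integral_cong_AE borel_measurable_times Nkm \<Delta>m)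
        (auto elim!: eventually_mono simp: \<Delta>_def)
    then show "(\<integral>w. N s w $ k * N u w $ l \<partial>M) = (if k = l then s - t else 0)"
      using cov[OF su] by simp
  qed
  moreover have "AE w in M. \<forall>s\<in>{t..T}. N s w = W s w - W t w"
    using N\<Delta> by eventually_elim simp
  ultimately show ?thesis by blast
qed

text \<open>
  The pathwise solutions, chosen separately for each path, are measurable as limits of Picard
  iterates.
\<close>

theorem linear_ode_process_exists:
  fixes A :: "real \<Rightarrow> real^'n^'n"
  assumes A: "continuous_on {a..b} A" and f: "path_process M a b f" and M: "sigma_finite_measure M"
  shows "\<exists>Y. path_process M a b Y \<and>
    (\<forall>w\<in>space M. \<forall>s\<in>{a..b}. Y s w = y0 + integral {a..s} (\<lambda>r. A r *v Y r w + f r w))"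
proof -
  obtain L where L: "0 \<le> L" "\<And>s v. s \<in> {a..b} \<Longrightarrow> norm (A s *v v) \<le> L * norm v"
    using matrix_vector_path_bound[OF A] by blast
  define p where "p = (\<lambda>n s w. picard_iterate (\<lambda>r y. A r *v y + f r w) y0 a n s)"
  have "\<exists>y. continuous_on {a..b} y \<and>
      (\<forall>s\<in>{a..b}. y s = y0 + integral {a..s} (\<lambda>r. A r *v y r + f r w)) \<and>
      (\<forall>s\<in>{a..b}. (\<lambda>n. p n s w) \<longlonglongrightarrow> y s)" if w: "w \<in> space M" for w
    unfolding p_def
  proof (rule picard_lindelof[where L = L])
    show "continuous_on {a..b} (\<lambda>s. A s *v y s + f s w)" if "continuous_on {a..b} y" for y
      using f w by (intro continuous_intros A that) (simp add: path_process_def)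
    fix s and y z :: "real^'n" assume s: "s \<in> {a..b}"
    show "norm (A s *v y + f s w - (A s *v z + f s w)) \<le> L * norm (y - z)"
      using L(2)[OF s, of "y - z"] by (simp add: matrix_vector_mult_diff_distrib)
  qed
  then have "\<forall>w\<in>space M. \<exists>y. continuous_on {a..b} y \<and>
      (\<forall>s\<in>{a..b}. y s = y0 + integral {a..s} (\<lambda>r. A r *v y r + f r w)) \<and>
      (\<forall>s\<in>{a..b}. (\<lambda>n. p n s w) \<longlonglongrightarrow> y s)" by blast
  from bchoice[OF this] obtain y where y: "\<And>w. w \<in> space M \<Longrightarrow> continuous_on {a..b} (y w)"
      "\<And>w s. w \<in> space M \<Longrightarrow> s \<in> {a..b} \<Longrightarrow> y w s = y0 + integral {a..s} (\<lambda>r. A r *v y w r + f r w)"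
      "\<And>w s. w \<in> space M \<Longrightarrow> s \<in> {a..b} \<Longrightarrow> (\<lambda>n. p n s w) \<longlonglongrightarrow> y w s"
    by blast
  have pm: "path_process M a b (p n)" for n
  proof (induction n)
    case 0
    show ?case by (simp add: p_def path_process_const)
  next
    case (Suc n)
    have "path_process M a b (\<lambda>s w. y0 + integral {a..s} (\<lambda>r. A r *v p n r w + f r w))"
      by (intro path_process_add[OF path_process_const path_process_indefinite_integral[OF
              path_process_add[OF path_process_matrix_vector[OF A Suc] f] M]]) simp
    then show ?case by (simp add: p_def)
  qed
  have "path_process M a b (\<lambda>s w. y w s)"
    unfolding path_process_def
  proof (intro conjI ballI y(1))
    fix s assume s: "s \<in> {a..b}"
    show "(\<lambda>w. y w s) \<in> borel_measurable M"
    proof (rule borel_measurable_LIMSEQ_metric)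
      show "p n s \<in> borel_measurable M" for n using pm[of n] s by (simp add: path_process_def)
      show "(\<lambda>n. p n s w) \<longlonglongrightarrow> y w s" if "w \<in> space M" for w using y(3)[OF that s] .
    qed
  qed
  then show ?thesis using y(2) by (intro exI[of _ "\<lambda>s w. y w s"]) blast
qed

section \<open>Sensitivities of a quadratic cost\<close>

lemma L1_process_diff:
  fixes F G :: "real \<Rightarrow> 'o \<Rightarrow> 'b::euclidean_space"
  assumes F: "L1_process M a b F" and G: "L1_process M a b G"
  shows "L1_process M a b (\<lambda>s w. F s w - G s w)"
  using L1_process_add[OF F L1_process_scaleR[OF G, of "- 1"]] by simp

lemma trace_zero [simp]: "trace (0 :: real^'n^'n) = 0"
  by (simp add: trace_def)

lemma inner_vector_matrix: "x \<bullet> (y v* A) = (A *v x) \<bullet> (y :: real^'m)"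
  by (metis dot_lmul_matrix inner_commute)

lemma sym_mat_inner: "sym_mat P \<Longrightarrow> x \<bullet> (P *v y) = y \<bullet> (P *v x)"
  unfolding sym_mat_def by (metis dot_lmul_matrix inner_commute transpose_matrix_vector)

text \<open>
  The derivative of \<open>K \<mapsto> transpose K ** R ** K\<close> at \<open>K\<close> in direction
  \<open>L\<close>.
\<close>

definition cross :: "real^'a^'a \<Rightarrow> real^'n^'a \<Rightarrow> real^'n^'a \<Rightarrow> real^'n^'n" where
  "cross R K L = transpose K ** R ** L + transpose L ** R ** K"

lemmas quadratic_expand =
  lyap_op_def cross_def matrix_vector_mult_add_rdistrib matrix_vector_right_distrib
  inner_add_left inner_add_right matrix_vector_mul_assoc[symmetric] inner_vector_matrix

lemma first_order_identity:
  fixes K K' :: "real^'n^'a"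
  assumes "sym_mat R" "sym_mat \<Psi>"
  shows "2 * (X \<bullet> (Q *v Y) + (K *v X) \<bullet> (R *v (K *v Y) + R *v (K' *v X))
      + (X \<bullet> (\<Psi> *v (S *v X)) - X \<bullet> ((Q + transpose K ** R ** K) *v Y)))
    = X \<bullet> ((lyap_op S \<Psi> + cross R K K') *v X)"
  using sym_mat_inner[OF assms(1), of "K *v X" "K' *v X"] sym_mat_inner[OF assms(2), of X "S *v X"]
  by (simp add: quadratic_expand)

text \<open>
  The cancellation behind the second derivative. The first two lines are the integrands of the
  second derivative; each further line is the integrand left by the Lyapunov product rule for one
  of the pairs \<open>(Y', Y)\<close> and \<open>(X, Z)\<close> with \<open>\<Psi>\<close>,
  \<open>(X, Y')\<close> with \<open>\<Theta>\<close> and \<open>(X, Y)\<close> with \<open>\<Theta>'\<close>.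
  What remains is half the quadratic form of the inhomogeneity of the equation for
  \<open>\<Lambda>\<close>.
\<close>

lemma second_order_identity:
  fixes K K' K'' :: "real^'n^'a"
  assumes R: "sym_mat R" and \<Psi>: "sym_mat \<Psi>" and \<Theta>: "sym_mat \<Theta>" "sym_mat \<Theta>'"
  shows "2 * ((Y' \<bullet> (Q *v Y) + (K *v Y' + K'' *v X) \<bullet> (R *v (K *v Y + K' *v X)))
      + (X \<bullet> (Q *v Z) + (K *v X) \<bullet> (R *v (K *v Z + K'' *v Y + K' *v Y')))
      + ((S' *v X) \<bullet> (\<Psi> *v Y) + Y' \<bullet> (\<Psi> *v (S *v X)) - Y' \<bullet> ((Q + transpose K ** R ** K) *v Y))
      + (X \<bullet> (\<Psi> *v (S' *v Y + S *v Y')) - X \<bullet> ((Q + transpose K ** R ** K) *v Z))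
      + (X \<bullet> (\<Theta> *v (S' *v X)) - X \<bullet> ((lyap_op S \<Psi> + cross R K K') *v Y'))
      + (X \<bullet> (\<Theta>' *v (S *v X)) - X \<bullet> ((lyap_op S' \<Psi> + cross R K K'') *v Y)))
    = X \<bullet> ((lyap_op S' \<Theta> + lyap_op S \<Theta>' + cross R K'' K') *v X)"
  using sym_mat_inner[OF R, of "K *v Y'" "K' *v X"] sym_mat_inner[OF R, of "K'' *v X" "K' *v X"]
    sym_mat_inner[OF \<Psi>, of Y' "S *v X"]
    sym_mat_inner[OF \<Theta>(1), of X "S' *v X"] sym_mat_inner[OF \<Theta>(2), of X "S *v X"]
  by (simp add: quadratic_expand)

context standard_noise
begin

text \<open>
  Subtracting the noise term leaves a linear equation without noise whose forcing is
  nonanticipating.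
\<close>

lemma noisy_path_linear_ode:
  fixes A :: "real \<Rightarrow> real^'n^'n"
  assumes A: "continuous_on {a..b} A" and f: "nonanticipating f" and U: "path_process M a b U"
    and eq: "AE w in M. \<forall>s\<in>{a..b}.
      U s w = u + integral {a..s} (\<lambda>r. A r *v U r w + f r w) + \<alpha> *v N s w"
  shows "noisy_path \<alpha> u (\<lambda>s w. A s *v U s w + f s w) U"
proof -
  define D where "D = (\<lambda>s w. U s w + (- \<alpha>) *v N s w)"
  have UD: "U = (\<lambda>s w. D s w + \<alpha> *v N s w)"
    by (simp add: fun_eq_iff D_def bounded_bilinear.minus_left[OF bounded_bilinear_matrix_vector_mult])
  have "nonanticipating D"
  proof (rule nonanticipating_linear_ode[OF A])
    show "nonanticipating (\<lambda>s w. A s *v (\<alpha> *v N s w) + f s w)"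
      by (intro nonanticipating_add nonanticipating_matrix_vector A f nonanticipating_noise continuous_intros)
    show "path_process M a b D"
      unfolding D_def by (intro path_process_add U path_process_matrix_vector N_path continuous_intros)
    show "AE w in M. \<forall>s\<in>{a..b}. D s w = u + integral {a..s} (\<lambda>r. A r *v D r w + (A r *v (\<alpha> *v N r w) + f r w))"
      using eq by eventually_elim (simp add: UD matrix_vector_right_distrib add.assoc)
  qed
  then have "nonanticipating U"
    unfolding UD by (intro nonanticipating_add nonanticipating_matrix_vector nonanticipating_noise continuous_intros)
  then show ?thesis
    using eq unfolding noisy_path_def
    by (intro conjI nonanticipating_add nonanticipating_matrix_vector A f)
qed

text \<open>
  The terms containing \<open>A\<close> cancel, because the linear part of the Lyapunov equation is the
  adjoint of the common linear drift of the two paths.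
\<close>

theorem lyapunov_product_rule:
  fixes A F P :: "real \<Rightarrow> real^'n^'n"
  assumes U: "noisy_path \<alpha> u (\<lambda>s w. A s *v U s w + f s w) U"
    and V: "noisy_path \<beta> v (\<lambda>s w. A s *v V s w + h s w) V"
    and P: "lyapunov b A F P" and a: "0 \<le> a"
    and A: "continuous_on {a..b} A" and F: "continuous_on {a..b} F"
  shows "(\<integral>w. U b w \<bullet> (P b *v V b w) \<partial>M) = u \<bullet> (P a *v v) +
    (\<integral>w. integral {a..b} (\<lambda>s. f s w \<bullet> (P s *v V s w) + U s w \<bullet> (P s *v h s w)
        - U s w \<bullet> (F s *v V s w)) \<partial>M)
    + integral {a..b} (\<lambda>s. trace (transpose \<alpha> ** P s ** \<beta>))"
proof -
  have Pc: "continuous_on {a..b} P"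
    by (rule continuous_on_subset[OF lyapunov_continuous[OF P]]) (use a in auto)
  have dP: "(P has_vector_derivative - (lyap_op (A s) (P s) + F s)) (at s within {a..b})"
    if "s \<in> {a..b}" for s
    using P a that unfolding lyapunov_def
    by (intro has_vector_derivative_within_subset[of P _ s "{0..b}" "{a..b}"]) auto
  have "continuous_on {a..b} (\<lambda>s. - (lyap_op (A s) (P s) + F s))"
    by (intro continuous_intros A Pc F)
  note expected_product_rule[OF U V dP this]
  moreover have "(A s *v U s w + f s w) \<bullet> (P s *v V s w)
        + U s w \<bullet> (- (lyap_op (A s) (P s) + F s) *v V s w) + U s w \<bullet> (P s *v (A s *v V s w + h s w))
      = f s w \<bullet> (P s *v V s w) + U s w \<bullet> (P s *v h s w) - U s w \<bullet> (F s *v V s w)" for s w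
    by (simp add: quadratic_expand bounded_bilinear.minus_left[OF bounded_bilinear_matrix_vector_mult]
        matrix_vector_mult_diff_rdistrib inner_diff_right)
  ultimately show ?thesis by simp
qed

lemma noisy_path_L2: "noisy_path \<alpha> u f U \<Longrightarrow> L2_process M a b U"
  by (simp add: noisy_path_def nonanticipating_L2)

abbreviation path_mean :: "(real \<Rightarrow> 'o \<Rightarrow> real) \<Rightarrow> real" where
  "path_mean F \<equiv> \<integral>w. integral {a..b} (\<lambda>s. F s w) \<partial>M"

lemma path_mean_sum: "L1_process M a b F \<Longrightarrow> L1_process M a b G \<Longrightarrow>
    path_mean (\<lambda>s w. F s w + G s w) = path_mean F + path_mean G"
  by (rule path_mean_add[OF _ _ ab sigma_finite_measure_axioms])

lemma path_mean_twice: "path_mean (\<lambda>s w. 2 * F s w) = 2 * path_mean F"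
  by simp

lemma path_mean_uminus: "path_mean (\<lambda>s w. - F s w) = - path_mean F"
  by simp

lemma expectation_path_plus_terminal:
  assumes "L1_process M a b F" "integrable M f"
  shows "(\<integral>w. integral {a..b} (\<lambda>s. F s w) + f w \<partial>M) = path_mean F + (\<integral>w. f w \<partial>M)"
  by (intro Bochner_Integration.integral_add L1_process_fubini(1) assms ab sigma_finite_measure_axioms)

lemma terminal_integrable:
  fixes G :: "real^'n^'m"
  assumes "L2_process M a b U" "L2_process M a b V"
  shows "integrable M (\<lambda>w. U b w \<bullet> (G *v V b w))"
  using ab by (intro L1_process_integrable[OF L1_process_inner[OF assms(1)
      L2_process_matrix_vector[OF continuous_on_const assms(2)]]]) auto

theorem expected_quadratic_cost:
  fixes A F P :: "real \<Rightarrow> real^'n^'n"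
  assumes X: "noisy_path \<sigma> x (\<lambda>s w. A s *v X s w) X"
    and P: "lyapunov b A F P" and a: "0 \<le> a"
    and A: "continuous_on {a..b} A" and F: "continuous_on {a..b} F"
  shows "path_mean (\<lambda>s w. X s w \<bullet> (F s *v X s w)) + (\<integral>w. X b w \<bullet> (P b *v X b w) \<partial>M)
    = x \<bullet> (P a *v x) + integral {a..b} (\<lambda>s. trace (transpose \<sigma> ** P s ** \<sigma>))"
  using lyapunov_product_rule[of \<sigma> x A X "\<lambda>_ _. 0" \<sigma> x X "\<lambda>_ _. 0" F P] X P a A F
  by (simp add: path_mean_uminus)

text \<open>
  The terminal cost is \<open>X b \<bullet> (\<Psi> b *v Y b)\<close>, so the product rule for
  \<open>\<Psi>\<close> turns it into running terms. Together with the running cost these form half of the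
  quadratic cost with weight equal to the inhomogeneity of the equation for \<open>\<Theta>\<close>.
\<close>

theorem first_sensitivity:
  fixes A Q S \<Psi> \<Theta> :: "real \<Rightarrow> real^'n^'n" and K K' :: "real \<Rightarrow> real^'n^'k"
  assumes X: "noisy_path \<sigma> x (\<lambda>s w. A s *v X s w) X"
    and Y: "noisy_path 0 0 (\<lambda>s w. A s *v Y s w + S s *v X s w) Y"
    and cont: "continuous_on {a..b} A" "continuous_on {a..b} Q" "continuous_on {a..b} S"
      "continuous_on {a..b} R" "continuous_on {a..b} K" "continuous_on {a..b} K'"
    and a: "0 \<le> a" and sym: "\<And>s. s \<in> {a..b} \<Longrightarrow> sym_mat (R s)" "\<And>s. s \<in> {a..b} \<Longrightarrow> sym_mat (\<Psi> s)"
    and \<Psi>: "lyapunov b A (\<lambda>s. Q s + transpose (K s) ** R s ** K s) \<Psi>" "\<Psi> b = G"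
    and \<Theta>: "lyapunov b A (\<lambda>s. lyap_op (S s) (\<Psi> s) + cross (R s) (K s) (K' s)) \<Theta>" "\<Theta> b = 0"
  shows "(\<integral>w. integral {a..b} (\<lambda>s. X s w \<bullet> (Q s *v Y s w)
        + (K s *v X s w) \<bullet> (R s *v (K s *v Y s w) + R s *v (K' s *v X s w)))
      + X b w \<bullet> (G *v Y b w) \<partial>M)
    = 1/2 * (x \<bullet> (\<Theta> a *v x) + integral {a..b} (\<lambda>s. trace (transpose \<sigma> ** \<Theta> s ** \<sigma>)))"
proof -
  have \<Psi>c: "continuous_on {a..b} \<Psi>"
    by (rule continuous_on_subset[OF lyapunov_continuous[OF \<Psi>(1)]]) (use a in auto)
  note c = cont \<Psi>c
  note L2 = noisy_path_L2[OF X] noisy_path_L2[OF Y]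
  note L1_intros = L1_process_add L1_process_diff L1_process_inner L2_process_add L2_process_matrix_vector L2
  define H where "H = (\<lambda>s w. X s w \<bullet> (Q s *v Y s w)
        + (K s *v X s w) \<bullet> (R s *v (K s *v Y s w) + R s *v (K' s *v X s w)))"
  define I where "I = (\<lambda>s w. X s w \<bullet> (\<Psi> s *v (S s *v X s w))
        - X s w \<bullet> ((Q s + transpose (K s) ** R s ** K s) *v Y s w))"
  have L1: "L1_process M a b H" "L1_process M a b I"
    unfolding H_def I_def by (intro L1_intros continuous_intros c)+
  have "(\<integral>w. X b w \<bullet> (G *v Y b w) \<partial>M) = path_mean I"
  proof -
    have cF: "continuous_on {a..b} (\<lambda>s. Q s + transpose (K s) ** R s ** K s)"
      by (intro continuous_intros c)
    show ?thesis
      using lyapunov_product_rule[of \<sigma> x A X "\<lambda>_ _. 0" 0 0 Y "\<lambda>s w. S s *v X s w", OF _ Y \<Psi>(1) a cont(1) cF] X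
      by (simp add: I_def \<Psi>(2))
  qed
  then have "(\<integral>w. integral {a..b} (\<lambda>s. H s w) + X b w \<bullet> (G *v Y b w) \<partial>M) = path_mean H + path_mean I"
    by (simp add: expectation_path_plus_terminal[OF L1(1) terminal_integrable[OF L2]])
  also have "\<dots> = path_mean (\<lambda>s w. H s w + I s w)" by (simp add: path_mean_sum L1)
  also have "\<dots> = 1/2 * path_mean (\<lambda>s w. 2 * (H s w + I s w))" unfolding path_mean_twice by simp
  also have "path_mean (\<lambda>s w. 2 * (H s w + I s w))
      = path_mean (\<lambda>s w. X s w \<bullet> ((lyap_op (S s) (\<Psi> s) + cross (R s) (K s) (K' s)) *v X s w))"
    unfolding H_def I_def
    by (intro Bochner_Integration.integral_cong Henstock_Kurzweil_Integration.integral_cong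
        first_order_identity sym refl)
  also have "\<dots> = x \<bullet> (\<Theta> a *v x) + integral {a..b} (\<lambda>s. trace (transpose \<sigma> ** \<Theta> s ** \<sigma>))"
  proof -
    have "continuous_on {a..b} (\<lambda>s. lyap_op (S s) (\<Psi> s) + cross (R s) (K s) (K' s))"
      unfolding cross_def by (intro continuous_intros c)
    from expected_quadratic_cost[OF X \<Theta>(1) a cont(1) this] show ?thesis by (simp add: \<Theta>(2))
  qed
  finally show ?thesis by (simp add: H_def)
qed

text \<open>
  The two terminal terms are expanded with \<open>\<Psi>\<close>. The product rules for \<open>\<Theta>\<close> and
  \<open>\<Theta>'\<close> have vanishing boundary terms, since a sensitivity starts at 0 and
  \<open>\<Theta>\<close> ends at 0; they supply the mixed terms that the pointwise identity needs.
\<close>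

theorem second_sensitivity:
  fixes A Q S S' \<Psi> \<Theta> \<Theta>' \<Lambda> :: "real \<Rightarrow> real^'n^'n" and K K' K'' :: "real \<Rightarrow> real^'n^'k"
  assumes X: "noisy_path \<sigma> x (\<lambda>s w. A s *v X s w) X"
    and Y: "noisy_path 0 0 (\<lambda>s w. A s *v Y s w + S s *v X s w) Y"
    and Y': "noisy_path 0 0 (\<lambda>s w. A s *v Y' s w + S' s *v X s w) Y'"
    and Z: "noisy_path 0 0 (\<lambda>s w. A s *v Z s w + (S' s *v Y s w + S s *v Y' s w)) Z"
    and cont: "continuous_on {a..b} A" "continuous_on {a..b} Q" "continuous_on {a..b} S"
      "continuous_on {a..b} S'" "continuous_on {a..b} R" "continuous_on {a..b} K"
      "continuous_on {a..b} K'" "continuous_on {a..b} K''"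
    and a: "0 \<le> a" and sym: "\<And>s. s \<in> {a..b} \<Longrightarrow> sym_mat (R s)" "\<And>s. s \<in> {a..b} \<Longrightarrow> sym_mat (\<Psi> s)"
      "\<And>s. s \<in> {a..b} \<Longrightarrow> sym_mat (\<Theta> s)" "\<And>s. s \<in> {a..b} \<Longrightarrow> sym_mat (\<Theta>' s)"
    and \<Psi>: "lyapunov b A (\<lambda>s. Q s + transpose (K s) ** R s ** K s) \<Psi>" "\<Psi> b = G"
    and \<Theta>: "lyapunov b A (\<lambda>s. lyap_op (S s) (\<Psi> s) + cross (R s) (K s) (K' s)) \<Theta>" "\<Theta> b = 0"
    and \<Theta>': "lyapunov b A (\<lambda>s. lyap_op (S' s) (\<Psi> s) + cross (R s) (K s) (K'' s)) \<Theta>'" "\<Theta>' b = 0"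
    and \<Lambda>: "lyapunov b A (\<lambda>s. lyap_op (S' s) (\<Theta> s) + lyap_op (S s) (\<Theta>' s) + cross (R s) (K'' s) (K' s)) \<Lambda>"
      "\<Lambda> b = 0"
  shows "path_mean (\<lambda>s w. Y' s w \<bullet> (Q s *v Y s w)
        + (K s *v Y' s w + K'' s *v X s w) \<bullet> (R s *v (K s *v Y s w + K' s *v X s w)))
      + path_mean (\<lambda>s w. X s w \<bullet> (Q s *v Z s w)
        + (K s *v X s w) \<bullet> (R s *v (K s *v Z s w + K'' s *v Y s w + K' s *v Y' s w)))
      + (\<integral>w. Y' b w \<bullet> (G *v Y b w) + X b w \<bullet> (G *v Z b w) \<partial>M)
    = 1/2 * (x \<bullet> (\<Lambda> a *v x) + integral {a..b} (\<lambda>s. trace (transpose \<sigma> ** \<Lambda> s ** \<sigma>)))"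
proof -
  have cs: "continuous_on {a..b} \<Psi>" "continuous_on {a..b} \<Theta>" "continuous_on {a..b} \<Theta>'"
    using a lyapunov_continuous[OF \<Psi>(1)] lyapunov_continuous[OF \<Theta>(1)] lyapunov_continuous[OF \<Theta>'(1)]
    by (auto elim!: continuous_on_subset)
  note c = cont cs
  note L2 = noisy_path_L2[OF X] noisy_path_L2[OF Y] noisy_path_L2[OF Y'] noisy_path_L2[OF Z]
  note L1_intros = L1_process_add L1_process_diff L1_process_inner L2_process_add L2_process_matrix_vector L2
  let ?F\<Psi> = "\<lambda>s. Q s + transpose (K s) ** R s ** K s"
  let ?F\<Theta> = "\<lambda>s. lyap_op (S s) (\<Psi> s) + cross (R s) (K s) (K' s)"
  let ?F\<Theta>' = "\<lambda>s. lyap_op (S' s) (\<Psi> s) + cross (R s) (K s) (K'' s)"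
  let ?F\<Lambda> = "\<lambda>s. lyap_op (S' s) (\<Theta> s) + lyap_op (S s) (\<Theta>' s) + cross (R s) (K'' s) (K' s)"
  have cF: "continuous_on {a..b} ?F\<Psi>" "continuous_on {a..b} ?F\<Theta>" "continuous_on {a..b} ?F\<Theta>'"
      "continuous_on {a..b} ?F\<Lambda>"
    unfolding cross_def by (intro continuous_intros c)+
  define H1 where "H1 = (\<lambda>s w. Y' s w \<bullet> (Q s *v Y s w)
        + (K s *v Y' s w + K'' s *v X s w) \<bullet> (R s *v (K s *v Y s w + K' s *v X s w)))"
  define H2 where "H2 = (\<lambda>s w. X s w \<bullet> (Q s *v Z s w)
        + (K s *v X s w) \<bullet> (R s *v (K s *v Z s w + K'' s *v Y s w + K' s *v Y' s w)))"
  define I1 where "I1 = (\<lambda>s w. (S' s *v X s w) \<bullet> (\<Psi> s *v Y s w) + Y' s w \<bullet> (\<Psi> s *v (S s *v X s w))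
      - Y' s w \<bullet> (?F\<Psi> s *v Y s w))"
  define I2 where "I2 = (\<lambda>s w. X s w \<bullet> (\<Psi> s *v (S' s *v Y s w + S s *v Y' s w)) - X s w \<bullet> (?F\<Psi> s *v Z s w))"
  define I3 where "I3 = (\<lambda>s w. X s w \<bullet> (\<Theta> s *v (S' s *v X s w)) - X s w \<bullet> (?F\<Theta> s *v Y' s w))"
  define I4 where "I4 = (\<lambda>s w. X s w \<bullet> (\<Theta>' s *v (S s *v X s w)) - X s w \<bullet> (?F\<Theta>' s *v Y s w))"
  have L1: "L1_process M a b H1" "L1_process M a b H2" "L1_process M a b I1" "L1_process M a b I2"
      "L1_process M a b I3" "L1_process M a b I4"
    unfolding H1_def H2_def I1_def I2_def I3_def I4_def by (intro L1_intros c cF)+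
  have X0: "noisy_path \<sigma> x (\<lambda>s w. A s *v X s w + (\<lambda>_ _. 0) s w) X" using X by simp
  note rule = lyapunov_product_rule[OF _ _ _ a cont(1)]
  have E1: "(\<integral>w. Y' b w \<bullet> (G *v Y b w) \<partial>M) = path_mean I1"
    using rule[OF Y' Y \<Psi>(1) cF(1)] by (simp add: I1_def \<Psi>(2))
  have E2: "(\<integral>w. X b w \<bullet> (G *v Z b w) \<partial>M) = path_mean I2"
    using rule[OF X0 Z \<Psi>(1) cF(1)] by (simp add: I2_def \<Psi>(2))
  have E3: "0 = path_mean I3"
    using rule[OF X0 Y' \<Theta>(1) cF(2)] by (simp add: I3_def \<Theta>(2))
  have E4: "0 = path_mean I4"
    using rule[OF X0 Y \<Theta>'(1) cF(3)] by (simp add: I4_def \<Theta>'(2))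
  have "path_mean H1 + path_mean H2 + (\<integral>w. Y' b w \<bullet> (G *v Y b w) + X b w \<bullet> (G *v Z b w) \<partial>M)
      = path_mean H1 + path_mean H2 + path_mean I1 + path_mean I2 + path_mean I3 + path_mean I4"
    using E1 E2 E3 E4 terminal_integrable[OF L2(3,2)] terminal_integrable[OF L2(1,4)] by simp
  also have "\<dots> = path_mean (\<lambda>s w. H1 s w + H2 s w + I1 s w + I2 s w + I3 s w + I4 s w)"
    by (simp add: path_mean_sum L1 L1_process_add)
  also have "\<dots> = 1/2 * path_mean (\<lambda>s w. 2 * (H1 s w + H2 s w + I1 s w + I2 s w + I3 s w + I4 s w))"
    unfolding path_mean_twice by simp
  also have "path_mean (\<lambda>s w. 2 * (H1 s w + H2 s w + I1 s w + I2 s w + I3 s w + I4 s w))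
      = path_mean (\<lambda>s w. X s w \<bullet> (?F\<Lambda> s *v X s w))"
    unfolding H1_def H2_def I1_def I2_def I3_def I4_def
    by (intro Bochner_Integration.integral_cong Henstock_Kurzweil_Integration.integral_cong
        second_order_identity sym refl)
  also have "\<dots> = x \<bullet> (\<Lambda> a *v x) + integral {a..b} (\<lambda>s. trace (transpose \<sigma> ** \<Lambda> s ** \<sigma>))"
    using expected_quadratic_cost[OF X \<Lambda>(1) a cont(1) cF(4)] by (simp add: \<Lambda>(2))
  finally show ?thesis by (simp add: H1_def H2_def)
qed

end

section \<open>The value and its derivatives as functionals of Lyapunov solutions\<close>

lemma col_block_eq: "col_block own h M = M ** emb own h"
  by (simp add: vec_eq_iff col_block_def emb_def matrix_matrix_mult_def if_distrib if_distribR
      sum.delta' cong: if_cong)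

lemma transpose_emb: "transpose (emb own h) = emb own h"
  by (auto simp: vec_eq_iff emb_def transpose_def)

lemma emb_mult_nth: "(emb own h ** (M :: real^'m^'a)) $ r = (if own r = h then M $ r else 0)"
proof -
  have "(if r = k \<and> own k = h then 1 else 0) * M $ k $ i
      = (if k = r then (if own r = h then M $ r $ i else 0) else 0)" for k i by auto
  then show ?thesis by (simp add: vec_eq_iff emb_def matrix_matrix_mult_def)
qed

lemma block_eq: "block own h l M = emb own h ** M ** emb own l"
  by (simp add: vec_eq_iff col_block_eq[symmetric] col_block_def block_def emb_mult_nth)

lemma policy_row: "K \<in> policies g h \<Longrightarrow> owner g a \<noteq> h \<Longrightarrow> K t $ a = 0"
  by (cases "t \<in> {0..horizon g}") (auto simp: policies_def)

lemma emb_policy: "K \<in> policies g h \<Longrightarrow> emb (owner g) h ** K t = K t"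
  by (auto simp: vec_eq_iff emb_mult_nth policy_row)

lemma policy_emb:
  "K \<in> policies g h \<Longrightarrow> transpose (K t) ** emb (owner g) h = transpose (K t)"
  using emb_policy[of K g h t] by (metis matrix_transpose_mul transpose_emb)

lemma col_block_policy: "K \<in> policies g h \<Longrightarrow> col_block (owner g) h M ** K t = M ** K t"
  by (simp add: col_block_eq matrix_mul_assoc[symmetric] emb_policy)

lemma policies_add_scaled:
  "K \<in> policies g h \<Longrightarrow> L \<in> policies g h \<Longrightarrow> (\<lambda>s. K s + r *\<^sub>R L s) \<in> policies g h"
  by (auto simp: policies_def intro!: continuous_intros)

lemma policies_diff:
  "K \<in> policies g h \<Longrightarrow> L \<in> policies g h \<Longrightarrow> (\<lambda>s. K s - L s) \<in> policies g h"
  by (auto simp: policies_def intro!: continuous_intros)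

lemma zero_policy: "(\<lambda>s. 0) \<in> policies g h"
  by (auto simp: policies_def)

lemma profiles_update: "\<phi> \<in> profiles g \<Longrightarrow> K \<in> policies g h \<Longrightarrow> \<phi>(h := K) \<in> profiles g"
  by (auto simp: profiles_def)

lemma profiles_policy: "\<phi> \<in> profiles g \<Longrightarrow> \<phi> h \<in> policies g h"
  by (simp add: profiles_def)

lemma policies_continuous: "K \<in> policies g h \<Longrightarrow> continuous_on {0..horizon g} K"
  by (simp add: policies_def)

text \<open>
  Policies of different players have disjoint rows, so stacking is addition and a perturbation of
  one policy perturbs the stacked feedback additively.
\<close>

lemma stack_eq_sum:
  assumes "\<phi> \<in> profiles g"
  shows "stack g \<phi> t = (\<Sum>i\<in>UNIV. \<phi> i t)"
proof (subst vec_eq_iff, intro allI)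
  fix a
  have "\<phi> i t $ a = (if i = owner g a then \<phi> i t $ a else 0)" for i
    using policy_row[OF profiles_policy[OF assms], of a i] by auto
  then have "(\<Sum>i\<in>UNIV. \<phi> i t $ a) = (\<Sum>i\<in>UNIV. if i = owner g a then \<phi> i t $ a else 0)"
    by (rule sum.cong[OF refl])
  then show "stack g \<phi> t $ a = (\<Sum>i\<in>UNIV. \<phi> i t) $ a" by (simp add: stack_def)
qed

lemma closed_loop_mult_vec:
  "closed_loop g \<phi> r *v v = cA g r *v v + cB g r *v (stack g \<phi> r *v v)"
  by (simp add: closed_loop_def matrix_vector_mult_add_rdistrib matrix_vector_mul_assoc)

lemma cont_process_eq_path_process: "cont_process M {a..b} U \<longleftrightarrow> path_process M a b U"
  by (simp add: cont_process_def path_process_def)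

lemma lyapunov_iff:
  "lyapunov T M F P \<longleftrightarrow> continuous_on {0..T} P \<and>
    (\<forall>t\<in>{0..T}. \<exists>P'. (P has_vector_derivative P') (at t within {0..T}) \<and>
      P' + (lyap_op (M t) (P t) + F t) = 0)"
proof -
  have "(\<exists>P'. (P has_vector_derivative P') (at t within {0..T}) \<and> P' + R = 0) \<longleftrightarrow>
      (P has_vector_derivative - R) (at t within {0..T})" for t R
    by (auto simp: eq_neg_iff_add_eq_0[symmetric])
  then show ?thesis using lyapunov_continuous[of T M F P] by (auto simp: lyapunov_def)
qed

text \<open>
  A scalar terminal value problem whose right-hand side does not depend on the solution is an
  integration; this identifies the additive constants of the derivatives.
\<close>

lemma terminal_value_integral:
  assumes f: "continuous_on {0..T} f" and t: "t \<in> {0..T}"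
  shows "(SOME p. continuous_on {0..T} p \<and>
     (\<forall>t\<in>{0..T}. \<exists>p'. (p has_real_derivative p') (at t within {0..T}) \<and> p' + f t = 0) \<and>
     p T = 0) t = integral {t..T} f"
    (is "(SOME p. ?P p) t = _")
proof -
  define p0 where "p0 = (\<lambda>t. integral {0..T} f - integral {0..t} f)"
  have d0: "(p0 has_real_derivative - f s) (at s within {0..T})" if "s \<in> {0..T}" for s
    using integral_has_vector_derivative[OF f that] unfolding p0_def
    by (auto intro!: derivative_eq_intros simp: has_real_derivative_iff_has_vector_derivative[symmetric])
  have "continuous_on {0..T} p0"
    using d0 by (meson DERIV_continuous continuous_on_eq_continuous_within)
  moreover have "\<forall>t\<in>{0..T}. \<exists>p'. (p0 has_real_derivative p') (at t within {0..T}) \<and> p' + f t = 0"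
    using d0 by (intro ballI exI[of _ "- f _"]) auto
  ultimately have "?P p0" by (simp add: p0_def)
  then have P: "?P (SOME p. ?P p)" by (rule someI[of ?P])
  define p where "p = (SOME p. ?P p)"
  have d: "(p has_real_derivative - f s) (at s within {0..T})" if s: "s \<in> {0..T}" for s
  proof -
    obtain p' where "(p has_real_derivative p') (at s within {0..T})" "p' + f s = 0"
      using bspec[OF conjunct1[OF conjunct2[OF P]] s] unfolding p_def[symmetric] by auto
    moreover from this have "p' = - f s" by linarith
    ultimately show ?thesis by simp
  qed
  have "(f has_integral (- p T) - (- p t)) {t..T}"
  proof (rule fundamental_theorem_of_calculus)
    show "t \<le> T" using t by simp
    fix s assume s: "s \<in> {t..T}"
    then have "((\<lambda>s. - p s) has_real_derivative f s) (at s within {0..T})"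
      using t by (auto intro!: derivative_eq_intros d)
    then show "((\<lambda>s. - p s) has_vector_derivative f s) (at s within {t..T})"
      using t unfolding has_real_derivative_iff_has_vector_derivative
      by (rule_tac has_vector_derivative_within_subset) auto
  qed
  moreover have "p T = 0" unfolding p_def by (rule conjunct2[OF conjunct2[OF P]])
  ultimately show ?thesis by (simp add: has_integral_iff p_def)
qed

lemma lyapunov_SOME:
  fixes M F :: "real \<Rightarrow> real^'n^'n"
  assumes "continuous_on {0..T} M" "continuous_on {0..T} F"
    and "\<And>t. t \<in> {0..T} \<Longrightarrow> sym_mat (F t)" "sym_mat G"
  defines "P0 \<equiv> SOME P. lyapunov T M F P \<and> (\<forall>t\<in>{0..T}. sym_mat (P t)) \<and> P T = G"
  shows "lyapunov T M F P0 \<and> (\<forall>t\<in>{0..T}. sym_mat (P0 t)) \<and> P0 T = G"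
  unfolding P0_def
  by (rule someI_ex[where P = "\<lambda>P. lyapunov T M F P \<and> (\<forall>t\<in>{0..T}. sym_mat (P t)) \<and> P T = G"])
    (rule lyapunov_exists[OF assms(1-4)])

text \<open>
  The common form of value, first and second derivative as a linear functional of a path of
  symmetric matrices. Its continuity for uniform convergence carries difference quotients of
  matrices over to difference quotients of values.
\<close>

definition quad_functional :: "real^'w^'n \<Rightarrow> real \<Rightarrow> real \<Rightarrow> real^'n \<Rightarrow> (real \<Rightarrow> real^'n^'n) \<Rightarrow> real" where
  "quad_functional \<sigma> T t x P =
     1/2 * (x \<bullet> (P t *v x) + integral {t..T} (\<lambda>s. trace (transpose \<sigma> ** P s ** \<sigma>)))"

lemma trace_sandwich: "trace (\<sigma> ** transpose \<sigma> ** P) = trace (transpose \<sigma> ** P ** (\<sigma> :: real^'w^'n))"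
  by (metis matrix_mul_assoc trace_mul_sym)

lemma sym_mat_lyap_op: "sym_mat P \<Longrightarrow> sym_mat (lyap_op S P)"
  by (simp add: sym_mat_def transpose_lyap_op)

lemma sym_mat_add: "sym_mat P \<Longrightarrow> sym_mat Q \<Longrightarrow> sym_mat (P + Q)"
  by (simp add: sym_mat_def transpose_simps)

lemma sym_mat_cross: "sym_mat R \<Longrightarrow> sym_mat (cross R K L)"
  by (simp add: sym_mat_def cross_def transpose_simps matrix_mul_assoc add.commute)

lemma sym_mat_congruence: "sym_mat R \<Longrightarrow> sym_mat (transpose K ** R ** K)"
  by (simp add: sym_mat_def transpose_simps matrix_mul_assoc)

lemma cross_commute: "cross R K L = cross R L K"
  by (simp add: cross_def add.commute)

lemma col_block_forcing: 
  assumes "K' \<in> policies g h" "sym_mat R"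
  shows "transpose K ** col_block (owner g) h R ** K' t
      + transpose (K' t) ** transpose (col_block (owner g) h R) ** K = cross R K (K' t)"
proof -
  have "transpose (K' t) ** transpose (col_block (owner g) h R) = transpose (K' t) ** R"
    using assms(2) unfolding matrix_transpose_mul[symmetric] col_block_policy[OF assms(1)]
    by (simp add: matrix_transpose_mul sym_mat_def)
  then show ?thesis
    by (simp add: cross_def matrix_mul_assoc[symmetric] col_block_policy[OF assms(1)])
qed

lemma block_forcing:
  assumes K': "K' \<in> policies g h" and K'': "K'' \<in> policies g l" and R: "sym_mat R"
  shows "transpose (K'' t) ** block (owner g) l h R ** K' t
      + transpose (K' t) ** transpose (block (owner g) l h R) ** K'' t = cross R (K'' t) (K' t)"
proof -
  have "transpose (K'' t) ** block (owner g) l h R ** K' t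
      = (transpose (K'' t) ** emb (owner g) l) ** R ** (emb (owner g) h ** K' t)"
    by (simp add: block_eq matrix_mul_assoc)
  then have 1: "transpose (K'' t) ** block (owner g) l h R ** K' t = transpose (K'' t) ** R ** K' t"
    by (simp add: policy_emb[OF K''] emb_policy[OF K'])
  have "transpose (K' t) ** transpose (block (owner g) l h R) ** K'' t
      = transpose (transpose (K'' t) ** block (owner g) l h R ** K' t)"
    by (simp add: matrix_transpose_mul matrix_mul_assoc)
  also have "\<dots> = transpose (K' t) ** R ** K'' t"
    unfolding 1 using R by (simp add: matrix_transpose_mul matrix_mul_assoc sym_mat_def)
  finally show ?thesis using 1 by (simp add: cross_def)
qed

locale lq =
  fixes g :: "('x::finite, 'a::finite, 'w::finite, 'p::finite, 'o) lq_data"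
  assumes game: "lq_game g"
begin

abbreviation "T \<equiv> horizon g"
abbreviation "AA \<phi> \<equiv> closed_loop g \<phi>"
abbreviation "KK \<phi> \<equiv> stack g \<phi>"
abbreviation "BK K s \<equiv> cB g s ** K s"

lemma data_continuous:
  "continuous_on {0..T} (cA g)" "continuous_on {0..T} (cB g)"
  "continuous_on {0..T} (cQ g i)" "continuous_on {0..T} (cR g i)"
  using game by (auto simp: lq_game_def)

lemma data_symmetric:
  "s \<in> {0..T} \<Longrightarrow> sym_mat (cQ g i s)" "s \<in> {0..T} \<Longrightarrow> sym_mat (cR g i s)" "sym_mat (cG g i)"
  using game by (auto simp: lq_game_def)

lemma stack_continuous:
  assumes "\<phi> \<in> profiles g" shows "continuous_on {0..T} (KK \<phi>)"
proof -
  have "KK \<phi> = (\<lambda>t. \<Sum>i\<in>UNIV. \<phi> i t)" using stack_eq_sum[OF assms] by (simp add: fun_eq_iff)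
  then show ?thesis
    by (simp add: continuous_on_sum policies_continuous[OF profiles_policy[OF assms]])
qed

lemma closed_loop_continuous: "\<phi> \<in> profiles g \<Longrightarrow> continuous_on {0..T} (AA \<phi>)"
  unfolding closed_loop_def[abs_def] by (intro continuous_intros data_continuous stack_continuous)

lemmas cont_intros = continuous_intros data_continuous stack_continuous closed_loop_continuous

lemma BK_continuous: "K \<in> policies g h \<Longrightarrow> continuous_on {0..T} (\<lambda>s. BK K s)"
  by (intro cont_intros policies_continuous)

definition Psi_source where
  "Psi_source i \<phi> s = cQ g i s + transpose (KK \<phi> s) ** cR g i s ** KK \<phi> s"

definition Theta_source where
  "Theta_source i \<phi> K' s = lyap_op (BK K' s) (ode_Psi g i \<phi> s) + cross (cR g i s) (KK \<phi> s) (K' s)"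

definition Lambda_source where
  "Lambda_source i \<phi> h K' l K'' s = lyap_op (BK K'' s) (ode_Theta g i \<phi> h K' s)
     + lyap_op (BK K' s) (ode_Theta g i \<phi> l K'' s) + cross (cR g i s) (K'' s) (K' s)"

lemma Psi_solution:
  assumes \<phi>: "\<phi> \<in> profiles g"
  shows "lyapunov T (AA \<phi>) (Psi_source i \<phi>) (ode_Psi g i \<phi>) \<and>
    (\<forall>t\<in>{0..T}. sym_mat (ode_Psi g i \<phi> t)) \<and> ode_Psi g i \<phi> T = cG g i"
proof -
  have eq: "ode_Psi g i \<phi> = (SOME P. lyapunov T (AA \<phi>) (Psi_source i \<phi>) P \<and>
      (\<forall>t\<in>{0..T}. sym_mat (P t)) \<and> P T = cG g i)"
    unfolding ode_Psi_def lyapunov_iff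
    by (rule arg_cong[where f = Eps]) (auto simp: fun_eq_iff Psi_source_def lyap_op_def add.assoc)
  show ?thesis unfolding eq
    by (rule lyapunov_SOME)
      (auto simp: Psi_source_def intro!: cont_intros \<phi> sym_mat_add sym_mat_congruence data_symmetric)
qed

lemma Theta_eq_SOME:
  assumes K': "K' \<in> policies g h"
  shows "ode_Theta g i \<phi> h K' = (SOME P. lyapunov T (AA \<phi>) (Theta_source i \<phi> K') P \<and>
      (\<forall>t\<in>{0..T}. sym_mat (P t)) \<and> P T = 0)"
proof -
  have *: "P' + transpose (AA \<phi> t) ** P t + P t ** AA \<phi> t
           + ode_Psi g i \<phi> t ** (cBl g h t ** K' t)
           + transpose (cBl g h t ** K' t) ** ode_Psi g i \<phi> t
           + transpose (KK \<phi> t) ** col_block (owner g) h (cR g i t) ** K' t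
           + transpose (K' t) ** transpose (col_block (owner g) h (cR g i t)) ** KK \<phi> t
      = P' + (lyap_op (AA \<phi> t) (P t) + Theta_source i \<phi> K' t)" if "t \<in> {0..T}" for P P' t
    unfolding Theta_source_def col_block_forcing[OF K' data_symmetric(2)[OF that], symmetric]
    by (simp add: lyap_op_def col_block_policy[OF K'] algebra_simps)
  show ?thesis
    unfolding ode_Theta_def lyapunov_iff
    by (rule arg_cong[where f = Eps]) (auto simp: fun_eq_iff *)
qed

lemma Theta_solution:
  assumes \<phi>: "\<phi> \<in> profiles g" and K': "K' \<in> policies g h"
  shows "lyapunov T (AA \<phi>) (Theta_source i \<phi> K') (ode_Theta g i \<phi> h K') \<and>
    (\<forall>t\<in>{0..T}. sym_mat (ode_Theta g i \<phi> h K' t)) \<and> ode_Theta g i \<phi> h K' T = 0"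
proof -
  have Psi: "continuous_on {0..T} (ode_Psi g i \<phi>)" "\<forall>t\<in>{0..T}. sym_mat (ode_Psi g i \<phi> t)"
    using Psi_solution[OF \<phi>] lyapunov_continuous by blast+
  show ?thesis unfolding Theta_eq_SOME[OF K']
  proof (rule lyapunov_SOME)
    show "continuous_on {0..T} (Theta_source i \<phi> K')"
      unfolding Theta_source_def cross_def by (intro cont_intros \<phi> policies_continuous[OF K'] Psi(1))
    show "sym_mat (Theta_source i \<phi> K' t)" if "t \<in> {0..T}" for t
      unfolding Theta_source_def using Psi(2) that
      by (intro sym_mat_add sym_mat_lyap_op sym_mat_cross data_symmetric) auto
    show "sym_mat 0" by (simp add: sym_mat_def transpose_def vec_eq_iff)
  qed (intro cont_intros \<phi>)
qed

lemma Lambda_eq_SOME: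
  assumes K': "K' \<in> policies g h" and K'': "K'' \<in> policies g l"
  shows "ode_Lambda g i \<phi> h K' l K'' = (SOME P. lyapunov T (AA \<phi>) (Lambda_source i \<phi> h K' l K'') P \<and>
      (\<forall>t\<in>{0..T}. sym_mat (P t)) \<and> P T = 0)"
proof -
  have *: "P' + transpose (AA \<phi> t) ** P t + P t ** AA \<phi> t
           + ode_Theta g i \<phi> h K' t ** (cBl g l t ** K'' t)
           + transpose (cBl g l t ** K'' t) ** ode_Theta g i \<phi> h K' t
           + ode_Theta g i \<phi> l K'' t ** (cBl g h t ** K' t)
           + transpose (cBl g h t ** K' t) ** ode_Theta g i \<phi> l K'' t
           + transpose (K'' t) ** block (owner g) l h (cR g i t) ** K' t
           + transpose (K' t) ** transpose (block (owner g) l h (cR g i t)) ** K'' t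
      = P' + (lyap_op (AA \<phi> t) (P t) + Lambda_source i \<phi> h K' l K'' t)" if "t \<in> {0..T}" for P P' t
    unfolding Lambda_source_def block_forcing[OF K' K'' data_symmetric(2)[OF that], symmetric]
    by (simp add: lyap_op_def col_block_policy[OF K'] col_block_policy[OF K''] algebra_simps)
  show ?thesis
    unfolding ode_Lambda_def lyapunov_iff
    by (rule arg_cong[where f = Eps]) (auto simp: fun_eq_iff *)
qed

lemma Lambda_solution:
  assumes \<phi>: "\<phi> \<in> profiles g" and K': "K' \<in> policies g h" and K'': "K'' \<in> policies g l"
  shows "lyapunov T (AA \<phi>) (Lambda_source i \<phi> h K' l K'') (ode_Lambda g i \<phi> h K' l K'') \<and>
    (\<forall>t\<in>{0..T}. sym_mat (ode_Lambda g i \<phi> h K' l K'' t)) \<and> ode_Lambda g i \<phi> h K' l K'' T = 0"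
proof -
  have c: "continuous_on {0..T} (ode_Theta g i \<phi> h K')" "continuous_on {0..T} (ode_Theta g i \<phi> l K'')"
    and sy: "\<forall>t\<in>{0..T}. sym_mat (ode_Theta g i \<phi> h K' t)" "\<forall>t\<in>{0..T}. sym_mat (ode_Theta g i \<phi> l K'' t)"
    using Theta_solution[OF \<phi> K'] Theta_solution[OF \<phi> K''] lyapunov_continuous by blast+
  show ?thesis unfolding Lambda_eq_SOME[OF K' K'']
  proof (rule lyapunov_SOME)
    show "continuous_on {0..T} (Lambda_source i \<phi> h K' l K'')"
      unfolding Lambda_source_def cross_def by (intro cont_intros \<phi> policies_continuous[OF K'] policies_continuous[OF K''] c)
    show "sym_mat (Lambda_source i \<phi> h K' l K'' t)" if "t \<in> {0..T}" for t
      unfolding Lambda_source_def using sy that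
      by (intro sym_mat_add sym_mat_lyap_op sym_mat_cross data_symmetric) auto
    show "sym_mat 0" by (simp add: sym_mat_def transpose_def vec_eq_iff)
  qed (intro cont_intros \<phi>)
qed

text \<open>
  The inhomogeneities for the two orders of the directions agree as functions, so both terms select
  the solution of the same problem, and the symmetry of second derivatives holds by definition.
\<close>

lemma Lambda_swap:
  assumes "K' \<in> policies g h" "K'' \<in> policies g l"
  shows "ode_Lambda g i \<phi> h K' l K'' = ode_Lambda g i \<phi> l K'' h K'"
proof -
  have "Lambda_source i \<phi> h K' l K'' = Lambda_source i \<phi> l K'' h K'"
    by (simp add: fun_eq_iff Lambda_source_def cross_commute add.commute)
  then show ?thesis by (simp add: Lambda_eq_SOME assms)
qed

lemma pde_deriv1_eq:
  assumes "\<phi> \<in> profiles g" "K' \<in> policies g h" "t \<in> {0..T}"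
  shows "pde_deriv1 g i \<phi> t x h K' = quad_functional (sig g) T t x (ode_Theta g i \<phi> h K')"
proof -
  have c: "continuous_on {0..T} (ode_Theta g i \<phi> h K')"
    using Theta_solution[OF assms(1,2)] lyapunov_continuous by blast
  have "ode_theta g i \<phi> h K' t
      = integral {t..T} (\<lambda>t. 1/2 * trace (sig g ** transpose (sig g) ** ode_Theta g i \<phi> h K' t))"
    unfolding ode_theta_def by (intro terminal_value_integral assms continuous_intros c)
  then show ?thesis
    by (simp add: pde_deriv1_def quad_functional_def trace_sandwich)
qed

lemma pde_deriv2_eq:
  assumes "\<phi> \<in> profiles g" "K' \<in> policies g h" "K'' \<in> policies g l" "t \<in> {0..T}"
  shows "pde_deriv2 g i \<phi> t x h K' l K'' = quad_functional (sig g) T t x (ode_Lambda g i \<phi> h K' l K'')"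
proof -
  have c: "continuous_on {0..T} (ode_Lambda g i \<phi> h K' l K'')"
    using Lambda_solution[OF assms(1-3)] lyapunov_continuous by blast
  have "ode_lambda g i \<phi> h K' l K'' t
      = integral {t..T} (\<lambda>t. 1/2 * trace (sig g ** transpose (sig g) ** ode_Lambda g i \<phi> h K' l K'' t))"
    unfolding ode_lambda_def by (intro terminal_value_integral assms continuous_intros c)
  then show ?thesis
    by (simp add: pde_deriv2_def quad_functional_def trace_sandwich)
qed

end

text \<open>
  The increments of the Brownian motion from time \<open>t\<close>, in a version whose paths are all
  continuous; the state equation sees them only almost surely.
\<close>

locale lq_noise = lq g + standard_noise "Om g" t "horizon g" N
  for g :: "('x::finite, 'a::finite, 'w::finite, 'p::finite, 'o) lq_data" and t and N :: "real \<Rightarrow> 'o \<Rightarrow> real^'w" +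
  assumes t_nonneg: "0 \<le> t"
    and N_eq: "AE w in Om g. \<forall>s\<in>{t..horizon g}. N s w = BM g s w - BM g t w"
begin

lemma sub: "{t..T} \<subseteq> {0..T}" using t_nonneg by auto

lemmas cont = continuous_on_subset[OF _ sub]

lemma state_noisy_path:
  assumes \<phi>: "\<phi> \<in> profiles g"
  shows "noisy_path (sig g) x (\<lambda>s w. AA \<phi> s *v state g \<phi> t x s w) (state g \<phi> t x)"
proof -
  let ?P = "\<lambda>X. cont_process (Om g) {t..T} X \<and> (AE w in Om g. \<forall>s\<in>{t..T}.
        X s w = x + integral {t..s} (\<lambda>r. cA g r *v X r w + cB g r *v (KK \<phi> r *v X r w))
              + sig g *v (BM g s w - BM g t w))"
  have A: "continuous_on {t..T} (AA \<phi>)" by (intro cont closed_loop_continuous \<phi>)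
  have "path_process (Om g) t T (\<lambda>s w. AA \<phi> s *v (sig g *v N s w))"
    by (intro path_process_matrix_vector A N_path continuous_intros)
  from linear_ode_process_exists[OF A this sigma_finite_measure_axioms, of x]
  obtain D where D: "path_process (Om g) t T D" "\<forall>w\<in>space (Om g). \<forall>s\<in>{t..T}.
      D s w = x + integral {t..s} (\<lambda>r. AA \<phi> r *v D r w + AA \<phi> r *v (sig g *v N r w))" by blast
  have "?P (\<lambda>s w. D s w + sig g *v N s w)"
  proof
    show "cont_process (Om g) {t..T} (\<lambda>s w. D s w + sig g *v N s w)"
      unfolding cont_process_eq_path_process
      by (intro path_process_add D path_process_matrix_vector N_path continuous_intros)
    show "AE w in Om g. \<forall>s\<in>{t..T}. D s w + sig g *v N s w = x + integral {t..s}
          (\<lambda>r. cA g r *v (D r w + sig g *v N r w) + cB g r *v (KK \<phi> r *v (D r w + sig g *v N r w)))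
        + sig g *v (BM g s w - BM g t w)"
      using N_eq AE_space
    proof eventually_elim
      case (elim w)
      show ?case
      proof
        fix s assume s: "s \<in> {t..T}"
        show "D s w + sig g *v N s w = x + integral {t..s}
          (\<lambda>r. cA g r *v (D r w + sig g *v N r w) + cB g r *v (KK \<phi> r *v (D r w + sig g *v N r w)))
        + sig g *v (BM g s w - BM g t w)"
          using D(2)[rule_format, OF elim(2) s] elim(1)[rule_format, OF s]
          by (simp add: closed_loop_mult_vec matrix_vector_right_distrib add_ac)
      qed
    qed
  qed
  then have "?P (state g \<phi> t x)" unfolding state_def by (rule someI[of ?P])
  then have path: "path_process (Om g) t T (state g \<phi> t x)"
    and eq: "AE w in Om g. \<forall>s\<in>{t..T}. state g \<phi> t x s w = x
        + integral {t..s} (\<lambda>r. AA \<phi> r *v state g \<phi> t x r w) + sig g *v (BM g s w - BM g t w)"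
    by (simp_all add: cont_process_eq_path_process closed_loop_mult_vec)
  have "noisy_path (sig g) x (\<lambda>s w. AA \<phi> s *v state g \<phi> t x s w + (0 *v N s w)) (state g \<phi> t x)"
  proof (rule noisy_path_linear_ode[OF A _ path])
    show "nonanticipating (\<lambda>s w. 0 *v N s w)"
      by (intro nonanticipating_matrix_vector nonanticipating_noise continuous_intros)
    show "AE w in Om g. \<forall>s\<in>{t..T}. state g \<phi> t x s w = x
        + integral {t..s} (\<lambda>r. AA \<phi> r *v state g \<phi> t x r w + 0 *v N r w) + sig g *v N s w"
      using eq N_eq by eventually_elim simp
  qed
  then show ?thesis by simp
qed

lemma linear_sensitivity_exists:
  assumes \<phi>: "\<phi> \<in> profiles g" and f: "nonanticipating f"
  shows "\<exists>Y. cont_process (Om g) {t..T} Y \<and>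
    (AE w in Om g. \<forall>s\<in>{t..T}. Y s w = integral {t..s} (\<lambda>r. AA \<phi> r *v Y r w + f r w))"
proof -
  have A: "continuous_on {t..T} (AA \<phi>)" by (intro cont closed_loop_continuous \<phi>)
  have "path_process (Om g) t T f" using f by (simp add: nonanticipating_def L2_process_def)
  from linear_ode_process_exists[OF A this sigma_finite_measure_axioms, of 0]
  show ?thesis unfolding cont_process_eq_path_process by (auto intro!: AE_I2)
qed

lemma linear_sensitivity_noisy_path:
  assumes \<phi>: "\<phi> \<in> profiles g" and f: "nonanticipating f"
    and Y: "cont_process (Om g) {t..T} Y"
      "AE w in Om g. \<forall>s\<in>{t..T}. Y s w = integral {t..s} (\<lambda>r. AA \<phi> r *v Y r w + f r w)"
  shows "noisy_path 0 0 (\<lambda>s w. AA \<phi> s *v Y s w + f s w) Y"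
  using Y by (intro noisy_path_linear_ode cont closed_loop_continuous \<phi> f)
    (simp_all add: cont_process_eq_path_process)

lemma sens1_noisy_path:
  assumes \<phi>: "\<phi> \<in> profiles g" and K': "K' \<in> policies g h"
  shows "noisy_path 0 0 (\<lambda>s w. AA \<phi> s *v sens1 g \<phi> t x h K' s w + BK K' s *v state g \<phi> t x s w)
    (sens1 g \<phi> t x h K')"
proof -
  let ?f = "\<lambda>s w. BK K' s *v state g \<phi> t x s w"
  have f: "nonanticipating ?f"
    using state_noisy_path[OF \<phi>, of x]
    by (intro nonanticipating_matrix_vector cont BK_continuous[OF K']) (simp add: noisy_path_def)
  have eq: "sens1 g \<phi> t x h K' = (SOME Y. cont_process (Om g) {t..T} Y \<and> (AE w in Om g. \<forall>s\<in>{t..T}.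
      Y s w = integral {t..s} (\<lambda>r. AA \<phi> r *v Y r w + ?f r w)))"
    unfolding sens1_def by (simp add: matrix_vector_mul_assoc col_block_policy[OF K'])
  from someI_ex[OF linear_sensitivity_exists[OF \<phi> f], folded eq]
  show ?thesis by (intro linear_sensitivity_noisy_path \<phi> f) auto
qed

lemma sens2_noisy_path:
  assumes \<phi>: "\<phi> \<in> profiles g" and K': "K' \<in> policies g h" and K'': "K'' \<in> policies g l"
  shows "noisy_path 0 0 (\<lambda>s w. AA \<phi> s *v sens2 g \<phi> t x h K' l K'' s w
      + (BK K'' s *v sens1 g \<phi> t x h K' s w + BK K' s *v sens1 g \<phi> t x l K'' s w))
    (sens2 g \<phi> t x h K' l K'')"
proof -
  let ?f = "\<lambda>s w. BK K'' s *v sens1 g \<phi> t x h K' s w + BK K' s *v sens1 g \<phi> t x l K'' s w"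
  have f: "nonanticipating ?f"
    using sens1_noisy_path[OF \<phi> K', of x] sens1_noisy_path[OF \<phi> K'', of x]
    by (intro nonanticipating_add nonanticipating_matrix_vector cont BK_continuous[OF K']
        BK_continuous[OF K'']) (simp_all add: noisy_path_def)
  have eq: "sens2 g \<phi> t x h K' l K'' = (SOME Y. cont_process (Om g) {t..T} Y \<and> (AE w in Om g. \<forall>s\<in>{t..T}.
      Y s w = integral {t..s} (\<lambda>r. AA \<phi> r *v Y r w + ?f r w)))"
    unfolding sens2_def
    by (simp add: matrix_vector_mul_assoc col_block_policy[OF K'] col_block_policy[OF K''] add.assoc)
  from someI_ex[OF linear_sensitivity_exists[OF \<phi> f], folded eq]
  show ?thesis by (intro linear_sensitivity_noisy_path \<phi> f) auto
qed

lemma Psi_facts: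
  assumes "\<phi> \<in> profiles g"
  shows "lyapunov T (AA \<phi>) (\<lambda>s. cQ g i s + transpose (KK \<phi> s) ** cR g i s ** KK \<phi> s) (ode_Psi g i \<phi>)"
    and "ode_Psi g i \<phi> T = cG g i" and "\<And>s. s \<in> {t..T} \<Longrightarrow> sym_mat (ode_Psi g i \<phi> s)"
  using Psi_solution[OF assms, of i] sub by (auto simp: Psi_source_def[abs_def])

lemma Theta_facts:
  assumes "\<phi> \<in> profiles g" and "L \<in> policies g k"
  shows "lyapunov T (AA \<phi>) (\<lambda>s. lyap_op (BK L s) (ode_Psi g i \<phi> s)
      + cross (cR g i s) (KK \<phi> s) (L s)) (ode_Theta g i \<phi> k L)"
    and "ode_Theta g i \<phi> k L T = 0" and "\<And>s. s \<in> {t..T} \<Longrightarrow> sym_mat (ode_Theta g i \<phi> k L s)"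
  using Theta_solution[OF assms, of i] sub by (auto simp: Theta_source_def[abs_def])

lemma R_symmetric: "s \<in> {t..T} \<Longrightarrow> sym_mat (cR g i s)"
  using sub by (auto intro: data_symmetric)

lemma value_fn_eq_functional:
  assumes \<phi>: "\<phi> \<in> profiles g"
  shows "value_fn g i \<phi> t x = quad_functional (sig g) T t x (ode_Psi g i \<phi>)"
proof -
  let ?X = "state g \<phi> t x"
  have Psi: "lyapunov T (AA \<phi>) (Psi_source i \<phi>) (ode_Psi g i \<phi>)" "ode_Psi g i \<phi> T = cG g i"
    using Psi_solution[OF \<phi>] by blast+
  have cF: "continuous_on {t..T} (Psi_source i \<phi>)"
    unfolding Psi_source_def by (intro cont cont_intros \<phi>)
  note X = state_noisy_path[OF \<phi>, of x]
  note L2 = noisy_path_L2[OF X]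
  have "L1_process (Om g) t T (\<lambda>s w. ?X s w \<bullet> (Psi_source i \<phi> s *v ?X s w))"
    by (intro L1_process_inner L2 L2_process_matrix_vector cF)
  note expectation_path_plus_terminal[OF this terminal_integrable[OF L2 L2, of "cG g i"]]
  also note expected_quadratic_cost[OF X Psi(1) t_nonneg cont[OF closed_loop_continuous[OF \<phi>]] cF, unfolded Psi(2)]
  finally show ?thesis
    by (simp add: value_fn_def Let_def quad_functional_def Psi_source_def
        quadratic_expand)
qed

lemma prob_deriv1_eq_functional:
  assumes \<phi>: "\<phi> \<in> profiles g" and K': "K' \<in> policies g h"
  shows "prob_deriv1 g i \<phi> t x h K' = quad_functional (sig g) T t x (ode_Theta g i \<phi> h K')"
proof -
  note c = closed_loop_continuous[OF \<phi>, THEN cont] data_continuous(3)[THEN cont]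
    BK_continuous[OF K', THEN cont] data_continuous(4)[THEN cont] stack_continuous[OF \<phi>, THEN cont]
    policies_continuous[OF K', THEN cont]
  show ?thesis
    unfolding prob_deriv1_def Let_def quad_functional_def matrix_vector_mul_assoc[of "col_block _ _ _"]
      col_block_policy[OF K'] matrix_vector_mul_assoc[of "cR g i _" "K' _", symmetric]
    by (rule first_sensitivity[OF state_noisy_path[OF \<phi>] sens1_noisy_path[OF \<phi> K'] c t_nonneg
          R_symmetric Psi_facts(3,1,2)[OF \<phi>] Theta_facts(1,2)[OF \<phi> K']])
qed

lemma prob_deriv2_eq_functional:
  assumes \<phi>: "\<phi> \<in> profiles g" and K': "K' \<in> policies g h" and K'': "K'' \<in> policies g l"
  shows "prob_deriv2 g i \<phi> t x h K' l K'' = quad_functional (sig g) T t x (ode_Lambda g i \<phi> h K' l K'')"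
proof -
  have La: "lyapunov T (AA \<phi>) (\<lambda>s. lyap_op (BK K'' s) (ode_Theta g i \<phi> h K' s)
        + lyap_op (BK K' s) (ode_Theta g i \<phi> l K'' s) + cross (cR g i s) (K'' s) (K' s))
        (ode_Lambda g i \<phi> h K' l K'')" "ode_Lambda g i \<phi> h K' l K'' T = 0"
    using Lambda_solution[OF \<phi> K' K'', of i] by (auto simp: Lambda_source_def[abs_def])
  note c = closed_loop_continuous[OF \<phi>, THEN cont] data_continuous(3)[THEN cont]
    BK_continuous[OF K', THEN cont] BK_continuous[OF K'', THEN cont] data_continuous(4)[THEN cont]
    stack_continuous[OF \<phi>, THEN cont] policies_continuous[OF K', THEN cont]
    policies_continuous[OF K'', THEN cont]
  show ?thesis
    unfolding prob_deriv2_def Let_def quad_functional_def matrix_vector_mul_assoc[of "emb _ _"]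
      emb_policy[OF K'] emb_policy[OF K'']
    by (rule second_sensitivity[OF state_noisy_path[OF \<phi>] sens1_noisy_path[OF \<phi> K']
          sens1_noisy_path[OF \<phi> K''] sens2_noisy_path[OF \<phi> K' K''] c t_nonneg R_symmetric
          Psi_facts(3)[OF \<phi>] Theta_facts(3)[OF \<phi> K'] Theta_facts(3)[OF \<phi> K'']
          Psi_facts(1,2)[OF \<phi>] Theta_facts(1,2)[OF \<phi> K'] Theta_facts(1,2)[OF \<phi> K''] La])
qed

end

context lq
begin

lemma obtain_noise:
  assumes "t \<in> {0..T}"
  obtains N where "lq_noise g t N"
proof -
  have "std_brownian_motion (Om g) T (BM g)" using game by (simp add: lq_game_def)
  from brownian_standard_noise[OF this, of t] assms
  obtain N where N: "standard_noise (Om g) t T N" "AE w in Om g. \<forall>s\<in>{t..T}. N s w = BM g s w - BM g t w"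
    by auto
  have "lq_noise g t N"
    by (intro lq_noise.intro lq_axioms N(1) lq_noise_axioms.intro N(2)) (use assms in auto)
  then show thesis by (rule that)
qed

lemma value_fn_eq:
  "t \<in> {0..T} \<Longrightarrow> \<phi> \<in> profiles g \<Longrightarrow>
    value_fn g i \<phi> t x = quad_functional (sig g) T t x (ode_Psi g i \<phi>)"
  by (rule obtain_noise) (auto intro: lq_noise.value_fn_eq_functional)

lemma prob_deriv1_eq_pde:
  "t \<in> {0..T} \<Longrightarrow> \<phi> \<in> profiles g \<Longrightarrow> K' \<in> policies g h \<Longrightarrow>
    prob_deriv1 g i \<phi> t x h K' = pde_deriv1 g i \<phi> t x h K'"
  by (rule obtain_noise) (auto simp: pde_deriv1_eq intro: lq_noise.prob_deriv1_eq_functional)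

lemma prob_deriv2_eq_pde:
  "t \<in> {0..T} \<Longrightarrow> \<phi> \<in> profiles g \<Longrightarrow> K' \<in> policies g h \<Longrightarrow> K'' \<in> policies g l \<Longrightarrow>
    prob_deriv2 g i \<phi> t x h K' l K'' = pde_deriv2 g i \<phi> t x h K' l K''"
  by (rule obtain_noise) (auto simp: pde_deriv2_eq intro: lq_noise.prob_deriv2_eq_functional)

end

section \<open>Directional derivatives of the value\<close>

lemma uniform_limit_difference_quotient:
  fixes f :: "real \<Rightarrow> real \<Rightarrow> 'b::real_normed_vector"
  assumes f: "\<And>r s. r \<noteq> 0 \<Longrightarrow> s \<in> {a..b} \<Longrightarrow> f r s = f 0 s + r *\<^sub>R (c r s + r *\<^sub>R d s)"
    and c: "uniform_limit {a..b} c l (at 0)" and d: "continuous_on {a..b} d"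
  shows "uniform_limit {a..b} (\<lambda>r s. (f r s - f 0 s) /\<^sub>R r) l (at 0)"
proof -
  obtain C where C: "0 \<le> C" "\<And>s. s \<in> {a..b} \<Longrightarrow> norm (d s) \<le> C"
    using continuous_on_norm_bound[OF d] by blast
  have rd: "uniform_limit {a..b} (\<lambda>r s. r *\<^sub>R d s) (\<lambda>s. 0) (at 0)"
  proof (rule uniform_limitI)
    fix e :: real assume e: "0 < e"
    have "\<forall>\<^sub>F r in at (0::real). \<bar>r\<bar> < e / (C + 1)"
      using eventually_at_ball[of "e / (C + 1)" "0::real" UNIV] e C(1)
      by (auto elim!: eventually_mono simp: dist_norm)
    then show "\<forall>\<^sub>F r in at (0::real). \<forall>s\<in>{a..b}. dist (r *\<^sub>R d s) 0 < e"
    proof (eventually_elim, intro ballI)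
      fix r :: real and s assume r: "\<bar>r\<bar> < e / (C + 1)" and s: "s \<in> {a..b}"
      have "\<bar>r\<bar> * norm (d s) \<le> \<bar>r\<bar> * (C + 1)" using C(2)[OF s] by (intro mult_left_mono) auto
      also have "\<dots> < e" using r C(1) by (simp add: field_simps)
      finally show "dist (r *\<^sub>R d s) 0 < e" by simp
    qed
  qed
  have "uniform_limit {a..b} (\<lambda>r s. c r s + r *\<^sub>R d s) (\<lambda>s. l s + 0) (at 0)"
    by (rule uniform_limit_add[OF c rd])
  moreover have "\<forall>\<^sub>F r in at (0::real). \<forall>s\<in>{a..b}. c r s + r *\<^sub>R d s = (f r s - f 0 s) /\<^sub>R r"
    unfolding eventually_at_filter by (rule always_eventually) (simp add: f)
  ultimately show ?thesis
    by (simp add: uniform_limit_cong[where f = "\<lambda>r s. c r s + r *\<^sub>R d s"])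
qed

lemma quad_functional_has_derivative:
  fixes P :: "real \<Rightarrow> real \<Rightarrow> real^'n^'n"
  assumes P: "\<And>r. continuous_on {0..T} (P r)" and t: "t \<in> {0..T}"
    and lim: "uniform_limit {0..T} (\<lambda>r s. (P r s - P 0 s) /\<^sub>R r) D (at 0)"
  shows "((\<lambda>r. quad_functional \<sigma> T t x (P r)) has_real_derivative quad_functional \<sigma> T t x D) (at 0)"
proof -
  define q where "q = (\<lambda>r s. (P r s - P 0 s) /\<^sub>R r)"
  define \<tau> where "\<tau> = (\<lambda>R. trace (transpose \<sigma> ** R ** \<sigma>))"
  have \<tau>: "bounded_linear \<tau>"
    unfolding \<tau>_def
    by (intro bounded_linear_compose[OF bounded_linear_trace]
        bounded_linear_compose[OF bounded_bilinear.bounded_linear_left[OF bounded_bilinear_matrix_mult]]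
        bounded_bilinear.bounded_linear_right[OF bounded_bilinear_matrix_mult])
  have qc: "continuous_on {0..T} (q r)" for r
    unfolding q_def by (intro continuous_intros P)
  have lim': "uniform_limit {0..T} q D (at 0)" using lim by (simp add: q_def)
  have sub: "{t..T} \<subseteq> {0..T}" using t by auto
  have eq: "(quad_functional \<sigma> T t x (P r) - quad_functional \<sigma> T t x (P 0)) / r
      = quad_functional \<sigma> T t x (q r)" for r
  proof -
    have i: "(\<lambda>s. \<tau> (P r s)) integrable_on {t..T}" for r
      by (intro integrable_continuous_real bounded_linear.continuous_on[OF \<tau>] continuous_on_subset[OF P sub])
    have "integral {t..T} (\<lambda>s. \<tau> (q r s))
        = (integral {t..T} (\<lambda>s. \<tau> (P r s)) - integral {t..T} (\<lambda>s. \<tau> (P 0 s))) / r"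
      by (simp add: q_def bounded_linear.linear[OF \<tau>, THEN linear_cmul] bounded_linear.linear[OF \<tau>, THEN linear_diff]
          Henstock_Kurzweil_Integration.integral_diff[OF i i] divide_inverse mult.commute)
    moreover have "x \<bullet> (q r t *v x) = (x \<bullet> (P r t *v x) - x \<bullet> (P 0 t *v x)) / r"
      by (simp add: q_def bounded_bilinear.scaleR_left[OF bounded_bilinear_matrix_vector_mult]
          matrix_vector_mult_diff_rdistrib inner_diff_right divide_inverse mult.commute)
    ultimately show ?thesis
      by (simp add: quad_functional_def \<tau>_def diff_divide_distrib add_divide_distrib)
  qed
  have lim1: "((\<lambda>r. x \<bullet> (q r t *v x)) \<longlongrightarrow> x \<bullet> (D t *v x)) (at 0)"
    by (intro tendsto_inner tendsto_const bounded_bilinear.tendsto[OF bounded_bilinear_matrix_vector_mult]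
        tendsto_uniform_limitI[OF lim' t])
  have lim2: "((\<lambda>r. integral {t..T} (\<lambda>s. \<tau> (q r s))) \<longlongrightarrow> integral {t..T} (\<lambda>s. \<tau> (D s))) (at 0)"
  proof -
    have "uniform_limit {t..T} (\<lambda>r s. \<tau> (q r s)) (\<lambda>s. \<tau> (D s)) (at 0)"
      by (rule bounded_linear.uniform_limit[OF \<tau> uniform_limit_on_subset[OF lim' sub]])
    moreover have "continuous_on {t..T} (\<lambda>s. \<tau> (q r s))" for r
      by (intro bounded_linear.continuous_on[OF \<tau>] continuous_on_subset[OF qc sub])
    ultimately obtain I J where IJ: "\<And>r. ((\<lambda>s. \<tau> (q r s)) has_integral I r) {t..T}"
        "((\<lambda>s. \<tau> (D s)) has_integral J) {t..T}" "(I \<longlongrightarrow> J) (at 0)"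
      by (rule uniform_limit_integral) auto
    have "I = (\<lambda>r. integral {t..T} (\<lambda>s. \<tau> (q r s)))"
      by (rule ext) (rule integral_unique[OF IJ(1), symmetric])
    then show ?thesis using IJ(3) unfolding integral_unique[OF IJ(2)] by simp
  qed
  have "((\<lambda>r. quad_functional \<sigma> T t x (q r)) \<longlongrightarrow> quad_functional \<sigma> T t x D) (at 0)"
    using tendsto_mult[OF tendsto_const[of "1/2"] tendsto_add[OF lim1 lim2]]
    unfolding quad_functional_def \<tau>_def .
  then show ?thesis by (simp add: DERIV_def eq)
qed

lemma cross_add_scaled:
  "cross R (K + r *\<^sub>R L) M = cross R K M + r *\<^sub>R cross R L M"
  by (simp add: cross_def transpose_simps matrix_mult_add_rdistrib matrix_add_ldistrib
      scalar_matrix_assoc[symmetric] matrix_scalar_ac scaleR_add_right algebra_simps)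

lemma congruence_add_scaled:
  "transpose (K + r *\<^sub>R L) ** R ** (K + r *\<^sub>R L)
    = transpose K ** R ** K + r *\<^sub>R (cross R K L + r *\<^sub>R (transpose L ** R ** L))"
  by (simp add: cross_def transpose_simps matrix_mult_add_rdistrib matrix_add_ldistrib
      scalar_matrix_assoc[symmetric] matrix_scalar_ac scaleR_add_right algebra_simps)

definition perturb :: "('p \<Rightarrow> real \<Rightarrow> 'v::real_vector) \<Rightarrow> 'p \<Rightarrow> (real \<Rightarrow> 'v) \<Rightarrow> real \<Rightarrow> 'p \<Rightarrow> real \<Rightarrow> 'v" where
  "perturb \<phi> h D r = \<phi>(h := \<lambda>s. \<phi> h s + r *\<^sub>R D s)"

lemma perturb_0 [simp]: "perturb \<phi> h D 0 = \<phi>"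
  by (simp add: perturb_def)

lemma perturb_perturb: "perturb (perturb \<phi> h D r) h D r' = perturb \<phi> h D (r + r')"
  by (simp add: perturb_def scaleR_add_left add.assoc)

lemma perturb_commute: "h \<noteq> l \<Longrightarrow> perturb (perturb \<phi> h D r) l E r' = perturb (perturb \<phi> l E r') h D r"
  by (simp add: perturb_def fun_upd_twist)

lemma perturb_profile: "\<phi> \<in> profiles g \<Longrightarrow> D \<in> policies g h \<Longrightarrow> perturb \<phi> h D r \<in> profiles g"
  unfolding perturb_def by (intro profiles_update policies_add_scaled) (auto intro: profiles_policy)

lemma DERIV_perturb:
  assumes "((\<lambda>r'. f (perturb (perturb \<phi> h D r) h D r')) has_real_derivative F) (at 0)"
  shows "((\<lambda>r. f (perturb \<phi> h D r)) has_real_derivative F) (at r)"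
  using assms DERIV_shift[of "\<lambda>r. f (perturb \<phi> h D r)" F 0 r] by (simp add: perturb_perturb add.commute)

section \<open>Potentials and mixed differences\<close>

text \<open>
  Players are added one at a time. With the potential \<open>\<Phi>\<close> of the players in \<open>S\<close>
  at hand, resetting player \<open>j\<close> to the base strategy and adding the gain of \<open>j\<close>
  gives a potential for \<open>insert j S\<close>: for \<open>j\<close> this is immediate, and for
  \<open>i \<in> S\<close> the gain of \<open>j\<close> contributes the mixed difference of \<open>V j\<close>, which
  may be exchanged for that of \<open>V i\<close>.
\<close>

theorem potential_exists:
  fixes V :: "'p::finite \<Rightarrow> ('p \<Rightarrow> 'k) \<Rightarrow> real" and A :: "'p \<Rightarrow> 'k set"
  assumes base: "\<And>i. z i \<in> A i"
    and mixed: "\<And>i j \<phi> k k'. i \<noteq> j \<Longrightarrow> \<phi> \<in> {\<phi>. \<forall>i. \<phi> i \<in> A i} \<Longrightarrow> k \<in> A i \<Longrightarrow> k' \<in> A j \<Longrightarrow>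
      V i (\<phi>(i := k, j := k')) - V i (\<phi>(j := k')) - (V i (\<phi>(i := k)) - V i \<phi>)
      = V j (\<phi>(i := k, j := k')) - V j (\<phi>(j := k')) - (V j (\<phi>(i := k)) - V j \<phi>)"
  shows "\<exists>\<Phi>. \<forall>i. \<forall>\<phi>\<in>{\<phi>. \<forall>i. \<phi> i \<in> A i}. \<forall>k\<in>A i. \<Phi> (\<phi>(i := k)) - \<Phi> \<phi> = V i (\<phi>(i := k)) - V i \<phi>"
proof -
  have "\<exists>\<Phi>. \<forall>i\<in>S. \<forall>\<phi>\<in>{\<phi>. \<forall>i. \<phi> i \<in> A i}. \<forall>k\<in>A i. \<Phi> (\<phi>(i := k)) - \<Phi> \<phi> = V i (\<phi>(i := k)) - V i \<phi>"
    if "finite S" for S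
    using that
  proof (induction S)
    case (insert j S)
    then obtain \<Phi> where \<Phi>: "\<And>i \<phi> k. i \<in> S \<Longrightarrow> \<phi> \<in> {\<phi>. \<forall>i. \<phi> i \<in> A i} \<Longrightarrow> k \<in> A i \<Longrightarrow>
        \<Phi> (\<phi>(i := k)) - \<Phi> \<phi> = V i (\<phi>(i := k)) - V i \<phi>" by blast
    define \<Phi>' where "\<Phi>' = (\<lambda>\<phi>. \<Phi> (\<phi>(j := z j)) + V j \<phi> - V j (\<phi>(j := z j)))"
    have "\<Phi>' (\<phi>(i := k)) - \<Phi>' \<phi> = V i (\<phi>(i := k)) - V i \<phi>"
      if i: "i \<in> insert j S" and \<phi>: "\<phi> \<in> {\<phi>. \<forall>i. \<phi> i \<in> A i}" and k: "k \<in> A i" for i \<phi> k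
    proof (cases "i = j")
      case False
      let ?\<psi> = "\<phi>(j := z j)"
      have \<psi>: "?\<psi> \<in> {\<phi>. \<forall>i. \<phi> i \<in> A i}" using \<phi> base by auto
      have "\<Phi> (?\<psi>(i := k)) - \<Phi> ?\<psi> = V i (?\<psi>(i := k)) - V i ?\<psi>"
        using i False by (intro \<Phi> \<psi> k) auto
      moreover have "V i (?\<psi>(i := k, j := \<phi> j)) - V i (?\<psi>(j := \<phi> j)) - (V i (?\<psi>(i := k)) - V i ?\<psi>)
          = V j (?\<psi>(i := k, j := \<phi> j)) - V j (?\<psi>(j := \<phi> j)) - (V j (?\<psi>(i := k)) - V j ?\<psi>)"
        using \<phi> by (intro mixed False \<psi> k) auto
      moreover have "?\<psi>(i := k, j := \<phi> j) = \<phi>(i := k)" "?\<psi>(j := \<phi> j) = \<phi>"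
        "?\<psi>(i := k) = \<phi>(i := k, j := z j)"
        using False by (auto simp: fun_eq_iff)
      ultimately show ?thesis by (simp add: \<Phi>'_def)
    qed (simp add: \<Phi>'_def)
    then show ?case by (intro exI[of _ \<Phi>'] ballI)
  qed simp
  from this[of UNIV] show ?thesis by simp
qed

context lq
begin

lemma stack_perturb:
  assumes \<phi>: "\<phi> \<in> profiles g" and D: "D \<in> policies g h"
  shows "KK (perturb \<phi> h D r) s = KK \<phi> s + r *\<^sub>R D s"
proof -
  have "perturb \<phi> h D r i s = \<phi> i s + (if i = h then r *\<^sub>R D s else 0)" for i
    by (simp add: perturb_def)
  then show ?thesis
    by (simp add: stack_eq_sum[OF perturb_profile[OF \<phi> D]] stack_eq_sum[OF \<phi>] sum.distrib)
qed

lemma closed_loop_perturb: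
  assumes "\<phi> \<in> profiles g" "D \<in> policies g h"
  shows "AA (perturb \<phi> h D r) s = AA \<phi> s + r *\<^sub>R BK D s"
  by (simp add: closed_loop_def stack_perturb[OF assms] matrix_add_ldistrib matrix_scalar_ac
      scalar_matrix_assoc)

text \<open>
  The coefficient of the equation for \<open>\<Psi>\<close> is affine in the step \<open>r\<close> and its
  inhomogeneity is quadratic in it, so the derivative solves the equation defining
  \<open>\<Theta>\<close>.
\<close>

lemma Psi_difference_quotient:
  assumes \<phi>: "\<phi> \<in> profiles g" and D: "D \<in> policies g h"
  shows "uniform_limit {0..T} (\<lambda>r s. (ode_Psi g i (perturb \<phi> h D r) s - ode_Psi g i \<phi> s) /\<^sub>R r)
    (ode_Theta g i \<phi> h D) (at 0)"
proof -
  note prof = perturb_profile[OF \<phi> D]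
  let ?F = "\<lambda>r. Psi_source i (perturb \<phi> h D r)"
  have F: "uniform_limit {0..T} (\<lambda>r s. (?F r s - ?F 0 s) /\<^sub>R r) (\<lambda>s. cross (cR g i s) (KK \<phi> s) (D s)) (at 0)"
  proof (rule uniform_limit_difference_quotient[where c = "\<lambda>r s. cross (cR g i s) (KK \<phi> s) (D s)"
        and d = "\<lambda>s. transpose (D s) ** cR g i s ** D s"])
    show "?F r s = ?F 0 s + r *\<^sub>R (cross (cR g i s) (KK \<phi> s) (D s)
        + r *\<^sub>R (transpose (D s) ** cR g i s ** D s))" for r s
      by (simp add: Psi_source_def stack_perturb[OF \<phi> D] congruence_add_scaled add.assoc)
    show "continuous_on {0..T} (\<lambda>s. transpose (D s) ** cR g i s ** D s)"
      by (intro cont_intros policies_continuous[OF D])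
  qed (rule uniform_limit_const)
  have Th: "lyapunov T (AA \<phi>) (\<lambda>s. lyap_op (BK D s) (ode_Psi g i (perturb \<phi> h D 0) s)
        + cross (cR g i s) (KK \<phi> s) (D s)) (ode_Theta g i \<phi> h D)"
    using Theta_solution[OF \<phi> D, of i] by (simp add: Theta_source_def[abs_def])
  have Ps: "lyapunov T (\<lambda>s. AA \<phi> s + r *\<^sub>R BK D s) (?F r) (ode_Psi g i (perturb \<phi> h D r))" for r
    using Psi_solution[OF prof[of r], where i = i] by (simp add: closed_loop_perturb[OF \<phi> D, abs_def])
  have "ode_Psi g i (perturb \<phi> h D r) T = cG g i" "ode_Theta g i \<phi> h D T = 0" for r
    using Psi_solution[OF prof[of r], where i = i] Theta_solution[OF \<phi> D, of i] by blast+
  from lyapunov_difference_quotient[OF closed_loop_continuous[OF \<phi>] BK_continuous[OF D] Ps this(1) F Th this(2)]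
  show ?thesis by simp
qed

text \<open>
  The inhomogeneity of the equation for \<open>\<Theta>\<close> depends on the profile also through
  \<open>\<Psi>\<close>, whose derivative in the new direction is the other \<open>\<Theta>\<close>; this is
  why \<open>\<Lambda>\<close> contains both.
\<close>

lemma Theta_difference_quotient:
  assumes \<phi>: "\<phi> \<in> profiles g" and K': "K' \<in> policies g h" and D: "D \<in> policies g l"
  shows "uniform_limit {0..T} (\<lambda>r s. (ode_Theta g i (perturb \<phi> l D r) h K' s - ode_Theta g i \<phi> h K' s) /\<^sub>R r)
    (ode_Lambda g i \<phi> h K' l D) (at 0)"
proof -
  note prof = perturb_profile[OF \<phi> D]
  interpret L: bounded_bilinear "lyap_op :: real^'x^'x \<Rightarrow> _" by (rule bounded_bilinear_lyap_op)
  let ?F = "\<lambda>r. Theta_source i (perturb \<phi> l D r) K'"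
  let ?q = "\<lambda>r s. (ode_Psi g i (perturb \<phi> l D r) s - ode_Psi g i \<phi> s) /\<^sub>R r"
  let ?F1 = "\<lambda>s. lyap_op (BK K' s) (ode_Theta g i \<phi> l D s) + cross (cR g i s) (D s) (K' s)"
  have F: "uniform_limit {0..T} (\<lambda>r s. (?F r s - ?F 0 s) /\<^sub>R r) ?F1 (at 0)"
  proof (rule uniform_limit_difference_quotient[where d = "\<lambda>s. 0" and
        c = "\<lambda>r s. lyap_op (BK K' s) (?q r s) + cross (cR g i s) (D s) (K' s)"])
    show "?F r s = ?F 0 s + r *\<^sub>R (lyap_op (BK K' s) (?q r s) + cross (cR g i s) (D s) (K' s) + r *\<^sub>R 0)"
      if "r \<noteq> 0" for r s
      using that by (simp add: Theta_source_def stack_perturb[OF \<phi> D] cross_add_scaled L.scaleR_right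
          L.diff_right scaleR_add_right)
    have Thc: "continuous_on {0..T} (ode_Theta g i \<phi> l D)"
      using Theta_solution[OF \<phi> D, of i] lyapunov_continuous by blast
    show "uniform_limit {0..T} (\<lambda>r s. lyap_op (BK K' s) (?q r s) + cross (cR g i s) (D s) (K' s)) ?F1 (at 0)"
      by (intro uniform_limit_add uniform_limit_const L.bounded_uniform_limit
          Psi_difference_quotient \<phi> D compact_imp_bounded compact_continuous_image
          BK_continuous[OF K'] Thc compact_Icc)
  qed simp
  have La: "lyapunov T (AA \<phi>) (\<lambda>s. lyap_op (BK D s) (ode_Theta g i (perturb \<phi> l D 0) h K' s) + ?F1 s)
      (ode_Lambda g i \<phi> h K' l D)"
    using Lambda_solution[OF \<phi> K' D, of i] by (simp add: Lambda_source_def[abs_def] add.assoc)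
  have Th: "lyapunov T (\<lambda>s. AA \<phi> s + r *\<^sub>R BK D s) (?F r) (ode_Theta g i (perturb \<phi> l D r) h K')" for r
    using Theta_solution[OF prof[of r] K', where i = i] by (simp add: closed_loop_perturb[OF \<phi> D, abs_def])
  have "ode_Theta g i (perturb \<phi> l D r) h K' T = 0" "ode_Lambda g i \<phi> h K' l D T = 0" for r
    using Theta_solution[OF prof[of r] K', where i = i] Lambda_solution[OF \<phi> K' D, of i] by blast+
  from lyapunov_difference_quotient[OF closed_loop_continuous[OF \<phi>] BK_continuous[OF D] Th this(1) F La this(2)]
  show ?thesis by simp
qed

lemma value_fn_has_derivative:
  assumes \<phi>: "\<phi> \<in> profiles g" and D: "D \<in> policies g h" and t: "t \<in> {0..T}"
  shows "((\<lambda>r. value_fn g i (perturb \<phi> h D r) t x) has_real_derivative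
    pde_deriv1 g i (perturb \<phi> h D r) t x h D) (at r)"
proof (rule DERIV_perturb)
  note prof = perturb_profile[OF \<phi> D, of r]
  note prof' = perturb_profile[OF prof D]
  have c: "continuous_on {0..T} (ode_Psi g i (perturb (perturb \<phi> h D r) h D r'))" for r'
    using Psi_solution[OF prof'[of r'], where i = i] lyapunov_continuous by blast
  show "((\<lambda>r'. value_fn g i (perturb (perturb \<phi> h D r) h D r') t x) has_real_derivative
    pde_deriv1 g i (perturb \<phi> h D r) t x h D) (at 0)"
    unfolding value_fn_eq[OF t prof'] pde_deriv1_eq[OF prof D t]
    by (rule quad_functional_has_derivative[OF c t]) (simp add: Psi_difference_quotient[OF prof D])
qed

lemma pde_deriv1_has_derivative:
  assumes \<phi>: "\<phi> \<in> profiles g" and K': "K' \<in> policies g h" and D: "D \<in> policies g l" and t: "t \<in> {0..T}"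
  shows "((\<lambda>r. pde_deriv1 g i (perturb \<phi> l D r) t x h K') has_real_derivative
    pde_deriv2 g i (perturb \<phi> l D r) t x h K' l D) (at r)"
proof (rule DERIV_perturb)
  note prof = perturb_profile[OF \<phi> D, of r]
  note prof' = perturb_profile[OF prof D]
  have c: "continuous_on {0..T} (ode_Theta g i (perturb (perturb \<phi> l D r) l D r') h K')" for r'
    using Theta_solution[OF prof'[of r'] K', where i = i] lyapunov_continuous by blast
  show "((\<lambda>r'. pde_deriv1 g i (perturb (perturb \<phi> l D r) l D r') t x h K') has_real_derivative
    pde_deriv2 g i (perturb \<phi> l D r) t x h K' l D) (at 0)"
    unfolding pde_deriv1_eq[OF prof' K' t] pde_deriv2_eq[OF prof K' D t]
    by (rule quad_functional_has_derivative[OF c t]) (simp add: Theta_difference_quotient[OF prof K' D])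
qed

lemma pde_deriv2_swap:
  assumes "\<phi> \<in> profiles g" "K' \<in> policies g h" "K'' \<in> policies g l" "t \<in> {0..T}"
  shows "pde_deriv2 g i \<phi> t x h K' l K'' = pde_deriv2 g i \<phi> t x l K'' h K'"
  unfolding pde_deriv2_eq[OF assms] pde_deriv2_eq[OF assms(1,3,2,4)] Lambda_swap[OF assms(2,3)] ..

abbreviation value2 where
  "value2 k \<phi> i D j E t x r s \<equiv> value_fn g k (perturb (perturb \<phi> i D r) j E s) t x"

text \<open>
  A function with derivative 0 is constant, applied twice: by symmetry of the second derivatives, the
  difference of the two players' derivatives in direction \<open>D\<close> is constant along \<open>E\<close>;
  hence the increment along \<open>E\<close> of the difference of their values has derivative 0 in
  direction \<open>D\<close>.
\<close>

lemma mixed_difference_eq: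
  assumes t: "t \<in> {0..T}" and ij: "i \<noteq> j" and \<phi>: "\<phi> \<in> profiles g"
    and D: "D \<in> policies g i" and E: "E \<in> policies g j"
    and sym: "\<And>\<psi>. \<psi> \<in> profiles g \<Longrightarrow> pde_deriv2 g i \<psi> t x i D j E = pde_deriv2 g j \<psi> t x j E i D"
  shows "value2 i \<phi> i D j E t x 1 1 - value2 i \<phi> i D j E t x 0 1
      - (value2 i \<phi> i D j E t x 1 0 - value2 i \<phi> i D j E t x 0 0)
    = value2 j \<phi> i D j E t x 1 1 - value2 j \<phi> i D j E t x 0 1
      - (value2 j \<phi> i D j E t x 1 0 - value2 j \<phi> i D j E t x 0 0)"
proof -
  let ?V = "\<lambda>k. value2 k \<phi> i D j E t x"
  let ?d = "\<lambda>k r s. pde_deriv1 g k (perturb (perturb \<phi> i D r) j E s) t x i D"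
  have dV: "((\<lambda>r. ?V k r s) has_real_derivative ?d k r s) (at r)" for k r s
    using value_fn_has_derivative[OF perturb_profile[OF \<phi> E, of s] D t, of k x r]
    by (simp add: perturb_commute[OF ij])
  have dd: "((\<lambda>s. ?d i r s - ?d j r s) has_real_derivative 0) (at s)" for r s
  proof -
    have "((\<lambda>s. ?d i r s - ?d j r s) has_real_derivative
        pde_deriv2 g i (perturb (perturb \<phi> i D r) j E s) t x i D j E
        - pde_deriv2 g j (perturb (perturb \<phi> i D r) j E s) t x i D j E) (at s)"
      by (intro DERIV_diff pde_deriv1_has_derivative perturb_profile \<phi> D E t)
    moreover have "perturb (perturb \<phi> i D r) j E s \<in> profiles g" by (intro perturb_profile \<phi> D E)
    ultimately show ?thesis by (simp add: sym pde_deriv2_swap[OF _ D E t, of _ j])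
  qed
  have d_const: "?d i r 1 - ?d j r 1 = ?d i r 0 - ?d j r 0" for r
    using DERIV_isconst_all[of "\<lambda>s. ?d i r s - ?d j r s" 1 0] dd[of r] by simp
  let ?G = "\<lambda>r. ?V i r 1 - ?V i r 0 - (?V j r 1 - ?V j r 0)"
  have "(?G has_real_derivative 0) (at r)" for r
  proof -
    have "(?G has_real_derivative (?d i r 1 - ?d i r 0 - (?d j r 1 - ?d j r 0))) (at r)"
      by (intro DERIV_diff dV)
    then show ?thesis using d_const[of r] by (simp add: algebra_simps)
  qed
  then have "?G 1 = ?G 0" using DERIV_isconst_all[of ?G 1 0] by simp
  then show ?thesis by simp
qed

lemma closed_loop_potentialI:
  assumes t: "t \<in> {0..T}"
    and sym: "\<And>i j \<phi> K' K''. i \<noteq> j \<Longrightarrow> \<phi> \<in> profiles g \<Longrightarrow> K' \<in> policies g i \<Longrightarrow> K'' \<in> policies g j \<Longrightarrow>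
      pde_deriv2 g i \<phi> t x i K' j K'' = pde_deriv2 g j \<phi> t x j K'' i K'"
  shows "closed_loop_potential_game g t x"
proof -
  have prof: "profiles g = {\<phi>. \<forall>i. \<phi> i \<in> policies g i}" by (simp add: profiles_def)
  have "\<exists>\<Phi>. \<forall>i. \<forall>\<phi>\<in>{\<phi>. \<forall>i. \<phi> i \<in> policies g i}. \<forall>K\<in>policies g i.
      \<Phi> (\<phi>(i := K)) - \<Phi> \<phi> = value_fn g i (\<phi>(i := K)) t x - value_fn g i \<phi> t x"
  proof (rule potential_exists[where z = "\<lambda>i s. 0"])
    show "(\<lambda>s. 0) \<in> policies g i" for i by (rule zero_policy)
    fix i j and \<phi> :: "'p \<Rightarrow> real \<Rightarrow> real^'x^'a" and K K'
    assume ij: "i \<noteq> j" and \<phi>': "\<phi> \<in> {\<phi>. \<forall>i. \<phi> i \<in> policies g i}"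
      and K: "K \<in> policies g i" "K' \<in> policies g j"
    have \<phi>: "\<phi> \<in> profiles g" using \<phi>' by (simp add: prof)
    have D: "(\<lambda>s. K s - \<phi> i s) \<in> policies g i" "(\<lambda>s. K' s - \<phi> j s) \<in> policies g j"
      by (rule policies_diff[OF K(1) profiles_policy[OF \<phi>]], rule policies_diff[OF K(2) profiles_policy[OF \<phi>]])
    show "value_fn g i (\<phi>(i := K, j := K')) t x - value_fn g i (\<phi>(j := K')) t x
        - (value_fn g i (\<phi>(i := K)) t x - value_fn g i \<phi> t x)
      = value_fn g j (\<phi>(i := K, j := K')) t x - value_fn g j (\<phi>(j := K')) t x
        - (value_fn g j (\<phi>(i := K)) t x - value_fn g j \<phi> t x)"
      using mixed_difference_eq[OF t ij \<phi> D sym[OF ij _ D]] ij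
      by (simp add: perturb_def fun_upd_idem[of "\<phi>(i := K)" j "\<phi> j"])
  qed
  then show ?thesis by (simp add: closed_loop_potential_game_def is_potential_def prof)
qed

text \<open>
  A potential has the same mixed difference as each of the two values, so the two mixed differences
  agree for all steps; differentiating in both steps at 0 gives the second derivatives.
\<close>

lemma potential_symmetry:
  assumes t: "t \<in> {0..T}" and ij: "i \<noteq> j" and \<phi>: "\<phi> \<in> profiles g"
    and D: "D \<in> policies g i" and E: "E \<in> policies g j" and \<Phi>: "is_potential g t x \<Phi>"
  shows "pde_deriv2 g i \<phi> t x i D j E = pde_deriv2 g j \<phi> t x j E i D"
proof -
  let ?V = "\<lambda>k. value2 k \<phi> i D j E t x"
  let ?d = "\<lambda>k s. pde_deriv1 g k (perturb \<phi> j E s) t x i D"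
  have pot: "\<Phi> (perturb \<psi> k L r) - \<Phi> \<psi> = value_fn g k (perturb \<psi> k L r) t x - value_fn g k \<psi> t x"
    if "\<psi> \<in> profiles g" "L \<in> policies g k" for \<psi> k L r
    using \<Phi> that unfolding is_potential_def perturb_def
    by (auto intro!: policies_add_scaled intro: profiles_policy)
  have mixed: "?V i r s - ?V i 0 s - (?V i r 0 - ?V i 0 0) = ?V j r s - ?V j 0 s - (?V j r 0 - ?V j 0 0)" for r s
    using pot[OF perturb_profile[OF \<phi> E, of s] D, of r] pot[OF \<phi> D, of r]
      pot[OF perturb_profile[OF \<phi> D, of r] E, of s] pot[OF \<phi> E, of s]
    by (simp add: perturb_commute[OF ij])
  have dV: "((\<lambda>r. ?V k r s) has_real_derivative ?d k s) (at 0)" for k s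
    using value_fn_has_derivative[OF perturb_profile[OF \<phi> E, of s] D t, of k x 0]
    by (simp add: perturb_commute[OF ij])
  have d: "?d i s - ?d i 0 = ?d j s - ?d j 0" for s
  proof (rule DERIV_unique)
    show "((\<lambda>r. ?V i r s - ?V i r 0) has_real_derivative ?d i s - ?d i 0) (at 0)"
      by (intro DERIV_diff dV)
    have "(\<lambda>r. ?V i r s - ?V i r 0) = (\<lambda>r. ?V j r s - ?V j r 0 + (?V i 0 s - ?V i 0 0 - (?V j 0 s - ?V j 0 0)))"
      using mixed[of _ s] by (auto simp: fun_eq_iff algebra_simps)
    moreover have "(\<dots> has_real_derivative ?d j s - ?d j 0 + 0) (at 0)"
      by (intro DERIV_add DERIV_diff dV DERIV_const)
    ultimately show "((\<lambda>r. ?V i r s - ?V i r 0) has_real_derivative ?d j s - ?d j 0) (at 0)" by simp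
  qed
  have dd: "((\<lambda>s. ?d k s - ?d k 0) has_real_derivative pde_deriv2 g k \<phi> t x i D j E) (at 0)" for k
    using DERIV_diff[OF pde_deriv1_has_derivative[OF \<phi> D E t, of k x 0] DERIV_const[of "?d k 0"]] by simp
  have "pde_deriv2 g i \<phi> t x i D j E = pde_deriv2 g j \<phi> t x i D j E"
    using dd[of i] dd[of j] unfolding d by (rule DERIV_unique)
  also have "\<dots> = pde_deriv2 g j \<phi> t x j E i D" by (rule pde_deriv2_swap[OF \<phi> D E t])
  finally show ?thesis .
qed

text \<open>
  From left to right the integrals defining the constants are equal. From right to left the state 0
  isolates the constants, and the quadratic form of a symmetric matrix determines the matrix by
  polarisation.
\<close>

lemma Lambda_eq_iff:
  assumes ij: "\<phi> \<in> profiles g" "K' \<in> policies g i" "K'' \<in> policies g j"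
  shows "(\<forall>t\<in>{0..T}. ode_Lambda g i \<phi> i K' j K'' t = ode_Lambda g j \<phi> j K'' i K' t) \<longleftrightarrow>
    (\<forall>t\<in>{0..T}. \<forall>x. pde_deriv2 g i \<phi> t x i K' j K'' = pde_deriv2 g j \<phi> t x j K'' i K')"
proof (intro iffI ballI allI)
  fix t x assume eq: "\<forall>t\<in>{0..T}. ode_Lambda g i \<phi> i K' j K'' t = ode_Lambda g j \<phi> j K'' i K' t" and t: "t \<in> {0..T}"
  then have "integral {t..T} (\<lambda>s. trace (transpose (sig g) ** ode_Lambda g i \<phi> i K' j K'' s ** sig g))
      = integral {t..T} (\<lambda>s. trace (transpose (sig g) ** ode_Lambda g j \<phi> j K'' i K' s ** sig g))"
    by (intro Henstock_Kurzweil_Integration.integral_cong) auto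
  then show "pde_deriv2 g i \<phi> t x i K' j K'' = pde_deriv2 g j \<phi> t x j K'' i K'"
    using eq t ij by (simp add: pde_deriv2_eq quad_functional_def)
next
  fix t assume eq: "\<forall>t\<in>{0..T}. \<forall>x. pde_deriv2 g i \<phi> t x i K' j K'' = pde_deriv2 g j \<phi> t x j K'' i K'" and t: "t \<in> {0..T}"
  let ?L = "ode_Lambda g i \<phi> i K' j K'' t" and ?L' = "ode_Lambda g j \<phi> j K'' i K' t"
  have sy: "sym_mat ?L" "sym_mat ?L'"
    using Lambda_solution[OF ij(1,2,3), of i] Lambda_solution[OF ij(1,3,2), of j] t by auto
  have q: "x \<bullet> (?L *v x) = x \<bullet> (?L' *v x)" for x
  proof -
    have "pde_deriv2 g i \<phi> t x i K' j K'' = pde_deriv2 g j \<phi> t x j K'' i K'"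
      "pde_deriv2 g i \<phi> t 0 i K' j K'' = pde_deriv2 g j \<phi> t 0 j K'' i K'" using eq t by auto
    then show ?thesis by (simp add: pde_deriv2_def)
  qed
  have b: "x \<bullet> (?L *v y) = x \<bullet> (?L' *v y)" for x y
    using q[of "x + y"] q[of x] q[of y] sym_mat_inner[OF sy(1), of x y] sym_mat_inner[OF sy(2), of x y]
    by (simp add: matrix_vector_right_distrib inner_add_left inner_add_right)
  show "?L = ?L'"
    unfolding matrix_eq by (auto intro: vector_eq_ldot[THEN iffD1] simp: b)
qed

lemma markov_potential_iff:
  "markov_potential_game g \<longleftrightarrow>
    (\<forall>i j. i \<noteq> j \<longrightarrow> (\<forall>\<phi>\<in>profiles g. \<forall>K'\<in>policies g i. \<forall>K''\<in>policies g j. \<forall>t\<in>{0..T}.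
      ode_Lambda g i \<phi> i K' j K'' t = ode_Lambda g j \<phi> j K'' i K' t))"
proof
  assume "markov_potential_game g"
  then obtain \<Phi> where \<Phi>: "\<And>t x. t \<in> {0..T} \<Longrightarrow> is_potential g t x (\<Phi> t x)"
    unfolding markov_potential_game_def by blast
  show "\<forall>i j. i \<noteq> j \<longrightarrow> (\<forall>\<phi>\<in>profiles g. \<forall>K'\<in>policies g i. \<forall>K''\<in>policies g j. \<forall>t\<in>{0..T}.
      ode_Lambda g i \<phi> i K' j K'' t = ode_Lambda g j \<phi> j K'' i K' t)"
  proof (intro allI impI ballI)
    fix i j \<phi> K' K'' t
    assume *: "i \<noteq> j" "\<phi> \<in> profiles g" "K' \<in> policies g i" "K'' \<in> policies g j" and t: "t \<in> {0..T}"
    have "\<forall>t\<in>{0..T}. \<forall>x. pde_deriv2 g i \<phi> t x i K' j K'' = pde_deriv2 g j \<phi> t x j K'' i K'"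
      using potential_symmetry[OF _ * \<Phi>] by blast
    then show "ode_Lambda g i \<phi> i K' j K'' t = ode_Lambda g j \<phi> j K'' i K' t"
      using Lambda_eq_iff[OF *(2-4)] t by blast
  qed
next
  assume L: "\<forall>i j. i \<noteq> j \<longrightarrow> (\<forall>\<phi>\<in>profiles g. \<forall>K'\<in>policies g i. \<forall>K''\<in>policies g j. \<forall>t\<in>{0..T}.
      ode_Lambda g i \<phi> i K' j K'' t = ode_Lambda g j \<phi> j K'' i K' t)"
  have "closed_loop_potential_game g t x" if t: "t \<in> {0..T}" for t x
  proof (rule closed_loop_potentialI[OF t])
    fix i j \<phi> K' K''
    assume *: "i \<noteq> j" "\<phi> \<in> profiles g" "K' \<in> policies g i" "K'' \<in> policies g j"
    show "pde_deriv2 g i \<phi> t x i K' j K'' = pde_deriv2 g j \<phi> t x j K'' i K'"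
      using Lambda_eq_iff[OF *(2-4)] L * t by blast
  qed
  then have "\<forall>t x. \<exists>\<Phi>. t \<in> {0..T} \<longrightarrow> is_potential g t x \<Phi>"
    unfolding closed_loop_potential_game_def by blast
  then obtain \<Phi> where "\<forall>t x. t \<in> {0..T} \<longrightarrow> is_potential g t x (\<Phi> t x)" by metis
  then show "markov_potential_game g" unfolding markov_potential_game_def by blast
qed

end

theorem theorem4p6:
  fixes g :: "('x::finite, 'a::finite, 'w::finite, 'p::finite, 'o) lq_data"
  assumes "lq_game g"
  shows "(\<forall>i h l. \<forall>\<phi>\<in>profiles g. \<forall>K'\<in>policies g h. \<forall>K''\<in>policies g l.
            \<forall>t\<in>{0..horizon g}. \<forall>x.
            prob_deriv1 g i \<phi> t x h K' = pde_deriv1 g i \<phi> t x h K' \<and>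
            prob_deriv2 g i \<phi> t x h K' l K'' = pde_deriv2 g i \<phi> t x h K' l K'')
       \<and> (\<forall>t\<in>{0..horizon g}. \<forall>x.
            (\<forall>\<phi>\<in>profiles g. \<forall>i j. \<forall>K'\<in>policies g i. \<forall>K''\<in>policies g j.
               prob_deriv2 g i \<phi> t x i K' j K'' = prob_deriv2 g j \<phi> t x j K'' i K')
            \<longleftrightarrow>
            (\<forall>\<phi>\<in>profiles g. \<forall>i j. \<forall>K'\<in>policies g i. \<forall>K''\<in>policies g j.
               pde_deriv2 g i \<phi> t x i K' j K'' = pde_deriv2 g j \<phi> t x j K'' i K'))
       \<and> (\<forall>t\<in>{0..horizon g}. \<forall>x.
            (\<forall>i j. i \<noteq> j \<longrightarrow>
               (\<forall>\<phi>\<in>profiles g. \<forall>K'\<in>policies g i. \<forall>K''\<in>policies g j.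
                  1/2 * (x \<bullet> (ode_Lambda g i \<phi> i K' j K'' t *v x)) + ode_lambda g i \<phi> i K' j K'' t
                = 1/2 * (x \<bullet> (ode_Lambda g j \<phi> j K'' i K' t *v x)) + ode_lambda g j \<phi> j K'' i K' t))
            \<longrightarrow> closed_loop_potential_game g t x)
       \<and> (markov_potential_game g \<longleftrightarrow>
            (\<forall>i j. i \<noteq> j \<longrightarrow>
               (\<forall>\<phi>\<in>profiles g. \<forall>K'\<in>policies g i. \<forall>K''\<in>policies g j.
                  \<forall>t\<in>{0..horizon g}.
                    ode_Lambda g i \<phi> i K' j K'' t = ode_Lambda g j \<phi> j K'' i K' t)))"
proof -
  interpret lq g by (rule lq.intro[OF assms])
  show ?thesis
  proof (intro conjI, goal_cases)
    case 1
    show ?case by (simp add: prob_deriv1_eq_pde prob_deriv2_eq_pde)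
  next
    case 2
    show ?case by (simp add: prob_deriv2_eq_pde)
  next
    case 3
    show ?case unfolding pde_deriv2_def[symmetric] by (blast intro: closed_loop_potentialI)
  qed (rule markov_potential_iff)
qed

end
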